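(* Let $p\ge0$ be an integer, let $q\ge1$ be an odd integer, let $\underline{D}\subseteq\mathbb{R}^{p+1}$ be a domain invariant under the reflection $(\underline{\boldsymbol{x}}_p,r)\mapsto(\underline{\boldsymbol{x}}_p,-r)$ of the $(p+1)$-th variable, and let $f(\underline{\boldsymbol{x}})=F_1(\underline{\boldsymbol{x}}')+\underline{\omega}F_2(\underline{\boldsymbol{x}}')$ be a generalized partial-slice function on $\Omega_{\underline{D}}\subseteq\mathbb{R}^{p+q}$ with $\mathbb{R}_{p+q}$-valued components $F_1,F_2\in C^1(\underline{D})$. Let $\lambda\in\mathbb{R}$ be a constant. If $F_1,F_2$ satisfy the Vekua-type system $$\begin{cases} D_{\underline{\boldsymbol{x}}_p}F_1(\underline{\boldsymbol{x}}')-\partial_rF_2(\underline{\boldsymbol{x}}')=\lambda F_1(\underline{\boldsymbol{x}}'),\\ -D_{\underline{\boldsymbol{x}}_p}F_2(\underline{\boldsymbol{x}}')+\partial_rF_1(\underline{\boldsymbol{x}}')=\lambda F_2(\underline{\boldsymbol{x}}'),\end{cases}\qquad \underline{\boldsymbol{x}}'=(\underline{\boldsymbol{x}}_p,r)\in\underline{D},$$ then $$(D_{\underline{\boldsymbol{x}}}-\lambda)\,(\Delta_{\underline{\boldsymbol{x}}}+\lambda^2)^{\frac{q-1}{2}}f(\underline{\boldsymbol{x}})=0\qquad\text{on }\Omega_{\underline{D}}.$$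
   Context: $\mathbb{R}_{p+q}$ is the real Clifford algebra generated by $e_1,\dots,e_{p+q}$ with $e_ie_j+e_je_i=-2\delta_{ij}$. Elements of $\mathbb{R}^{p+q}$ are identified with $1$-vectors $\underline{\boldsymbol{x}}=\underline{\boldsymbol{x}}_p+\underline{\boldsymbol{x}}_q$, where $\underline{\boldsymbol{x}}_p=\sum_{i=1}^px_ie_i\in\mathbb{R}^p$ and $\underline{\boldsymbol{x}}_q=\sum_{i=p+1}^{p+q}x_ie_i\in\mathbb{R}^q$ (no $x_0$ variable appears). $\mathbb{S}=\{\underline{\boldsymbol{x}}_q:\ \underline{\boldsymbol{x}}_q^2=-1\}$ is the unit sphere of $\mathbb{R}^q$, and $\underline{\boldsymbol{x}}_q=r\underline{\omega}$ with $r=|\underline{\boldsymbol{x}}_q|\ge0$, $\underline{\omega}\in\mathbb{S}$. Operators (acting from the left): $D_{\underline{\boldsymbol{x}}_p}=\sum_{i=1}^pe_i\partial_{x_i}$, $D_{\underline{\boldsymbol{x}}}=\sum_{i=1}^{p+q}e_i\partial_{x_i}$, $\Delta_{\underline{\boldsymbol{x}}}=\sum_{i=1}^{p+q}\partial_{x_i}^2$. The partially symmetric completion of $\underline{D}$ is $\Omega_{\underline{D}}=\{\underline{\boldsymbol{x}}_p+r\underline{\omega}:\ \underline{\omega}\in\mathbb{S},\ r\ge0,\ (\underline{\boldsymbol{x}}_p,r)\in\underline{D}\}\subseteq\mathbb{R}^{p+q}$. A function $f:\Omega_{\underline{D}}\to\mathbb{R}_{p+q}$ is a generalized partial-slice function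 with components $F_1,F_2:\underline{D}\to\mathbb{R}_{p+q}$ if $f(\underline{\boldsymbol{x}}_p+r\underline{\omega})=F_1(\underline{\boldsymbol{x}}_p,r)+\underline{\omega}F_2(\underline{\boldsymbol{x}}_p,r)$ on $\Omega_{\underline{D}}$, where $F_1(\underline{\boldsymbol{x}}_p,-r)=F_1(\underline{\boldsymbol{x}}_p,r)$ and $F_2(\underline{\boldsymbol{x}}_p,-r)=-F_2(\underline{\boldsymbol{x}}_p,r)$ on $\underline{D}$. *)

theory Defs
  imports "HOL-Analysis.Analysis"
begin

section \<open>Real Clifford algebras\<close>

text \<open>
  The type below is the union of the real Clifford algebras
  \<open>\<real>\<^sub>0 \<subseteq> \<real>\<^sub>1 \<subseteq> \<real>\<^sub>2 \<subseteq> \<dots>\<close>.  An element is given by its finitely many coefficients with respect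
  to the basis \<open>e\<^sub>A = e\<^bsub>i1\<^esub> \<dots> e\<^bsub>ik\<^esub>\<close> for finite \<open>A = {i1 < \<dots> < ik}\<close>.  Indices start at \<open>0\<close>.
\<close>

typedef clifford =
  "{a :: nat set \<Rightarrow> real. finite {A. a A \<noteq> 0} \<and> (\<forall>A. a A \<noteq> 0 \<longrightarrow> finite A)}"
  morphisms coeff Abs_clifford
  by (rule exI[of _ "\<lambda>_. 0"]) simp

definition supp :: "clifford \<Rightarrow> nat set set" where
  "supp a = {A. coeff a A \<noteq> 0}"

text \<open>
  The sign in \<open>e\<^sub>A e\<^sub>B = \<plusminus> e\<^sub>C\<close> with \<open>C\<close> the symmetric difference of \<open>A\<close> and \<open>B\<close>: moving the generators
  of \<open>e\<^sub>B\<close> into place gives one factor \<open>-1\<close> for each pair \<open>j < i\<close>, by anticommutation, and one for each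
  pair \<open>j = i\<close>, by \<open>e\<^sub>i\<^sup>2 = -1\<close>.
\<close>

definition blade_sign :: "nat set \<Rightarrow> nat set \<Rightarrow> real" where
  "blade_sign A B = (\<Prod>i\<in>A. \<Prod>j\<in>B. if j \<le> i then - 1 else 1)"

definition blade :: "nat set \<Rightarrow> clifford" where
  "blade A = Abs_clifford (\<lambda>B. if finite A \<and> B = A then 1 else 0)"

definition gen :: "nat \<Rightarrow> clifford" where
  "gen i = blade {i}"

lemma clifford_eqI: "(\<And>A. coeff a A = coeff b A) \<Longrightarrow> a = b"
  by (metis coeff_inject ext)

lemma finite_supp [simp]: "finite (supp a)"
  using coeff[of a] by (simp add: supp_def)

lemma coeff_nonzero_finite: "coeff a A \<noteq> 0 \<Longrightarrow> finite A"
  using coeff[of a] by simp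

lemma supp_finite: "A \<in> supp a \<Longrightarrow> finite A"
  by (simp add: supp_def coeff_nonzero_finite)

lemma coeff_Abs:
  assumes "finite {A. a A \<noteq> 0}" "\<And>A. a A \<noteq> 0 \<Longrightarrow> finite A"
  shows "coeff (Abs_clifford a) = a"
  using assms by (intro Abs_clifford_inverse) auto

lemma coeff_Abs_subset:
  assumes "finite S" "\<And>A. a A \<noteq> 0 \<Longrightarrow> A \<in> S" "\<And>A. A \<in> S \<Longrightarrow> finite A"
  shows "coeff (Abs_clifford a) = a"
  by (rule coeff_Abs) (use assms in \<open>auto intro: finite_subset[of _ S]\<close>)

lemma coeff_blade [simp]: "coeff (blade A) B = (if finite A \<and> B = A then 1 else 0)"
proof -
  have "coeff (blade A) = (\<lambda>B. if finite A \<and> B = A then 1 else 0)"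
    unfolding blade_def by (rule coeff_Abs) (auto split: if_splits)
  then show ?thesis by simp
qed

instantiation clifford :: "{zero,one,plus,minus,uminus,scaleR,times}"
begin

definition zero_clifford :: clifford where
  "0 = Abs_clifford (\<lambda>_. 0)"

definition one_clifford :: clifford where
  "1 = blade {}"

definition plus_clifford :: "clifford \<Rightarrow> clifford \<Rightarrow> clifford" where
  "a + b = Abs_clifford (\<lambda>A. coeff a A + coeff b A)"

definition minus_clifford :: "clifford \<Rightarrow> clifford \<Rightarrow> clifford" where
  "a - b = Abs_clifford (\<lambda>A. coeff a A - coeff b A)"

definition uminus_clifford :: "clifford \<Rightarrow> clifford" where
  "- a = Abs_clifford (\<lambda>A. - coeff a A)"

definition scaleR_clifford :: "real \<Rightarrow> clifford \<Rightarrow> clifford" where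
  "c *\<^sub>R a = Abs_clifford (\<lambda>A. c * coeff a A)"

text \<open>The product is the bilinear extension of the product of the basis elements, cf. \<open>blade_mult\<close>:
  \<open>e\<^sub>A e\<^sub>B\<close> contributes to the coefficient at \<open>C\<close> exactly if \<open>B\<close> is the symmetric difference of \<open>A\<close>
  and \<open>C\<close>.\<close>

definition times_clifford :: "clifford \<Rightarrow> clifford \<Rightarrow> clifford" where
  "a * b = Abs_clifford (\<lambda>C. \<Sum>A\<in>supp a.
     blade_sign A (sym_diff A C) * coeff a A * coeff b (sym_diff A C))"

instance ..

end

lemma coeff_zero [simp]: "coeff 0 A = 0"
  unfolding zero_clifford_def by (subst coeff_Abs) auto

lemma coeff_one: "coeff 1 A = (if A = {} then 1 else 0)"
  unfolding one_clifford_def by simp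

lemma coeff_add [simp]: "coeff (a + b) A = coeff a A + coeff b A"
  unfolding plus_clifford_def
  by (subst coeff_Abs_subset[of "supp a \<union> supp b"]) (auto simp: supp_finite, auto simp: supp_def)

lemma coeff_diff [simp]: "coeff (a - b) A = coeff a A - coeff b A"
  unfolding minus_clifford_def
  by (subst coeff_Abs_subset[of "supp a \<union> supp b"]) (auto simp: supp_finite, auto simp: supp_def)

lemma coeff_minus [simp]: "coeff (- a) A = - coeff a A"
  unfolding uminus_clifford_def
  by (subst coeff_Abs_subset[of "supp a"]) (auto simp: supp_finite, auto simp: supp_def)

lemma coeff_scaleR [simp]: "coeff (c *\<^sub>R a) A = c * coeff a A"
  unfolding scaleR_clifford_def
  by (subst coeff_Abs_subset[of "supp a"]) (auto simp: supp_finite, auto simp: supp_def)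

lemma sym_diff_cancel: "sym_diff A (sym_diff A B) = B"
  by blast

lemma sym_diff_inj: "sym_diff A B = sym_diff A C \<Longrightarrow> B = C"
  by blast

lemma mult_rearrange:
  fixes s t u v x y z :: real
  assumes "s * t = u * v"
  shows "s * (t * x * y) * z = u * x * (v * y * z)"
proof -
  have "s * (t * x * y) * z = (s * t) * (x * y * z)" by (simp only: mult_ac)
  also have "\<dots> = u * x * (v * y * z)" unfolding assms by (simp only: mult_ac)
  finally show ?thesis .
qed

lemma coeff_mult_supp:
  "coeff (a * b) C = (\<Sum>A\<in>supp a.
     blade_sign A (sym_diff A C) * coeff a A * coeff b (sym_diff A C))"
proof -
  let ?f = "\<lambda>C. \<Sum>A\<in>supp a. blade_sign A (sym_diff A C) * coeff a A * coeff b (sym_diff A C)"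
  let ?S = "(\<lambda>(A, B). sym_diff A B) ` (supp a \<times> supp b)"
  have "coeff (Abs_clifford ?f) = ?f"
  proof (rule coeff_Abs_subset)
    show "finite ?S" by simp
  next
    fix C assume "?f C \<noteq> 0"
    then obtain A where A: "A \<in> supp a" "coeff b (sym_diff A C) \<noteq> 0"
      by (metis (no_types, lifting) mult_eq_0_iff sum.neutral)
    then have "(A, sym_diff A C) \<in> supp a \<times> supp b" by (simp add: supp_def)
    moreover have "C = (\<lambda>(A, B). sym_diff A B) (A, sym_diff A C)"
      using sym_diff_cancel[of A C] by simp
    ultimately show "C \<in> ?S" by (rule rev_image_eqI)
  next
    fix C assume "C \<in> ?S"
    then show "finite C" by (auto dest: supp_finite)
  qed
  then show ?thesis by (simp add: times_clifford_def)
qed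

lemma coeff_mult:
  assumes "finite S" "supp a \<subseteq> S"
  shows "coeff (a * b) C = (\<Sum>A\<in>S.
           blade_sign A (sym_diff A C) * coeff a A * coeff b (sym_diff A C))"
  unfolding coeff_mult_supp
  by (rule sum.mono_neutral_left) (use assms in \<open>auto simp: supp_def\<close>)

lemma prod_sym_diff:
  fixes g :: "'a \<Rightarrow> real"
  assumes "finite A" "finite B" "\<And>x. g x * g x = 1"
  shows "prod g (sym_diff A B) = prod g A * prod g B"
proof -
  have 1: "prod g (sym_diff A B) = prod g (A - B) * prod g (B - A)"
    using assms by (intro prod.union_disjoint) auto
  have 2: "prod g A = prod g (A - B) * prod g (A \<inter> B)"
    using assms by (subst prod.union_disjoint[symmetric]) (auto intro: arg_cong[of _ _ "prod g"])
  have 3: "prod g B = prod g (B - A) * prod g (A \<inter> B)"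
    using assms by (subst prod.union_disjoint[symmetric]) (auto intro: arg_cong[of _ _ "prod g"])
  have 4: "prod g (A \<inter> B) * prod g (A \<inter> B) = 1"
    by (simp add: prod.distrib[symmetric] assms(3))
  have "prod g A * prod g B = prod g (A - B) * prod g (B - A) * (prod g (A \<inter> B) * prod g (A \<inter> B))"
    by (simp add: 2 3)
  with 1 4 show ?thesis by simp
qed

lemma blade_sign_square [simp]: "blade_sign A B * blade_sign A B = 1"
  unfolding blade_sign_def prod.distrib[symmetric] by (intro prod.neutral ballI) simp

lemma abs_blade_sign [simp]: "\<bar>blade_sign A B\<bar> = 1"
  using blade_sign_square[of A B] by (metis abs_mult_self_eq abs_one abs_square_eq_1 power2_eq_square)

lemma blade_sign_sym_diff_left:
  assumes "finite A" "finite B"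
  shows "blade_sign (sym_diff A B) C = blade_sign A C * blade_sign B C"
  unfolding blade_sign_def
  by (intro prod_sym_diff assms) (simp add: prod.distrib[symmetric] prod.neutral)

lemma blade_sign_sym_diff_right:
  assumes "finite B" "finite C"
  shows "blade_sign A (sym_diff B C) = blade_sign A B * blade_sign A C"
  unfolding blade_sign_def
  by (subst prod_sym_diff[OF assms]) (simp_all add: prod.distrib)

instance clifford :: "{real_vector,ring_1}"
proof
  fix a b c :: clifford and x y :: real
  show "a + b + c = a + (b + c)" "a + b = b + a" "0 + a = a" "- a + a = 0" "a - b = a + - b"
    "x *\<^sub>R (a + b) = x *\<^sub>R a + x *\<^sub>R b" "(x + y) *\<^sub>R a = x *\<^sub>R a + y *\<^sub>R a"
    "x *\<^sub>R y *\<^sub>R a = (x * y) *\<^sub>R a" "1 *\<^sub>R a = a"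
    by (auto intro!: clifford_eqI simp: algebra_simps)
  show "(0::clifford) \<noteq> 1"
    by (metis coeff_one coeff_zero zero_neq_one)
  show "1 * a = a"
  proof (rule clifford_eqI)
    fix C
    have "coeff (1 * a) C = (\<Sum>A\<in>{{}}.
           blade_sign A (sym_diff A C) * coeff 1 A * coeff a (sym_diff A C))"
      by (rule coeff_mult) (auto simp: supp_def coeff_one split: if_splits)
    then show "coeff (1 * a) C = coeff a C"
      by (simp add: blade_sign_def coeff_one)
  qed
  show "a * 1 = a"
  proof (rule clifford_eqI)
    fix C
    have "coeff (a * 1) C = (\<Sum>A\<in>insert C (supp a).
           blade_sign A (sym_diff A C) * coeff a A * coeff 1 (sym_diff A C))"
      by (rule coeff_mult) auto
    also have "\<dots> = (\<Sum>A\<in>insert C (supp a). if A = C then coeff a C else 0)"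
    proof (rule sum.cong[OF refl])
      fix A
      have "sym_diff A C = {} \<longleftrightarrow> A = C" by blast
      then show "blade_sign A (sym_diff A C) * coeff a A * coeff 1 (sym_diff A C) =
          (if A = C then coeff a C else 0)"
        by (auto simp: coeff_one blade_sign_def)
    qed
    also have "\<dots> = coeff a C" by (simp add: sum.delta)
    finally show "coeff (a * 1) C = coeff a C" .
  qed
  show "(a + b) * c = a * c + b * c"
  proof (rule clifford_eqI)
    fix C
    let ?S = "supp a \<union> supp b"
    have "supp (a + b) \<subseteq> ?S" by (auto simp: supp_def)
    then show "coeff ((a + b) * c) C = coeff (a * c + b * c) C"
      by (simp add: coeff_mult[of ?S] algebra_simps sum.distrib)
  qed
  show "a * (b + c) = a * b + a * c"
    by (rule clifford_eqI) (simp add: coeff_mult_supp algebra_simps sum.distrib)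
  show "a * b * c = a * (b * c)"
  proof (rule clifford_eqI)
    fix D
    let ?T = "(\<lambda>(A, B). sym_diff A B) ` (supp a \<times> supp b)"
    let ?U = "\<lambda>A. (\<lambda>B. sym_diff A B) ` supp b"
    have fT: "finite ?T" by simp
    have "supp (a * b) \<subseteq> ?T"
    proof
      fix C assume "C \<in> supp (a * b)"
      then have "(\<Sum>A\<in>supp a.
          blade_sign A (sym_diff A C) * coeff a A * coeff b (sym_diff A C)) \<noteq> 0"
        by (simp add: supp_def coeff_mult_supp)
      then obtain A where A: "A \<in> supp a" "coeff b (sym_diff A C) \<noteq> 0"
        by (metis (no_types, lifting) mult_eq_0_iff sum.neutral)
      then have "(A, sym_diff A C) \<in> supp a \<times> supp b" by (simp add: supp_def)
      moreover have "C = (\<lambda>(A, B). sym_diff A B) (A, sym_diff A C)"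
        using sym_diff_cancel[of A C] by simp
      ultimately show "C \<in> ?T" by (rule rev_image_eqI)
    qed
    then have "coeff (a * b * c) D =
        (\<Sum>E\<in>?T. blade_sign E (sym_diff E D) * coeff (a * b) E * coeff c (sym_diff E D))"
      by (rule coeff_mult[OF fT])
    also have "\<dots> = (\<Sum>E\<in>?T. \<Sum>A\<in>supp a. blade_sign E (sym_diff E D) *
        (blade_sign A (sym_diff A E) * coeff a A * coeff b (sym_diff A E)) * coeff c (sym_diff E D))"
      by (simp add: coeff_mult_supp sum_distrib_left sum_distrib_right)
    also have "\<dots> = (\<Sum>A\<in>supp a. \<Sum>E\<in>?T. blade_sign E (sym_diff E D) *
        (blade_sign A (sym_diff A E) * coeff a A * coeff b (sym_diff A E)) * coeff c (sym_diff E D))"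
      by (rule sum.swap)
    also have "\<dots> = (\<Sum>A\<in>supp a. \<Sum>B\<in>supp b. blade_sign (sym_diff A B) (sym_diff (sym_diff A B) D) *
        (blade_sign A B * coeff a A * coeff b B) * coeff c (sym_diff (sym_diff A B) D))"
    proof (rule sum.cong[OF refl])
      fix A assume A: "A \<in> supp a"
      let ?h = "\<lambda>E. blade_sign E (sym_diff E D) *
        (blade_sign A (sym_diff A E) * coeff a A * coeff b (sym_diff A E)) * coeff c (sym_diff E D)"
      have "sum ?h ?T = sum ?h (?U A)"
      proof (rule sum.mono_neutral_right[OF fT])
        show "?U A \<subseteq> ?T" using A by auto
        show "\<forall>E\<in>?T - ?U A. ?h E = 0"
        proof
          fix E assume "E \<in> ?T - ?U A"
          then have "E \<notin> ?U A" by simp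
          then have "sym_diff A E \<notin> supp b"
            using image_eqI[of E "\<lambda>B. sym_diff A B" "sym_diff A E" "supp b", OF sym_diff_cancel[symmetric]]
            by (rule contrapos_nn)
          then have "coeff b (sym_diff A E) = 0" by (simp add: supp_def)
          then show "?h E = 0" by simp
        qed
      qed
      also have "\<dots> = (\<Sum>B\<in>supp b. ?h (sym_diff A B))"
      proof (rule sum.reindex[unfolded comp_def])
        show "inj_on (\<lambda>B. sym_diff A B) (supp b)"
          by (rule inj_onI) (rule sym_diff_inj)
      qed
      finally show "sum ?h ?T = (\<Sum>B\<in>supp b. blade_sign (sym_diff A B) (sym_diff (sym_diff A B) D) *
        (blade_sign A B * coeff a A * coeff b B) * coeff c (sym_diff (sym_diff A B) D))"
        by (simp only: sym_diff_cancel)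
    qed
    also have "\<dots> = (\<Sum>A\<in>supp a. \<Sum>B\<in>supp b. blade_sign A (sym_diff A D) * coeff a A *
        (blade_sign B (sym_diff B (sym_diff A D)) * coeff b B * coeff c (sym_diff B (sym_diff A D))))"
    proof (intro sum.cong refl)
      fix A B assume AB: "A \<in> supp a" "B \<in> supp b"
      define C where "C = sym_diff (sym_diff A B) D"
      have fAB: "finite A" "finite B" using AB by (auto dest: supp_finite)
      have C': "sym_diff B (sym_diff A D) = C" unfolding C_def by blast
      have AD: "sym_diff A D = sym_diff B C" unfolding C_def by blast
      have sgn: "blade_sign (sym_diff A B) C * blade_sign A B =
          blade_sign A (sym_diff B C) * blade_sign B C" if "finite C"
        by (simp only: blade_sign_sym_diff_left[OF fAB] blade_sign_sym_diff_right[OF fAB(2) that]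
            mult.assoc mult.commute mult.left_commute)
      show "blade_sign (sym_diff A B) (sym_diff (sym_diff A B) D) *
          (blade_sign A B * coeff a A * coeff b B) * coeff c (sym_diff (sym_diff A B) D) =
        blade_sign A (sym_diff A D) * coeff a A *
          (blade_sign B (sym_diff B (sym_diff A D)) * coeff b B * coeff c (sym_diff B (sym_diff A D)))"
      proof (cases "coeff c C = 0")
        case True
        then show ?thesis unfolding C' C_def[symmetric] by simp
      next
        case False
        then have "finite C" by (rule coeff_nonzero_finite)
        from sgn[OF this] show ?thesis
          unfolding AD sym_diff_cancel C_def[symmetric] by (rule mult_rearrange)
      qed
    qed
    also have "\<dots> = coeff (a * (b * c)) D"
      by (simp add: coeff_mult_supp sum_distrib_left)
    finally show "coeff (a * b * c) D = coeff (a * (b * c)) D" .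
  qed
qed

text \<open>
  The norm only serves to provide the topology and the derivatives of Clifford-valued functions.  We
  take the sum of the absolute values of the coefficients, which is submultiplicative; on each
  finite-dimensional subspace it is equivalent to the Euclidean norm of the coefficients.
\<close>

instantiation clifford :: real_normed_algebra_1
begin

definition norm_clifford :: "clifford \<Rightarrow> real" where
  "norm_clifford a = (\<Sum>A\<in>supp a. \<bar>coeff a A\<bar>)"

definition dist_clifford :: "clifford \<Rightarrow> clifford \<Rightarrow> real" where
  "dist_clifford a b = norm (a - b)"

definition sgn_clifford :: "clifford \<Rightarrow> clifford" where
  "sgn_clifford a = inverse (norm a) *\<^sub>R a"

definition uniformity_clifford :: "(clifford \<times> clifford) filter" where
  "uniformity_clifford = (INF e\<in>{0<..}. principal {(a, b). dist a b < e})"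

definition open_clifford :: "clifford set \<Rightarrow> bool" where
  "open_clifford U \<longleftrightarrow> (\<forall>a\<in>U. \<forall>\<^sub>F (a', b) in uniformity. a' = a \<longrightarrow> b \<in> U)"

instance
proof
  fix a b :: clifford and x y :: real and U :: "clifford set"
  have norm_eq: "norm c = (\<Sum>A\<in>S. \<bar>coeff c A\<bar>)" if "finite S" "supp c \<subseteq> S" for c S
    unfolding norm_clifford_def
    by (rule sum.mono_neutral_left) (use that in \<open>auto simp: supp_def\<close>)
  show "x *\<^sub>R a * b = x *\<^sub>R (a * b)"
  proof (rule clifford_eqI)
    fix C
    have "supp (x *\<^sub>R a) \<subseteq> supp a" by (auto simp: supp_def)
    then show "coeff (x *\<^sub>R a * b) C = coeff (x *\<^sub>R (a * b)) C"
      by (simp add: coeff_mult[of "supp a"] sum_distrib_left mult_ac)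
  qed
  show "a * x *\<^sub>R b = x *\<^sub>R (a * b)"
    by (rule clifford_eqI) (simp add: coeff_mult_supp sum_distrib_left mult_ac)
  show "dist a b = norm (a - b)" by (rule dist_clifford_def)
  show "sgn a = inverse (norm a) *\<^sub>R a" by (rule sgn_clifford_def)
  show "uniformity = (INF e\<in>{0<..}. principal {(a :: clifford, b). dist a b < e})"
    by (rule uniformity_clifford_def)
  show "open U \<longleftrightarrow> (\<forall>a\<in>U. \<forall>\<^sub>F (a', b) in uniformity. a' = a \<longrightarrow> b \<in> U)"
    by (rule open_clifford_def)
  show "norm a = 0 \<longleftrightarrow> a = 0"
  proof
    assume "norm a = 0"
    then have "\<And>A. A \<in> supp a \<Longrightarrow> coeff a A = 0"
      by (simp add: norm_clifford_def sum_nonneg_eq_0_iff)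
    then show "a = 0" by (intro clifford_eqI) (auto simp: supp_def)
  next
    assume "a = 0"
    then show "norm a = 0" by (simp add: norm_clifford_def)
  qed
  show "norm (a + b) \<le> norm a + norm b"
  proof -
    let ?S = "supp a \<union> supp b"
    have "norm (a + b) = (\<Sum>A\<in>?S. \<bar>coeff (a + b) A\<bar>)"
      by (rule norm_eq[OF _]) (simp, auto simp: supp_def)
    also have "\<dots> \<le> (\<Sum>A\<in>?S. \<bar>coeff a A\<bar> + \<bar>coeff b A\<bar>)"
      by (intro sum_mono) (simp add: abs_triangle_ineq)
    also have "\<dots> = norm a + norm b"
      by (simp add: sum.distrib norm_eq[of ?S])
    finally show ?thesis .
  qed
  show "norm (x *\<^sub>R a) = \<bar>x\<bar> * norm a"
  proof -
    have "norm (x *\<^sub>R a) = (\<Sum>A\<in>supp a. \<bar>coeff (x *\<^sub>R a) A\<bar>)"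
      by (rule norm_eq[OF _]) (simp, auto simp: supp_def)
    then show ?thesis by (simp add: norm_clifford_def abs_mult sum_distrib_left)
  qed
  show "norm (1 :: clifford) = 1"
  proof -
    have "supp 1 = {{}}" by (auto simp: supp_def coeff_one)
    then show ?thesis by (simp add: norm_clifford_def coeff_one)
  qed
  show "norm (a * b) \<le> norm a * norm b"
  proof -
    let ?S = "supp (a * b)"
    have "norm (a * b) = (\<Sum>C\<in>?S. \<bar>coeff (a * b) C\<bar>)"
      by (simp add: norm_clifford_def)
    also have "\<dots> \<le> (\<Sum>C\<in>?S. \<Sum>A\<in>supp a. \<bar>coeff a A\<bar> * \<bar>coeff b (sym_diff A C)\<bar>)"
    proof (rule sum_mono)
      fix C
      have "\<bar>coeff (a * b) C\<bar> \<le> (\<Sum>A\<in>supp a.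
          \<bar>blade_sign A (sym_diff A C) * coeff a A * coeff b (sym_diff A C)\<bar>)"
        unfolding coeff_mult_supp by (rule sum_abs)
      then show "\<bar>coeff (a * b) C\<bar> \<le> (\<Sum>A\<in>supp a. \<bar>coeff a A\<bar> * \<bar>coeff b (sym_diff A C)\<bar>)"
        by (simp add: abs_mult)
    qed
    also have "\<dots> = (\<Sum>A\<in>supp a. \<bar>coeff a A\<bar> * (\<Sum>C\<in>?S. \<bar>coeff b (sym_diff A C)\<bar>))"
      by (subst sum.swap) (simp add: sum_distrib_left)
    also have "\<dots> \<le> (\<Sum>A\<in>supp a. \<bar>coeff a A\<bar> * norm b)"
    proof (intro sum_mono mult_left_mono)
      fix A
      have inj: "inj_on (\<lambda>C. sym_diff A C) ?S" by (rule inj_onI) (rule sym_diff_inj)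
      let ?V = "(\<lambda>C. sym_diff A C) ` ?S"
      have "(\<Sum>C\<in>?S. \<bar>coeff b (sym_diff A C)\<bar>) = (\<Sum>B\<in>?V. \<bar>coeff b B\<bar>)"
        by (subst sum.reindex[OF inj]) simp
      also have "\<dots> \<le> (\<Sum>B\<in>?V \<union> supp b. \<bar>coeff b B\<bar>)"
        by (rule sum_mono2) auto
      also have "\<dots> = norm b" by (rule norm_eq[symmetric]) auto
      finally show "(\<Sum>C\<in>?S. \<bar>coeff b (sym_diff A C)\<bar>) \<le> norm b" .
    qed simp
    also have "\<dots> = norm a * norm b"
      by (simp add: norm_clifford_def sum_distrib_right)
    finally show ?thesis .
  qed
qed

end

text \<open>The defining relations, and the basis elements as ordered products of the generators.\<close>

lemma blade_mult:
  assumes "finite A" "finite B"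
  shows "blade A * blade B = blade_sign A B *\<^sub>R blade (sym_diff A B)"
proof (rule clifford_eqI)
  fix C
  have "coeff (blade A * blade B) C = (\<Sum>A'\<in>{A}.
      blade_sign A' (sym_diff A' C) * coeff (blade A) A' * coeff (blade B) (sym_diff A' C))"
    by (rule coeff_mult) (auto simp: supp_def split: if_splits)
  moreover have "sym_diff A C = B \<longleftrightarrow> C = sym_diff A B" by blast
  ultimately show "coeff (blade A * blade B) C = coeff (blade_sign A B *\<^sub>R blade (sym_diff A B)) C"
    using assms by auto
qed

theorem gen_anticommute: "gen i * gen j + gen j * gen i = (if i = j then - 2 else 0)"
proof (cases "i = j")
  case True
  have "gen i * gen i = - 1"
    by (simp add: gen_def blade_mult blade_sign_def one_clifford_def)
  with True show ?thesis by simp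
next
  case False
  then have "sym_diff {i} {j} = {i, j}" "sym_diff {j} {i} = {i, j}" by auto
  with False show ?thesis
    by (cases "i < j") (auto simp: gen_def blade_mult blade_sign_def)
qed

theorem blade_eq_prod_gen:
  assumes "finite A"
  shows "blade A = prod_list (map gen (sorted_list_of_set A))"
  using assms
proof (induction A rule: finite_linorder_min_induct)
  case empty
  then show ?case by (simp add: one_clifford_def)
next
  case (insert i A)
  have "i \<notin> A" using insert by auto
  then have s: "sorted_list_of_set (insert i A) = i # sorted_list_of_set A"
    using insert by (simp add: insort_is_Cons less_imp_le)
  have "blade_sign {i} A = 1"
    using insert by (auto simp: blade_sign_def intro!: prod.neutral)
  moreover have "sym_diff {i} A = insert i A" using \<open>i \<notin> A\<close> by blast
  ultimately have "gen i * blade A = blade (insert i A)"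
    using blade_mult[of "{i}" A] insert by (simp add: gen_def)
  with insert s show ?case by simp
qed

text \<open>The Clifford algebra \<open>\<real>\<^sub>n\<close>, generated by \<open>gen 0, \<dots>, gen (n - 1)\<close>.\<close>

definition clifford_algebra :: "nat \<Rightarrow> clifford set" where
  "clifford_algebra n = span (blade ` Pow {..<n})"

text \<open>The identification of points of \<open>\<real>\<^sup>n\<close> with 1-vectors.\<close>

definition one_vector :: "nat \<Rightarrow> (nat \<Rightarrow> real) \<Rightarrow> clifford" where
  "one_vector n x = (\<Sum>i<n. x i *\<^sub>R gen i)"


section \<open>Partial derivatives of Clifford-valued functions\<close>

text \<open>
  Points of \<open>\<real>\<^sup>n\<close> are the points of \<^term>\<open>Euclidean_space n\<close>, i.e. functions \<open>x :: nat \<Rightarrow> real\<close> with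
  \<open>x i = 0\<close> for \<open>i \<ge> n\<close>.  The subspace topology used by \<^term>\<open>continuous_on\<close> on subsets of \<open>\<real>\<^sup>n\<close> is that
  of \<^term>\<open>Euclidean_space n\<close>.
\<close>

definition partial_deriv :: "nat \<Rightarrow> ((nat \<Rightarrow> real) \<Rightarrow> clifford) \<Rightarrow> (nat \<Rightarrow> real) \<Rightarrow> clifford" where
  "partial_deriv i f x = vector_derivative (\<lambda>t. f (x(i := t))) (at (x i))"

text \<open>\<open>C_k_on n k U f\<close> (for \<open>U\<close> open in \<open>\<real>\<^sup>n\<close>): all partial derivatives of \<open>f\<close> up to order \<open>k\<close> exist and
  are continuous on \<open>U\<close>.\<close>

fun C_k_on :: "nat \<Rightarrow> nat \<Rightarrow> (nat \<Rightarrow> real) set \<Rightarrow> ((nat \<Rightarrow> real) \<Rightarrow> clifford) \<Rightarrow> bool" where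
  "C_k_on n 0 U f \<longleftrightarrow> continuous_on U f"
| "C_k_on n (Suc k) U f \<longleftrightarrow> continuous_on U f \<and>
     (\<forall>i<n. (\<forall>x\<in>U. (\<lambda>t. f (x(i := t))) differentiable at (x i)) \<and>
            C_k_on n k U (partial_deriv i f))"

definition dirac :: "nat \<Rightarrow> ((nat \<Rightarrow> real) \<Rightarrow> clifford) \<Rightarrow> (nat \<Rightarrow> real) \<Rightarrow> clifford" where
  "dirac n f x = (\<Sum>i<n. gen i * partial_deriv i f x)"

definition laplacian :: "nat \<Rightarrow> ((nat \<Rightarrow> real) \<Rightarrow> clifford) \<Rightarrow> (nat \<Rightarrow> real) \<Rightarrow> clifford" where
  "laplacian n f x = (\<Sum>i<n. partial_deriv i (partial_deriv i f) x)"

definition helmholtz ::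
    "nat \<Rightarrow> real \<Rightarrow> ((nat \<Rightarrow> real) \<Rightarrow> clifford) \<Rightarrow> (nat \<Rightarrow> real) \<Rightarrow> clifford" where
  "helmholtz n lam f x = laplacian n f x + lam\<^sup>2 *\<^sub>R f x"


section \<open>Generalized partial-slice functions\<close>

text \<open>
  A point \<open>(x\<^sub>p, r)\<close> of \<open>\<real>\<^sup>p\<^sup>+\<^sup>1\<close> is \<open>x\<^sub>p(p := r)\<close> with \<open>x\<^sub>p \<in> \<real>\<^sup>p\<close>, so \<open>r\<close> is its coordinate with index \<open>p\<close>.
\<close>

definition domain_in :: "nat \<Rightarrow> (nat \<Rightarrow> real) set \<Rightarrow> bool" where
  "domain_in n D \<longleftrightarrow>
     D \<noteq> {} \<and> openin (Euclidean_space n) D \<and> connectedin (Euclidean_space n) D"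

definition reflect :: "nat \<Rightarrow> (nat \<Rightarrow> real) \<Rightarrow> (nat \<Rightarrow> real)" where
  "reflect p x = x(p := - x p)"

text \<open>The unit sphere of \<open>\<real>\<^sup>q\<close>, the latter being spanned by the coordinates \<open>p, \<dots>, p + q - 1\<close> of \<open>\<real>\<^sup>p\<^sup>+\<^sup>q\<close>.\<close>

definition slice_sphere :: "nat \<Rightarrow> nat \<Rightarrow> (nat \<Rightarrow> real) set" where
  "slice_sphere p q = {\<omega>. \<omega> \<in> topspace (Euclidean_space (p + q)) \<and> (\<forall>i<p. \<omega> i = 0) \<and>
     (one_vector (p + q) \<omega>)\<^sup>2 = - 1}"

definition slice_point :: "(nat \<Rightarrow> real) \<Rightarrow> real \<Rightarrow> (nat \<Rightarrow> real) \<Rightarrow> (nat \<Rightarrow> real)" where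
  "slice_point xp r \<omega> = (\<lambda>i. xp i + r * \<omega> i)"

definition partially_symmetric_completion ::
    "nat \<Rightarrow> nat \<Rightarrow> (nat \<Rightarrow> real) set \<Rightarrow> (nat \<Rightarrow> real) set" where
  "partially_symmetric_completion p q D =
     {slice_point xp r \<omega> | xp r \<omega>. xp \<in> topspace (Euclidean_space p) \<and>
        \<omega> \<in> slice_sphere p q \<and> 0 \<le> r \<and> xp(p := r) \<in> D}"

definition generalized_partial_slice ::
    "nat \<Rightarrow> nat \<Rightarrow> (nat \<Rightarrow> real) set \<Rightarrow> ((nat \<Rightarrow> real) \<Rightarrow> clifford) \<Rightarrow> ((nat \<Rightarrow> real) \<Rightarrow> clifford) \<Rightarrow>
     ((nat \<Rightarrow> real) \<Rightarrow> clifford) \<Rightarrow> bool" where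
  "generalized_partial_slice p q D F1 F2 f \<longleftrightarrow>
     F1 ` D \<subseteq> clifford_algebra (p + q) \<and> F2 ` D \<subseteq> clifford_algebra (p + q) \<and>
     (\<forall>x\<in>D. F1 (reflect p x) = F1 x \<and> F2 (reflect p x) = - F2 x) \<and>
     (\<forall>xp r \<omega>. xp \<in> topspace (Euclidean_space p) \<longrightarrow> \<omega> \<in> slice_sphere p q \<longrightarrow> 0 \<le> r \<longrightarrow>
        xp(p := r) \<in> D \<longrightarrow>
        f (slice_point xp r \<omega>) = F1 (xp(p := r)) + one_vector (p + q) \<omega> * F2 (xp(p := r)))"

end

theory Submission
  imports Defs
begin

text \<open>
  Only first derivatives of \<open>F\<^sub>1, F\<^sub>2\<close> are assumed to exist, but the Vekua-type system is elliptic.  After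
  adjoining a generator and a variable it becomes a homogeneous first-order system with Clifford
  coefficients, whose solutions equal their own averages against radial bump functions.  Integration by
  parts moves derivatives onto the bump function, so solutions are smooth.

  Put \<open>T = r\<^sup>-\<^sup>1 \<partial>\<^sub>r\<close>, \<open>A\<^sub>k = T\<^sup>k F\<^sub>1\<close> and \<open>B\<^sub>k = T\<^sup>k (F\<^sub>2 / r)\<close>, which are smooth and even across \<open>r = 0\<close>, and
  \<open>f\<^sub>k = A\<^sub>k + x\<^sub>q B\<^sub>k\<close> on the completion, so that \<open>f = f\<^sub>0\<close>.  Applying \<open>T\<close> to the system gives
  \<open>D\<^sub>p A\<^sub>k = (2k + 1) B\<^sub>k + r\<^sup>2 B\<^bsub>k+1\<^esub> + \<lambda> A\<^sub>k\<close> and \<open>D\<^sub>p B\<^sub>k = A\<^bsub>k+1\<^esub> - \<lambda> B\<^sub>k\<close>, hence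
  \<open>(\<Delta> + \<lambda>\<^sup>2) f\<^sub>k = (q - 1 - 2k) f\<^bsub>k+1\<^esub>\<close> and \<open>(D - \<lambda>) f\<^sub>k = - (q - 1 - 2k) B\<^sub>k\<close>.  The last expression vanishes
  for \<open>k = (q - 1) / 2\<close>.
\<close>

section \<open>Functions of class \<open>C\<^sup>k\<close>\<close>

text \<open>An average against a radial bump reproduces a solution only if the system is homogeneous
  with constant coefficients; this is why the term with \<open>lam\<close> must become a derivative
  in an extra variable. Modulo the equations, the radial derivative is a combination of rotations,
  and these integrate to zero against a radial weight. A bump of class \<open>C^1\<close> suffices:
  each round gains one derivative, and the differentiated function solves the same system again.

  The axis \<open>r = 0\<close> is the other obstacle. Neither \<omega> nor \<open>r\<close> is
  smooth there, so everything is written with even functions of \<open>r\<close> and with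
  \<open>x\<^sub>q\<close> itself, and identities for \<open>T\<close> are proved after
  multiplication by \<open>r\<close>.

  The number \<open>q - 1 - 2k\<close> is a balance: the second derivatives in the \<open>q\<close>
  variables of \<open>x\<^sub>q\<close> contribute \<open>q\<close> copies of \<open>T\<close>
  applied to the pair, the system removes \<open>2k + 1\<close> of them, and each further
  \<open>T\<close> raises the latter by 2 because \<open>T\<close> maps \<open>r\<^sup>2\<close> to
  2. Odd \<open>q\<close> is exactly the case in which the balance reaches zero at a natural number
  \<open>k\<close>.\<close>

definition pd :: "nat \<Rightarrow> ((nat \<Rightarrow> real) \<Rightarrow> 'b::real_normed_vector) \<Rightarrow> (nat \<Rightarrow> real) \<Rightarrow> 'b" where
  "pd i f x = vector_derivative (\<lambda>t. f (x(i := t))) (at (x i))"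

definition has_pd ::
    "nat \<Rightarrow> ((nat \<Rightarrow> real) \<Rightarrow> 'b::real_normed_vector) \<Rightarrow> 'b \<Rightarrow> (nat \<Rightarrow> real) \<Rightarrow> bool" where
  "has_pd i f d x \<longleftrightarrow> ((\<lambda>t. f (x(i := t))) has_vector_derivative d) (at (x i))"

text \<open>The counterpart of \<open>C_k_on\<close> for arbitrary normed targets: regularity is
  proved by applying real linear functionals, so real-valued functions must live in the same
  calculus.\<close>

fun Ck :: "nat \<Rightarrow> nat \<Rightarrow> (nat \<Rightarrow> real) set \<Rightarrow> ((nat \<Rightarrow> real) \<Rightarrow> 'b::real_normed_vector) \<Rightarrow> bool" where
  "Ck n 0 U f \<longleftrightarrow> continuous_on U f"
| "Ck n (Suc k) U f \<longleftrightarrow> continuous_on U f \<and>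
     (\<forall>i<n. (\<forall>x\<in>U. has_pd i f (pd i f x) x) \<and> Ck n k U (pd i f))"

lemma partial_deriv_eq_pd: "partial_deriv i f = pd i f"
  by (simp add: partial_deriv_def pd_def fun_eq_iff)

lemma has_pd_pd_iff: "has_pd i f (pd i f x) x \<longleftrightarrow> (\<lambda>t. f (x(i := t))) differentiable at (x i)"
  by (simp add: has_pd_def pd_def vector_derivative_works)

lemma C_k_on_eq_Ck: "C_k_on n k U f \<longleftrightarrow> Ck n k U f"
  by (induction k arbitrary: f) (simp_all add: partial_deriv_eq_pd has_pd_pd_iff)

lemma has_pd_unique: "has_pd i f d x \<Longrightarrow> pd i f x = d"
  by (simp add: has_pd_def pd_def vector_derivative_at)

section \<open>Open sets through coordinate boxes\<close>

definition box_nbhd :: "nat \<Rightarrow> (nat \<Rightarrow> real) \<Rightarrow> real \<Rightarrow> (nat \<Rightarrow> real) set" where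
  "box_nbhd n x e = {y. (\<forall>i<n. \<bar>y i - x i\<bar> < e) \<and> (\<forall>i\<ge>n. y i = x i)}"

text \<open>A nonempty subset of R^n is never open in the product topology of all real sequences, so
  openness is measured by boxes that move only the first \<open>n\<close> coordinates.\<close>

definition nopen :: "nat \<Rightarrow> (nat \<Rightarrow> real) set \<Rightarrow> bool" where
  "nopen n U \<longleftrightarrow> (\<forall>x\<in>U. (\<forall>i\<ge>n. x i = 0) \<and> (\<exists>e>0. box_nbhd n x e \<subseteq> U))"

lemma nopenD_zero: "nopen n U \<Longrightarrow> x \<in> U \<Longrightarrow> n \<le> i \<Longrightarrow> x i = 0"
  by (simp add: nopen_def)

lemma nopenE:
  assumes "nopen n U" "x \<in> U"
  obtains e where "e > 0" "box_nbhd n x e \<subseteq> U"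
  using assms by (auto simp: nopen_def)

lemma nopen_box_nbhd:
  assumes "\<And>i. n \<le> i \<Longrightarrow> x i = 0"
  shows "nopen n (box_nbhd n x e)"
  unfolding nopen_def
proof (intro ballI conjI)
  fix y assume y: "y \<in> box_nbhd n x e"
  then show "\<forall>i\<ge>n. y i = 0" using assms by (simp add: box_nbhd_def)
  define d where "d = Min (insert 1 ((\<lambda>i. e - \<bar>y i - x i\<bar>) ` {..<n}))"
  have d: "d > 0" using y unfolding d_def by (subst Min_gr_iff) (auto simp: box_nbhd_def)
  have "d \<le> e - \<bar>y i - x i\<bar>" if "i < n" for i
    unfolding d_def by (rule Min_le) (use that in auto)
  then have "box_nbhd n y d \<subseteq> box_nbhd n x e"
    using y by (fastforce simp: box_nbhd_def)
  with d show "\<exists>d>0. box_nbhd n y d \<subseteq> box_nbhd n x e" by blast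
qed

text \<open>A basic open set of the product constrains each coordinate separately, and a box moves
  only the first \<open>n\<close> of them, so a minimum of finitely many radii works. The
  \<open>1\<close> in that minimum covers \<open>n = 0\<close>.\<close>

lemma openin_Euclidean_space_imp_nopen:
  assumes "openin (Euclidean_space n) U"
  shows "nopen n U"
  unfolding nopen_def
proof (intro ballI conjI)
  fix x assume x: "x \<in> U"
  from assms obtain T where T: "openin (powertop_real UNIV) T" and U: "U = T \<inter> {x. \<forall>i\<ge>n. x i = 0}"
    by (auto simp: Euclidean_space_def openin_subtopology)
  show z: "\<forall>i\<ge>n. x i = 0" using x U by simp
  from T x U obtain V where V: "finite {i. V i \<noteq> UNIV}" "\<And>i. open (V i)" "x \<in> Pi\<^sub>E UNIV V" "Pi\<^sub>E UNIV V \<subseteq> T"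
    unfolding openin_product_topology_alt by auto
  have "\<exists>e>0. \<forall>t. \<bar>t - x i\<bar> < e \<longrightarrow> t \<in> V i" for i
  proof -
    have "x i \<in> V i" using V(3) by auto
    with V(2)[of i] show ?thesis by (auto simp: open_dist dist_real_def)
  qed
  then obtain e where e: "\<And>i. e i > 0" "\<And>i t. \<bar>t - x i\<bar> < e i \<Longrightarrow> t \<in> V i" by metis
  define d where "d = Min (insert 1 (e ` {..<n}))"
  have d: "d > 0" using e unfolding d_def by (subst Min_gr_iff) auto
  have de: "d \<le> e i" if "i < n" for i
    unfolding d_def by (rule Min_le) (use that in auto)
  have "box_nbhd n x d \<subseteq> U"
  proof
    fix y assume y: "y \<in> box_nbhd n x d"
    have "y i \<in> V i" for i
    proof (cases "i < n")
      case True
      then show ?thesis using y de[OF True] by (intro e(2)) (auto simp: box_nbhd_def)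
    next
      case False
      then show ?thesis using y e(1)[of i] by (intro e(2)) (auto simp: box_nbhd_def)
    qed
    then have "y \<in> T" using V(4) by auto
    then show "y \<in> U" using y z by (auto simp: U box_nbhd_def)
  qed
  with d show "\<exists>d>0. box_nbhd n x d \<subseteq> U" by blast
qed

lemma nopen_eventually_line:
  assumes "nopen n U" "x \<in> U" "i < n"
  shows "\<forall>\<^sub>F t in nhds (x i). x(i := t) \<in> U"
proof -
  obtain e where e: "e > 0" "box_nbhd n x e \<subseteq> U" using assms by (rule_tac nopenE)
  have "x(i := t) \<in> U" if "dist t (x i) < e" for t
    using e assms(3) that by (auto simp: box_nbhd_def dist_real_def intro!: subsetD[OF e(2)])
  then show ?thesis using e(1) eventually_nhds_metric by blast
qed

lemma has_pd_cong:
  assumes "nopen n U" "x \<in> U" "i < n" "\<And>y. y \<in> U \<Longrightarrow> f y = g y" "has_pd i f d x"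
  shows "has_pd i g d x"
proof -
  have "\<forall>\<^sub>F t in nhds (x i). t \<in> UNIV \<longrightarrow> f (x(i := t)) = g (x(i := t))"
    using nopen_eventually_line[OF assms(1-3)] by eventually_elim (simp add: assms(4))
  then have "((\<lambda>t. f (x(i := t))) has_vector_derivative d) (at (x i)) =
      ((\<lambda>t. g (x(i := t))) has_vector_derivative d) (at (x i))"
    by (intro has_vector_derivative_cong_ev) (simp_all add: assms(2,4))
  then show ?thesis using assms(5) by (simp add: has_pd_def)
qed

lemma pd_cong:
  assumes "nopen n U" "x \<in> U" "i < n" "\<And>y. y \<in> U \<Longrightarrow> f y = g y"
  shows "pd i f x = pd i g x"
  unfolding pd_def
proof (rule vector_derivative_cong_eq)
  show "\<forall>\<^sub>F t in nhds (x i). t \<in> UNIV \<longrightarrow> f (x(i := t)) = g (x(i := t))"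
    using nopen_eventually_line[OF assms(1-3)] by eventually_elim (simp add: assms(4))
qed auto

lemma Ck_imp_continuous_on: "Ck n k U f \<Longrightarrow> continuous_on U f"
  by (cases k) auto

lemma Ck_has_pd: "Ck n (Suc k) U f \<Longrightarrow> i < n \<Longrightarrow> x \<in> U \<Longrightarrow> has_pd i f (pd i f x) x"
  by simp

lemma Ck_pd: "Ck n (Suc k) U f \<Longrightarrow> i < n \<Longrightarrow> Ck n k U (pd i f)"
  by simp

lemma Ck_lower: "Ck n (Suc k) U f \<Longrightarrow> Ck n k U f"
  by (induction k arbitrary: f) auto

lemma Ck_subset: "Ck m k U f \<Longrightarrow> W \<subseteq> U \<Longrightarrow> n \<le> m \<Longrightarrow> Ck n k W f"
  by (induction k arbitrary: f) (auto intro: continuous_on_subset)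

lemma Ck_cong:
  assumes "nopen n U" "\<And>x. x \<in> U \<Longrightarrow> f x = g x" "Ck n k U f"
  shows "Ck n k U g"
  using assms(2,3)
proof (induction k arbitrary: f g)
  case 0
  then show ?case by (simp cong: continuous_on_cong)
next
  case (Suc k)
  have *: "pd i f x = pd i g x" if "i < n" "x \<in> U" for i x
    by (rule pd_cong[OF assms(1)]) (use Suc that in auto)
  have "has_pd i g (pd i g x) x" if "i < n" "x \<in> U" for i x
    by (rule has_pd_cong[OF assms(1) that(2,1) Suc.prems(1)]) (use Suc.prems(2) that in \<open>auto simp: *[OF that, symmetric] Suc.prems(1)\<close>)
  moreover have "Ck n k U (pd i g)" if "i < n" for i
    by (rule Suc.IH[of "pd i f"]) (use * that Suc.prems in auto)
  moreover have "continuous_on U g" using Suc.prems by (simp cong: continuous_on_cong)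
  ultimately show ?case by simp
qed

text \<open>The candidates \<open>f'\<close> only have to be derivatives on \<open>U\<close>;
  openness of \<open>U\<close> transfers their smoothness to \<open>pd i f\<close>. The closure
  rules of the calculus are obtained this way.\<close>

lemma Ck_SucI:
  assumes "nopen n U" "continuous_on U f"
    and "\<And>i x. i < n \<Longrightarrow> x \<in> U \<Longrightarrow> has_pd i f (f' i x) x"
    and "\<And>i. i < n \<Longrightarrow> Ck n k U (f' i)"
  shows "Ck n (Suc k) U f"
proof -
  have *: "pd i f x = f' i x" if "i < n" "x \<in> U" for i x
    using that by (intro has_pd_unique assms)
  have "Ck n k U (pd i f)" if "i < n" for i
    by (rule Ck_cong[OF assms(1) _ assms(4)[OF that]]) (simp add: * that)
  then show ?thesis using assms by (simp add: *)
qed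

section \<open>Rules for partial derivatives and closure of the classes\<close>

lemma has_pd_const: "has_pd i (\<lambda>_. c) 0 x"
  by (simp add: has_pd_def)

lemma has_pd_add: "has_pd i f a x \<Longrightarrow> has_pd i g b x \<Longrightarrow> has_pd i (\<lambda>x. f x + g x) (a + b) x"
  unfolding has_pd_def by (rule has_vector_derivative_add)

lemma has_pd_sum:
  "(\<And>j. j \<in> S \<Longrightarrow> has_pd i (f j) (d j) x) \<Longrightarrow> has_pd i (\<lambda>x. \<Sum>j\<in>S. f j x) (\<Sum>j\<in>S. d j) x"
  unfolding has_pd_def by (rule has_vector_derivative_sum)

lemma has_pd_linear: "bounded_linear L \<Longrightarrow> has_pd i f d x \<Longrightarrow> has_pd i (\<lambda>x. L (f x)) (L d) x"
  unfolding has_pd_def by (rule bounded_linear.has_vector_derivative)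

lemma has_pd_bilinear:
  assumes "bounded_bilinear B" "has_pd i f a x" "has_pd i g b x"
  shows "has_pd i (\<lambda>x. B (f x) (g x)) (B (f x) b + B a (g x)) x"
  using bounded_bilinear.has_vector_derivative[OF assms(1), of "\<lambda>t. f (x(i := t))" a "x i" UNIV
      "\<lambda>t. g (x(i := t))" b] assms(2,3)
  by (simp add: has_pd_def)

lemma has_pd_coord: "has_pd i (\<lambda>x. x j) (if i = j then 1 else 0) x"
  by (auto simp: has_pd_def)

lemma Ck_const: "nopen n U \<Longrightarrow> Ck n k U (\<lambda>_. c)"
proof (induction k arbitrary: c)
  case (Suc k)
  then show ?case by (intro Ck_SucI[where f' = "\<lambda>_ _. 0"]) (auto intro: has_pd_const)
qed simp

lemma Ck_coord: "nopen n U \<Longrightarrow> Ck n k U (\<lambda>x. x j)"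
proof (cases k)
  case (Suc l)
  assume "nopen n U"
  then show ?thesis unfolding Suc
    by (intro Ck_SucI[where f' = "\<lambda>i _. if i = j then 1 else 0"] has_pd_coord Ck_const
        continuous_on_subset[OF continuous_on_product_coordinates] subset_UNIV)
qed (simp add: continuous_on_subset[OF continuous_on_product_coordinates])

lemma Ck_add:
  assumes "nopen n U"
  shows "Ck n k U f \<Longrightarrow> Ck n k U g \<Longrightarrow> Ck n k U (\<lambda>x. f x + g x)"
proof (induction k arbitrary: f g)
  case (Suc k)
  then show ?case
    by (intro Ck_SucI[where f' = "\<lambda>i x. pd i f x + pd i g x"])
       (auto intro!: has_pd_add Suc.IH continuous_on_add assms)
qed (auto intro: continuous_on_add)

lemma Ck_sum:
  assumes "nopen n U" "\<And>j. j \<in> S \<Longrightarrow> Ck n k U (f j)"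
  shows "Ck n k U (\<lambda>x. \<Sum>j\<in>S. f j x)"
  using assms(2)
  by (induction S rule: infinite_finite_induct) (auto intro!: Ck_add Ck_const assms(1))

lemma Ck_linear:
  assumes "nopen n U" "bounded_linear L"
  shows "Ck n k U f \<Longrightarrow> Ck n k U (\<lambda>x. L (f x))"
proof (induction k arbitrary: f)
  case 0
  then show ?case by (auto intro: bounded_linear.continuous_on[OF assms(2)])
next
  case (Suc k)
  then show ?case
    by (intro Ck_SucI[where f' = "\<lambda>i x. L (pd i f x)"])
       (auto intro!: has_pd_linear[OF assms(2)] Suc.IH assms bounded_linear.continuous_on[OF assms(2)])
qed

lemma Ck_bilinear:
  assumes "nopen n U" "bounded_bilinear B"
  shows "Ck n k U f \<Longrightarrow> Ck n k U g \<Longrightarrow> Ck n k U (\<lambda>x. B (f x) (g x))"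
proof (induction k arbitrary: f g)
  case 0
  then show ?case by (auto intro: bounded_bilinear.continuous_on[OF assms(2)])
next
  case (Suc k)
  have "Ck n k U f" "Ck n k U g" using Suc.prems by (blast intro: Ck_lower)+
  with Suc show ?case
    by (intro Ck_SucI[where f' = "\<lambda>i x. B (f x) (pd i g x) + B (pd i f x) (g x)"])
       (auto intro!: has_pd_bilinear[OF assms(2)] Ck_add Suc.IH assms bounded_bilinear.continuous_on[OF assms(2)])
qed

lemma continuous_on_local:
  assumes "nopen n U"
    and "\<And>x. x \<in> U \<Longrightarrow> \<exists>e>0. continuous_on (U \<inter> box_nbhd n x e) f"
  shows "continuous_on U f"
  unfolding continuous_on_def
proof
  fix x assume x: "x \<in> U"
  then obtain e where e: "e > 0" "continuous_on (U \<inter> box_nbhd n x e) f" using assms(2) by blast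
  \<comment> \<open>A box is not open in the ambient product space, whereas \<open>W\<close> is,
    being cut out by finitely many coordinates. Inside \<open>U\<close> the two agree, since all
    coordinates from \<open>n\<close> on vanish there.\<close>
  define W where "W = (\<Inter>i<n. {y. \<bar>y i - x i\<bar> < e})"
  have "open W" unfolding W_def
    by (intro open_INT ballI open_Collect_less continuous_intros) auto
  have xW: "x \<in> W" using e by (simp add: W_def)
  have "y i = x i" if "y \<in> U" "n \<le> i" for y i
    using nopenD_zero[OF assms(1) x, of i] nopenD_zero[OF assms(1), of y i] that by simp
  then have eq: "U \<inter> box_nbhd n x e = U \<inter> W"
    by (auto simp: box_nbhd_def W_def)
  have "at x within U = at x within (U \<inter> W)"
    by (rule at_within_nhd[OF xW \<open>open W\<close>]) auto
  then show "(f \<longlongrightarrow> f x) (at x within U)"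
    using e(2) x xW by (simp add: eq continuous_on_def)
qed

lemma Ck_local:
  assumes "nopen n U"
    and "\<And>x. x \<in> U \<Longrightarrow> \<exists>e>0. Ck n k (U \<inter> box_nbhd n x e) f"
  shows "Ck n k U f"
  using assms(2)
proof (induction k arbitrary: f)
  case 0
  then show ?case by (auto intro: continuous_on_local[OF assms(1)])
next
  case (Suc k)
  have "continuous_on U f"
    by (rule continuous_on_local[OF assms(1)]) (meson Ck_imp_continuous_on Suc.prems)
  moreover have "has_pd i f (pd i f x) x" if x: "x \<in> U" and i: "i < n" for i x
  proof -
    obtain e where "e > 0" "Ck n (Suc k) (U \<inter> box_nbhd n x e) f" using Suc.prems[OF x] by blast
    then show ?thesis using x i by (auto simp: box_nbhd_def)
  qed
  moreover have "Ck n k U (pd i f)" if i: "i < n" for i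
    by (rule Suc.IH) (meson Ck_pd Suc.prems i)
  ultimately show ?case by simp
qed

definition smooth :: "nat \<Rightarrow> (nat \<Rightarrow> real) set \<Rightarrow> ((nat \<Rightarrow> real) \<Rightarrow> 'b::real_normed_vector) \<Rightarrow> bool" where
  "smooth n U f \<longleftrightarrow> (\<forall>k. Ck n k U f)"

lemma smooth_Ck: "smooth n U f \<Longrightarrow> Ck n k U f"
  by (simp add: smooth_def)

lemma smooth_continuous_on: "smooth n U f \<Longrightarrow> continuous_on U f"
  using smooth_Ck[of n U f 0] by simp

lemma smooth_pd: "smooth n U f \<Longrightarrow> i < n \<Longrightarrow> smooth n U (pd i f)"
  by (metis Ck_pd smooth_def)

lemma smooth_has_pd: "smooth n U f \<Longrightarrow> i < n \<Longrightarrow> x \<in> U \<Longrightarrow> has_pd i f (pd i f x) x"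
  by (metis Ck_has_pd smooth_def)

section \<open>Iterated integrals over cubes\<close>

lemma continuous_on_fun_upd:
  fixes f :: "'s::topological_space \<Rightarrow> nat \<Rightarrow> real"
  assumes "continuous_on S f" "continuous_on S g"
  shows "continuous_on S (\<lambda>x. (f x)(i := g x))"
proof (rule continuous_on_coordinatewise_then_product)
  fix j
  show "continuous_on S (\<lambda>x. ((f x)(i := g x)) j)"
    using assms continuous_on_product_then_coordinatewise[OF assms(1), of j]
    by (cases "i = j") auto
qed

definition cube :: "real \<Rightarrow> (nat \<Rightarrow> real) set" where
  "cube a = {y. \<forall>i. \<bar>y i\<bar> \<le> a}"

lemma cube_upd: "y \<in> cube a \<Longrightarrow> t \<in> {-a..a} \<Longrightarrow> y(i := t) \<in> cube a"
  by (auto simp: cube_def)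

text \<open>Iterated one-dimensional integrals take the place of a measure on R^n: continuity,
  Leibniz's rule and the fundamental theorem are then applied one variable at a time. The argument
  \<open>y\<close> supplies the coordinates that are not integrated, so the induction on
  \<open>n\<close> can freeze the outer variables.\<close>

fun bint :: "nat \<Rightarrow> real \<Rightarrow> ((nat \<Rightarrow> real) \<Rightarrow> real) \<Rightarrow> (nat \<Rightarrow> real) \<Rightarrow> real" where
  "bint 0 a h y = h y"
| "bint (Suc n) a h y = integral {-a..a} (\<lambda>t. bint n a h (y(n := t)))"

text \<open>Both the points of the averaging region and the real radius later serve as parameter,
  hence the general topological space.\<close>

lemma continuous_on_bint_param:
  fixes h :: "'s::topological_space \<Rightarrow> (nat \<Rightarrow> real) \<Rightarrow> real"
  assumes "continuous_on (S \<times> cube a) (\<lambda>(s, y). h s y)"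
  shows "continuous_on (S \<times> cube a) (\<lambda>(s, y). bint n a (h s) y)"
proof (induction n)
  case (Suc n)
  have "continuous_on ((S \<times> cube a) \<times> cbox (-a) a)
      ((\<lambda>(s, y). bint n a (h s) y) \<circ> (\<lambda>((s, y), t). (s, y(n := t))))"
  proof (rule continuous_on_compose)
    show "continuous_on ((S \<times> cube a) \<times> cbox (-a) a) (\<lambda>((s, y), t). (s, y(n := t)))"
      unfolding split_beta by (intro continuous_on_Pair continuous_on_fun_upd continuous_on_fst continuous_on_snd continuous_on_id)
    show "continuous_on ((\<lambda>((s, y), t). (s, y(n := t))) ` ((S \<times> cube a) \<times> cbox (-a) a))
        (\<lambda>(s, y). bint n a (h s) y)"
      by (rule continuous_on_subset[OF Suc]) (auto intro: cube_upd)
  qed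
  then have "continuous_on ((S \<times> cube a) \<times> cbox (-a) a)
      (\<lambda>(z, t). bint n a (h (fst z)) ((snd z)(n := t)))"
    by (simp add: o_def split_beta)
  from integral_continuous_on_param[OF this] show ?case
    by (simp add: split_beta)
qed (use assms in simp)

lemma continuous_on_bint:
  assumes "continuous_on (cube a) h"
  shows "continuous_on (cube a) (bint n a h)"
proof -
  have "continuous_on (({0::real} \<times> cube a)) (h \<circ> snd)"
    by (intro continuous_on_compose continuous_intros) (use assms in simp)
  then have "continuous_on ({0::real} \<times> cube a) (\<lambda>(s, y). bint n a h y)"
    by (intro continuous_on_bint_param) (simp add: o_def split_beta)
  from continuous_on_compose2[OF this, of "cube a" "Pair 0"] show ?thesis
    by (simp add: continuous_on_Pair image_subset_iff)
qed

lemma continuous_on_bint_line: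
  assumes "continuous_on (cube a) h" "y \<in> cube a"
  shows "continuous_on {-a..a} (\<lambda>t. bint n a h (y(m := t)))"
  by (rule continuous_on_compose2[OF continuous_on_bint[OF assms(1)]])
     (auto simp del: fun_upd_apply intro!: continuous_on_fun_upd continuous_on_const continuous_on_id cube_upd assms)

lemma bint_line_integrable:
  assumes "continuous_on (cube a) h" "y \<in> cube a"
  shows "(\<lambda>t. bint n a h (y(m := t))) integrable_on {-a..a}"
  by (rule integrable_continuous_real[OF continuous_on_bint_line[OF assms]])

lemma bint_cong:
  assumes "\<And>z. z \<in> cube a \<Longrightarrow> h z = g z" "y \<in> cube a"
  shows "bint n a h y = bint n a g y"
  using assms(2)
proof (induction n arbitrary: y)
  case (Suc n)
  then show ?case by (auto intro!: integral_cong cube_upd)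
qed (use assms in simp)

lemma bint_fun_upd:
  assumes "n \<le> m"
  shows "bint n a h (y(m := t)) = bint n a (\<lambda>z. h (z(m := t))) y"
  using assms
proof (induction n arbitrary: y)
  case (Suc n)
  then have "(y(m := t))(n := s) = (y(n := s))(m := t)" for s
    by (intro fun_upd_twist) simp
  with Suc show ?case by (simp del: fun_upd_apply)
qed simp

lemma bint_zero: "bint n a (\<lambda>_. 0) y = 0"
  by (induction n arbitrary: y) auto

lemma bint_add:
  assumes "continuous_on (cube a) h" "continuous_on (cube a) g" "y \<in> cube a"
  shows "bint n a (\<lambda>z. h z + g z) y = bint n a h y + bint n a g y"
  using assms(3)
proof (induction n arbitrary: y)
  case (Suc n)
  have "bint (Suc n) a (\<lambda>z. h z + g z) y
      = integral {-a..a} (\<lambda>t. bint n a h (y(n := t)) + bint n a g (y(n := t)))"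
    using Suc by (auto intro!: integral_cong cube_upd)
  also have "\<dots> = bint (Suc n) a h y + bint (Suc n) a g y"
    using assms Suc.prems by (simp add: integral_add bint_line_integrable)
  finally show ?case .
qed simp

lemma bint_cmult: "bint n a (\<lambda>z. c * h z) y = c * bint n a h y"
  by (induction n arbitrary: y) auto

lemma bint_sum:
  assumes "\<And>j. j \<in> S \<Longrightarrow> continuous_on (cube a) (h j)" "y \<in> cube a"
  shows "bint n a (\<lambda>z. \<Sum>j\<in>S. h j z) y = (\<Sum>j\<in>S. bint n a (h j) y)"
  using assms(1)
proof (induction S rule: infinite_finite_induct)
  case (insert j S)
  then have "bint n a (\<lambda>z. h j z + (\<Sum>j\<in>S. h j z)) y = bint n a (h j) y + bint n a (\<lambda>z. \<Sum>j\<in>S. h j z) y"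
    by (intro bint_add assms(2) continuous_on_sum) auto
  with insert show ?case by simp
qed (simp_all add: bint_zero)

text \<open>Both claims go through one induction: at \<open>t = y n\<close> the outer integrand is
  the inner integral at \<open>y\<close> itself, and a continuous nonnegative function with a
  positive value has a nonzero integral.\<close>

lemma bint_pos:
  assumes "continuous_on (cube a) h" "\<And>z. z \<in> cube a \<Longrightarrow> h z \<ge> 0" "a > 0"
  shows "y \<in> cube a \<Longrightarrow> bint n a h y \<ge> 0 \<and> (h y > 0 \<longrightarrow> bint n a h y > 0)"
proof (induction n arbitrary: y)
  case (Suc n)
  let ?g = "\<lambda>t. bint n a h (y(n := t))"
  have g0: "?g t \<ge> 0" if "t \<in> {-a..a}" for t
    using Suc cube_upd that by blast
  have c: "continuous_on {-a..a} ?g" by (rule continuous_on_bint_line[OF assms(1) Suc.prems])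
  have int0: "integral {-a..a} ?g \<ge> 0"
    by (rule integral_nonneg) (use g0 c in \<open>auto intro: integrable_continuous_real\<close>)
  have "integral {-a..a} ?g > 0" if "h y > 0"
  proof -
    have "y n \<in> {-a..a}" using Suc.prems by (auto simp: cube_def abs_le_iff) (metis neg_le_iff_le minus_minus)
    moreover have "?g (y n) > 0" using Suc that by simp
    ultimately have "integral {-a..a} ?g \<noteq> 0"
      using integral_eq_0_iff[OF c _ g0] assms(3) by force
    with int0 show ?thesis by simp
  qed
  with int0 show ?case by simp
qed (use assms in auto)

lemma bint_has_vector_derivative:
  fixes h h' :: "real \<Rightarrow> (nat \<Rightarrow> real) \<Rightarrow> real"
  assumes "\<And>s y. s \<in> T \<Longrightarrow> y \<in> cube a \<Longrightarrow>
      ((\<lambda>s. h s y) has_vector_derivative h' s y) (at s within T)"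
    and "continuous_on (T \<times> cube a) (\<lambda>(s, y). h s y)"
    and "continuous_on (T \<times> cube a) (\<lambda>(s, y). h' s y)"
    and "convex T" "s \<in> T"
  shows "y \<in> cube a \<Longrightarrow>
    ((\<lambda>s. bint n a (h s) y) has_vector_derivative bint n a (h' s) y) (at s within T)"
  using assms(5)
proof (induction n arbitrary: s y)
  case (Suc n)
  have "((\<lambda>s. integral (cbox (-a) a) (\<lambda>t. bint n a (h s) (y(n := t))))
      has_vector_derivative integral (cbox (-a) a) (\<lambda>t. bint n a (h' s) (y(n := t)))) (at s within T)"
  proof (rule leibniz_rule_vector_derivative)
    fix x t assume "x \<in> T" "t \<in> cbox (-a) a"
    then show "((\<lambda>s. bint n a (h s) (y(n := t))) has_vector_derivative bint n a (h' x) (y(n := t)))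
        (at x within T)"
      using Suc by (intro Suc.IH cube_upd) auto
  next
    fix x assume x: "x \<in> T"
    have "continuous_on (cube a) (h x)"
      using continuous_on_compose2[OF assms(2), of "cube a" "Pair x"] x
      by (simp add: continuous_on_Pair image_subset_iff)
    then show "(\<lambda>t. bint n a (h x) (y(n := t))) integrable_on cbox (-a) a"
      using bint_line_integrable Suc.prems by simp
  next
    have "continuous_on (T \<times> cbox (-a) a)
        ((\<lambda>(s, y). bint n a (h' s) y) \<circ> (\<lambda>(s, t). (s, y(n := t))))"
      by (intro continuous_on_compose continuous_on_subset[OF continuous_on_bint_param[OF assms(3)]])
         (use Suc.prems in \<open>auto simp del: fun_upd_apply simp: split_beta intro!: continuous_on_Pair
           continuous_on_fst continuous_on_snd continuous_on_id continuous_on_const continuous_on_fun_upd cube_upd\<close>)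
    then show "continuous_on (T \<times> cbox (-a) a) (\<lambda>(s, t). bint n a (h' s) (y(n := t)))"
      by (simp add: o_def split_beta)
  qed (use Suc.prems assms(4) in auto)
  then show ?case by simp
qed (use assms in auto)

text \<open>Integration by parts without boundary terms. At the \<open>j\<close>-th integration the
  derivative moves out of the inner integrals, and the fundamental theorem leaves two faces of the
  cube, where \<open>h\<close> vanishes; the integrations outside it only see zero.\<close>

lemma bint_partial_derivative_eq_0:
  assumes deriv: "\<And>y t. y \<in> cube a \<Longrightarrow> t \<in> {-a..a} \<Longrightarrow>
      ((\<lambda>t. h (y(j := t))) has_vector_derivative h' (y(j := t))) (at t within {-a..a})"
    and ch: "continuous_on (cube a) h" and ch': "continuous_on (cube a) h'"
    and bd: "\<And>y. y \<in> cube a \<Longrightarrow> h (y(j := a)) = 0" "\<And>y. y \<in> cube a \<Longrightarrow> h (y(j := -a)) = 0"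
    and "a \<ge> 0" "j < n" "y \<in> cube a"
  shows "bint n a h' y = 0"
  using assms(7,8)
proof (induction n arbitrary: y)
  case (Suc n)
  show ?case
  proof (cases "j < n")
    case True
    have "integral {-a..a} (\<lambda>t. bint n a h' (y(n := t))) = integral {-a..a} (\<lambda>_. 0)"
      by (intro integral_cong Suc.IH cube_upd True Suc.prems)
    then show ?thesis by simp
  next
    case False
    then have j: "j = n" using Suc.prems by simp
    have *: "((\<lambda>t. bint n a (\<lambda>z. h (z(n := t))) y) has_vector_derivative
        bint n a (\<lambda>z. h' (z(n := t))) y) (at t within {-a..a})" if "t \<in> {-a..a}" for t
    proof (rule bint_has_vector_derivative)
      show "continuous_on ({-a..a} \<times> cube a) (\<lambda>(s, y). h (y(n := s)))"
        unfolding split_beta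
        by (rule continuous_on_compose2[OF ch]) (auto simp del: fun_upd_apply intro!:
           continuous_on_fst continuous_on_snd continuous_on_id continuous_on_fun_upd cube_upd)
      show "continuous_on ({-a..a} \<times> cube a) (\<lambda>(s, y). h' (y(n := s)))"
        unfolding split_beta
        by (rule continuous_on_compose2[OF ch']) (auto simp del: fun_upd_apply intro!:
           continuous_on_fst continuous_on_snd continuous_on_id continuous_on_fun_upd cube_upd)
    qed (use deriv that Suc.prems j in \<open>auto simp del: fun_upd_apply\<close>)
    have "((\<lambda>t. bint n a (\<lambda>z. h' (z(n := t))) y) has_integral
        bint n a (\<lambda>z. h (z(n := a))) y - bint n a (\<lambda>z. h (z(n := -a))) y) {-a..a}"
      by (rule fundamental_theorem_of_calculus) (use * assms(6) in \<open>auto simp del: fun_upd_apply\<close>)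
    moreover have "bint n a (\<lambda>z. h (z(n := a))) y = bint n a (\<lambda>_. 0) y"
      by (rule bint_cong) (use bd j Suc.prems in \<open>auto simp del: fun_upd_apply\<close>)
    moreover have "bint n a (\<lambda>z. h (z(n := -a))) y = bint n a (\<lambda>_. 0) y"
      by (rule bint_cong) (use bd j Suc.prems in \<open>auto simp del: fun_upd_apply\<close>)
    ultimately show ?thesis
      by (simp add: bint_fun_upd bint_zero integral_unique del: fun_upd_apply)
  qed
qed simp

text \<open>Changing the coordinates one after the other, the chain rule follows from its two-variable case.\<close>

lemma has_vector_derivative_along_line:
  fixes v :: "(nat \<Rightarrow> real) \<Rightarrow> real"
  assumes U: "nopen n U" and v: "Ck n 1 U v" and x: "x \<in> U" and y: "\<And>i. n \<le> i \<Longrightarrow> y i = 0"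
  shows "((\<lambda>s. v (\<lambda>i. x i + s * y i)) has_vector_derivative (\<Sum>i<n. y i * pd i v x)) (at 0)"
proof -
  obtain e where e: "e > 0" "box_nbhd n x e \<subseteq> U" using U x by (rule nopenE)
  \<comment> \<open>The summand \<open>1\<close> keeps \<open>M\<close> positive for
    \<open>y = 0\<close>; dividing \<open>e\<close> by \<open>M\<close> keeps every coordinate
    displacement below \<open>e\<close>.\<close>
  define M where "M = (\<Sum>i<n. \<bar>y i\<bar>) + 1"
  have M: "M > 0" unfolding M_def by (smt (verit) sum_nonneg abs_ge_zero)
  have yM: "\<bar>y i\<bar> \<le> M" if "i < n" for i
    using member_le_sum[of i "{..<n}" "\<lambda>i. \<bar>y i\<bar>"] that by (simp add: M_def)
  define d where "d = e / M"
  have d: "d > 0" using e M by (simp add: d_def)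
  have small: "\<bar>s * y i\<bar> < e" if "\<bar>s\<bar> < d" "i < n" for s i
  proof -
    have "\<bar>s * y i\<bar> \<le> \<bar>s\<bar> * M" using yM[OF that(2)] by (simp add: abs_mult mult_left_mono)
    also have "\<dots> < d * M" using that M by simp
    also have "\<dots> = e" using M by (simp add: d_def)
    finally show ?thesis .
  qed
  \<comment> \<open>Coordinates below \<open>k\<close> have moved with \<open>s\<close>, the
    \<open>k\<close>-th moves with \<open>t\<close>. Setting \<open>t = s\<close> gives the path for
    \<open>Suc k\<close> at \<open>t = 0\<close>, which closes the induction.\<close>
  define pt where "pt = (\<lambda>k s t i. x i + (if i < k then s * y i else if i = k then t * y i else 0))"
  have ptU: "pt k s t \<in> U" if "k < n" "\<bar>s\<bar> < d" "\<bar>t\<bar> < d" for k s t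
    using e small that y by (intro subsetD[OF e(2)]) (auto simp: box_nbhd_def pt_def)
  have "((\<lambda>s. v (pt k s 0)) has_derivative (\<lambda>h. h * (\<Sum>i<k. y i * pd i v x))) (at 0)" if "k \<le> n" for k
    using that
  proof (induction k)
    case 0
    then show ?case by (simp add: pt_def)
  next
    case (Suc k)
    let ?X = "{-d<..<d}"
    let ?F = "\<lambda>s t. blinfun_scaleR_left (y k * pd k v (pt k s t))"
    have k: "k < n" using Suc by simp
    \<comment> \<open>Joint differentiability needs continuity of only one partial derivative: in
      \<open>t\<close> it comes from \<open>pd k v\<close>, while in \<open>s\<close> the induction
      hypothesis at the origin is enough.\<close>
    have "((\<lambda>(s::real, t::real). v (pt k s t)) has_derivative
        (\<lambda>(ts::real, tt::real). ts * (\<Sum>i<k. y i * pd i v x) + blinfun_apply (?F 0 0) tt)) (at (0, 0) within ?X \<times> ?X)"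
    proof (rule has_derivative_partialsI[where f = "\<lambda>s t. v (pt k s t)" and fy = ?F
          and fx = "\<lambda>h. h * (\<Sum>i<k. y i * pd i v x)"])
      show "((\<lambda>s. v (pt k s 0)) has_derivative (\<lambda>h. h * (\<Sum>i<k. y i * pd i v x))) (at 0 within ?X)"
        by (rule has_derivative_at_withinI, rule Suc.IH) (use k in simp)
    next
      fix s t assume st: "s \<in> ?X" "t \<in> ?X"
      let ?z = "pt k s t"
      have "?z \<in> U" using st k by (intro ptU) auto
      then have "((\<lambda>r. v (?z(k := r))) has_vector_derivative pd k v ?z) (at (?z k))"
        using v k by (simp add: has_pd_def)
      then have "((\<lambda>r. v (?z(k := r))) has_vector_derivative pd k v ?z) (at (x k + t * y k))"
        by (simp add: pt_def)
      moreover have "((\<lambda>t. x k + t * y k) has_vector_derivative y k) (at t within ?X)"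
        by (auto intro!: derivative_eq_intros)
      ultimately have "(((\<lambda>r. v (?z(k := r))) \<circ> (\<lambda>t. x k + t * y k)) has_vector_derivative
          y k *\<^sub>R pd k v ?z) (at t within ?X)"
        by (intro vector_diff_chain_within) (auto intro: has_vector_derivative_at_within)
      moreover have "?z(k := x k + r * y k) = pt k s r" for r
        by (auto simp: pt_def fun_eq_iff)
      ultimately show "((\<lambda>t. v (pt k s t)) has_derivative blinfun_apply (?F s t)) (at t within ?X)"
        by (simp add: o_def has_vector_derivative_def)
    next
      have "continuous_on (?X \<times> ?X) (\<lambda>(s, t). pd k v (pt k s t))"
        unfolding split_beta
      proof (rule continuous_on_compose2[where g = "pd k v" and f = "\<lambda>z. pt k (fst z) (snd z)"])
        show "continuous_on U (pd k v)" using v k by simp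
        show "continuous_on (?X \<times> ?X) (\<lambda>z. pt k (fst z) (snd z))"
        proof (rule continuous_on_coordinatewise_then_product)
          fix i
          show "continuous_on (?X \<times> ?X) (\<lambda>z. pt k (fst z) (snd z) i)"
            unfolding pt_def by (cases "i < k"; cases "i = k") (auto intro!: continuous_intros)
        qed
        show "(\<lambda>z. pt k (fst z) (snd z)) ` (?X \<times> ?X) \<subseteq> U"
          using ptU k by auto
      qed
      then have "continuous_on (?X \<times> ?X) (\<lambda>(s, t). ?F s t)"
        unfolding split_beta by (intro continuous_intros)
      then show "continuous (at (0, 0) within ?X \<times> ?X) (\<lambda>(s, t). ?F s t)"
        using d by (simp add: continuous_on_eq_continuous_within)
    qed (use d in auto)
    moreover have X: "at (0, 0) within ?X \<times> ?X = at (0, 0)"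
      by (rule at_within_open) (use d in \<open>auto intro: open_Times\<close>)
    ultimately have *: "((\<lambda>(s, t). v (pt k s t)) has_derivative (\<lambda>(ts, tt).
        ts * (\<Sum>i<k. y i * pd i v x) + blinfun_apply (?F 0 0) tt)) (at (0, 0))"
      by simp
    have "((\<lambda>s::real. (s, s)) has_derivative (\<lambda>h. (h, h))) (at 0)"
      by (auto intro!: derivative_eq_intros)
    from has_derivative_compose[OF this *]
    have "((\<lambda>s. v (pt k s s)) has_derivative
        (\<lambda>h. h * (\<Sum>i<k. y i * pd i v x) + blinfun_apply (?F 0 0) h)) (at 0)"
      by simp
    moreover have "pt k s s = pt (Suc k) s 0" for s
      by (auto simp: pt_def fun_eq_iff less_Suc_eq)
    moreover have "pt k 0 0 = x" by (auto simp: pt_def fun_eq_iff)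
    ultimately show ?case by (simp add: distrib_left)
  qed
  from this[of n] have "((\<lambda>s. v (pt n s 0)) has_derivative (\<lambda>h. h * (\<Sum>i<n. y i * pd i v x))) (at 0)"
    by simp
  moreover have "pt n s 0 = (\<lambda>i. x i + s * y i)" for s
    using y by (auto simp: pt_def fun_eq_iff)
  ultimately show ?thesis by (simp add: has_vector_derivative_def)
qed

section \<open>Mean values and regularity\<close>

lemma bounded_linear_coeff: "bounded_linear (\<lambda>a. coeff a A)"
proof (rule bounded_linear_intro[where K = 1])
  fix a
  show "norm (coeff a A) \<le> norm a * 1"
  proof (cases "A \<in> supp a")
    case True
    then show ?thesis
      using member_le_sum[of A "supp a" "\<lambda>A. \<bar>coeff a A\<bar>"] by (simp add: norm_clifford_def)
  next
    case False
    then show ?thesis by (simp add: supp_def)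
  qed
qed auto

lemma coeff_sum: "coeff (\<Sum>j\<in>S. f j) A = (\<Sum>j\<in>S. coeff (f j) A)"
  by (rule linear_sum[OF bounded_linear.linear[OF bounded_linear_coeff]])

lemma clifford_eq_sum_blade:
  assumes "finite S" "\<And>A. A \<notin> S \<Longrightarrow> coeff a A = 0"
  shows "a = (\<Sum>A\<in>S. coeff a A *\<^sub>R blade A)"
proof (rule clifford_eqI)
  fix B
  have "coeff (\<Sum>A\<in>S. coeff a A *\<^sub>R blade A) B = (\<Sum>A\<in>S. if A = B then coeff a B else 0)"
    unfolding coeff_sum by (intro sum.cong) (use coeff_nonzero_finite in fastforce)+
  then show "coeff a B = coeff (\<Sum>A\<in>S. coeff a A *\<^sub>R blade A) B"
    using assms by (simp add: sum.delta)
qed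

text \<open>The type \<open>clifford\<close> is infinite-dimensional, so smooth coefficients alone
  are not enough; a common finite set \<open>S\<close> of blades turns the function into a finite
  sum.\<close>

lemma Ck_coeffI:
  assumes U: "nopen n U" and S: "finite S" "\<And>x A. x \<in> U \<Longrightarrow> A \<notin> S \<Longrightarrow> coeff (f x) A = 0"
    and "\<And>A. A \<in> S \<Longrightarrow> Ck n k U (\<lambda>x. coeff (f x) A)"
  shows "Ck n k U f"
proof -
  have "Ck n k U (\<lambda>x. \<Sum>A\<in>S. coeff (f x) A *\<^sub>R blade A)"
    using assms(4) by (intro Ck_sum[OF U] Ck_linear[OF U bounded_linear_scaleR_left])
  then show ?thesis
    by (rule Ck_cong[OF U, rotated]) (metis clifford_eq_sum_blade S)
qed

lemma coeff_pd_eq_0: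
  assumes "nopen n U" "Ck n (Suc k) U f" "x \<in> U" "i < n" "\<And>x. x \<in> U \<Longrightarrow> coeff (f x) A = 0"
  shows "coeff (pd i f x) A = 0"
proof -
  have "has_pd i (\<lambda>x. coeff (f x) A) (coeff (pd i f x) A) x"
    using assms by (intro has_pd_linear[OF bounded_linear_coeff]) simp
  moreover have "has_pd i (\<lambda>x. coeff (f x) A) 0 x"
    by (rule has_pd_cong[OF assms(1,3,4) _ has_pd_const]) (simp add: assms(5))
  ultimately show ?thesis using has_pd_unique by metis
qed

section \<open>Dilated translations and radial bump functions\<close>

definition shift :: "nat \<Rightarrow> (nat \<Rightarrow> real) \<Rightarrow> real \<Rightarrow> (nat \<Rightarrow> real) \<Rightarrow> (nat \<Rightarrow> real)" where
  "shift n x s y = (\<lambda>i. x i + (if i < n then s * y i else 0))"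

lemma continuous_on_shift:
  assumes "continuous_on S x" "continuous_on S s" "continuous_on S y"
  shows "continuous_on S (\<lambda>z. shift n (x z) (s z) (y z))"
proof (rule continuous_on_coordinatewise_then_product)
  fix i
  show "continuous_on S (\<lambda>z. shift n (x z) (s z) (y z) i)"
    using continuous_on_product_then_coordinatewise[OF assms(1), of i]
      continuous_on_product_then_coordinatewise[OF assms(3), of i] assms(2)
    by (cases "i < n") (auto simp: shift_def intro!: continuous_intros)
qed

lemma shift_upd_left: "j < n \<Longrightarrow> shift n (x(j := t)) 1 y = (shift n x 1 y)(j := t + y j)"
  by (auto simp: shift_def fun_eq_iff)

lemma shift_upd_right: "j < n \<Longrightarrow> shift n x s (y(j := t)) = (shift n x s y)(j := x j + s * t)"
  by (auto simp: shift_def fun_eq_iff)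

text \<open>The outer square makes the truncated paraboloid continuously differentiable, which
  suffices because each use moves a single derivative. It vanishes on the faces of the cube, and its
  gradient \<open>dbump\<close> is \<open>y j\<close> times a factor common to all
  \<open>j\<close>.\<close>

definition bump :: "nat \<Rightarrow> real \<Rightarrow> (nat \<Rightarrow> real) \<Rightarrow> real" where
  "bump n a y = (max 0 (a\<^sup>2 - (\<Sum>i<n. (y i)\<^sup>2)))\<^sup>2"

definition dbump :: "nat \<Rightarrow> real \<Rightarrow> nat \<Rightarrow> (nat \<Rightarrow> real) \<Rightarrow> real" where
  "dbump n a j y = - 4 * y j * max 0 (a\<^sup>2 - (\<Sum>i<n. (y i)\<^sup>2))"

lemma continuous_on_coord: "continuous_on S (\<lambda>y::nat \<Rightarrow> real. y i)"
  by (rule continuous_on_subset[OF continuous_on_product_coordinates subset_UNIV])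

lemma continuous_on_bump: "continuous_on S (bump n a)"
  unfolding bump_def[abs_def] by (intro continuous_intros continuous_on_coord)

lemma continuous_on_dbump: "continuous_on S (dbump n a j)"
  unfolding dbump_def[abs_def] by (intro continuous_intros continuous_on_coord)

lemma bump_eq_0:
  assumes "j < n" "\<bar>y j\<bar> = a"
  shows "bump n a y = 0"
proof -
  have "(y j)\<^sup>2 \<le> (\<Sum>i<n. (y i)\<^sup>2)"
    by (rule member_le_sum) (use assms in auto)
  moreover have "(y j)\<^sup>2 = a\<^sup>2" using assms by (metis power2_abs)
  ultimately show ?thesis by (simp add: bump_def)
qed

lemma has_vector_derivative_max_0_square:
  "((\<lambda>u::real. (max 0 u)\<^sup>2) has_vector_derivative 2 * max 0 u) (at u)"
proof -
  consider "u > 0" | "u < 0" | "u = 0" by linarith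
  then have "((\<lambda>u::real. (max 0 u)\<^sup>2) has_field_derivative 2 * max 0 u) (at u)"
  proof cases
    case 1
    have "((\<lambda>u::real. u\<^sup>2) has_field_derivative 2 * u) (at u)"
      by (auto intro!: derivative_eq_intros)
    then show ?thesis
      using 1 by (rule_tac has_field_derivative_transform_within_open[of _ _ _ "{0<..}"]) auto
  next
    case 2
    have "((\<lambda>u::real. 0) has_field_derivative 0) (at u)" by simp
    then show ?thesis
      using 2 by (rule_tac has_field_derivative_transform_within_open[of _ _ _ "{..<0}"]) auto
  next
    case 3
    have "((\<lambda>h::real. max 0 h) \<longlongrightarrow> 0) (at 0)"
      by (rule tendsto_eq_intros tendsto_ident_at refl | simp)+
    moreover have "(max 0 (0 + h))\<^sup>2 / h = max 0 h" for h :: real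
      by (cases "h > 0") (auto simp: power2_eq_square max_def)
    ultimately show ?thesis using 3 by (simp add: DERIV_def)
  qed
  then show ?thesis by (simp add: has_real_derivative_iff_has_vector_derivative)
qed

lemma bump_has_vector_derivative:
  assumes "j < n"
  shows "((\<lambda>t. bump n a (y(j := t))) has_vector_derivative dbump n a j (y(j := t))) (at t within T)"
proof -
  define c where "c = a\<^sup>2 - (\<Sum>i\<in>{..<n} - {j}. (y i)\<^sup>2)"
  have c: "a\<^sup>2 - (\<Sum>i<n. ((y(j := t)) i)\<^sup>2) = c - t\<^sup>2" for t
    using assms by (simp add: c_def sum.remove[of "{..<n}" j])
  have "((\<lambda>t. c - t\<^sup>2) has_field_derivative - (2 * t)) (at t within T)"
    by (auto intro!: derivative_eq_intros)
  then have "((\<lambda>t. c - t\<^sup>2) has_vector_derivative - (2 * t)) (at t within T)"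
    by (simp add: has_real_derivative_iff_has_vector_derivative)
  then have "(((\<lambda>u. (max 0 u)\<^sup>2) \<circ> (\<lambda>t. c - t\<^sup>2)) has_vector_derivative
      - (2 * t) *\<^sub>R (2 * max 0 (c - t\<^sup>2))) (at t within T)"
    by (rule vector_diff_chain_within)
       (rule has_vector_derivative_at_within[OF has_vector_derivative_max_0_square])
  then show ?thesis by (simp add: bump_def dbump_def c o_def del: fun_upd_apply) (simp add: mult_ac)
qed

text \<open>Radius \<open>2 * a\<close> leaves room to move any point of the box of radius
  \<open>a\<close> by any vector of \<open>cube a\<close>, so that averages over the cube see only
  values on \<open>U\<close>.\<close>

locale smoothing =
  fixes n :: nat and U :: "(nat \<Rightarrow> real) set" and x0 :: "nat \<Rightarrow> real" and a :: real
  assumes U: "nopen n U" and x0: "x0 \<in> U" and a: "a > 0" and big: "box_nbhd n x0 (2 * a) \<subseteq> U"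
begin

abbreviation "W \<equiv> box_nbhd n x0 a"

lemma W: "nopen n W"
  by (rule nopen_box_nbhd) (rule nopenD_zero[OF U x0])

lemma shift_in_U:
  assumes "x \<in> W" "y \<in> cube a" "0 \<le> s" "s \<le> 1"
  shows "shift n x s y \<in> U"
proof (rule subsetD[OF big], unfold box_nbhd_def, intro CollectI conjI allI impI)
  fix i assume "i < n"
  have "\<bar>s * y i\<bar> \<le> 1 * a"
    unfolding abs_mult using assms by (intro mult_mono) (auto simp: cube_def)
  then show "\<bar>shift n x s y i - x0 i\<bar> < 2 * a"
    using assms(1) \<open>i < n\<close> by (auto simp: shift_def box_nbhd_def)
qed (use assms in \<open>auto simp: shift_def box_nbhd_def\<close>)

lemma W_subset: "W \<subseteq> U"
  using big a by (force simp: box_nbhd_def)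

lemma zero_cube: "(\<lambda>_. 0) \<in> cube a"
  using a by (simp add: cube_def)

text \<open>The kernel is taken at \<open>y\<close> and not at \<open>- y\<close>, so trading a
  derivative of \<open>v\<close> for one of the kernel is plain integration by parts in
  \<open>y\<close>.\<close>

definition conv :: "((nat \<Rightarrow> real) \<Rightarrow> real) \<Rightarrow> ((nat \<Rightarrow> real) \<Rightarrow> real) \<Rightarrow> (nat \<Rightarrow> real) \<Rightarrow> real" where
  "conv v k x = bint n a (\<lambda>y. v (shift n x 1 y) * k y) (\<lambda>_. 0)"

lemma continuous_on_shift_W:
  assumes "continuous_on U v" "x \<in> W" "0 \<le> s" "s \<le> 1"
  shows "continuous_on (cube a) (\<lambda>y. v (shift n x s y))"
  by (rule continuous_on_compose2[OF assms(1)])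
     (auto intro!: continuous_on_shift continuous_on_const continuous_on_id shift_in_U assms)

lemma continuous_on_conv:
  assumes "continuous_on U v" "continuous_on UNIV k"
  shows "continuous_on W (conv v k)"
proof -
  have "continuous_on (W \<times> cube a) (\<lambda>(x, y). v (shift n x 1 y) * k y)"
    unfolding split_beta
    by (intro continuous_on_mult continuous_on_compose2[OF assms(1)] continuous_on_compose2[OF assms(2)]
        continuous_on_shift continuous_on_fst continuous_on_snd continuous_on_id continuous_on_const)
       (auto intro!: shift_in_U)
  then have "continuous_on (W \<times> cube a) (\<lambda>(x, y). bint n a (\<lambda>y. v (shift n x 1 y) * k y) y)"
    by (rule continuous_on_bint_param)
  from continuous_on_compose2[OF this, of W "\<lambda>x. (x, \<lambda>_. 0)"] show ?thesis
    using zero_cube by (simp add: conv_def[abs_def] image_subset_iff continuous_on_Pair)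
qed

text \<open>The derivative falls on \<open>v\<close>, so the kernel need only be continuous. This
  admits \<open>dbump\<close> as a kernel in spite of its kink on the sphere of radius
  \<open>a\<close>.\<close>

lemma has_pd_conv:
  assumes v: "Ck n 1 U v" and k: "continuous_on UNIV k" and x: "x \<in> W" and j: "j < n"
  shows "has_pd j (conv v k) (conv (pd j v) k x) x"
proof -
  let ?T = "{x0 j - a<..<x0 j + a}"
  have xT: "x j \<in> ?T" using x j by (auto simp: box_nbhd_def abs_less_iff)
  have xt: "x(j := t) \<in> W" if "t \<in> ?T" for t
    using x j that by (auto simp: box_nbhd_def abs_less_iff)
  have cont: "continuous_on (?T \<times> cube a) (\<lambda>(t, y). g (shift n (x(j := t)) 1 y) * k y)"
    if "continuous_on U g" for g :: "(nat \<Rightarrow> real) \<Rightarrow> real"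
    unfolding split_beta
    by (intro continuous_on_mult continuous_on_compose2[OF that] continuous_on_compose2[OF k]
        continuous_on_shift continuous_on_fun_upd continuous_on_fst continuous_on_snd
        continuous_on_id continuous_on_const) (auto intro!: shift_in_U xt simp del: fun_upd_apply)
  have "((\<lambda>t. bint n a (\<lambda>y. v (shift n (x(j := t)) 1 y) * k y) (\<lambda>_. 0)) has_vector_derivative
      bint n a (\<lambda>y. pd j v (shift n (x(j := x j)) 1 y) * k y) (\<lambda>_. 0)) (at (x j) within ?T)"
  proof (rule bint_has_vector_derivative)
    fix t y assume t: "t \<in> ?T" and y: "y \<in> cube a"
    let ?z = "shift n (x(j := t)) 1 y"
    have "?z \<in> U" using t y xt by (intro shift_in_U) auto
    then have "has_pd j v (pd j v ?z) ?z" using v j by simp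
    then have "((\<lambda>r. v (?z(j := r))) has_vector_derivative pd j v ?z) (at (t + y j))"
      using j by (simp add: has_pd_def shift_upd_left)
    moreover have "((\<lambda>t. t + y j) has_vector_derivative 1) (at t within ?T)"
      by (auto intro!: derivative_eq_intros)
    ultimately have "(((\<lambda>r. v (?z(j := r))) \<circ> (\<lambda>t. t + y j)) has_vector_derivative
        1 *\<^sub>R pd j v ?z) (at t within ?T)"
      by (intro vector_diff_chain_within) (auto intro: has_vector_derivative_at_within)
    then have "((\<lambda>t. v (shift n (x(j := t)) 1 y)) has_vector_derivative pd j v ?z) (at t within ?T)"
      using j by (simp add: o_def shift_upd_left)
    then show "((\<lambda>t. v (shift n (x(j := t)) 1 y) * k y) has_vector_derivative pd j v ?z * k y)
        (at t within ?T)"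
      by (rule has_vector_derivative_mult_left)
  next
    show "continuous_on (?T \<times> cube a) (\<lambda>(t, y). v (shift n (x(j := t)) 1 y) * k y)"
      by (rule cont) (use v in simp)
    show "continuous_on (?T \<times> cube a) (\<lambda>(t, y). pd j v (shift n (x(j := t)) 1 y) * k y)"
      by (rule cont) (use v j in simp)
  qed (use xT zero_cube in auto)
  then show ?thesis
    unfolding has_pd_def conv_def using xT at_within_open[of "x j" ?T] by simp
qed

lemma Ck_conv:
  assumes "Ck n 1 U v" "continuous_on UNIV k"
  shows "Ck n 1 W (conv v k)"
  unfolding One_nat_def
  by (rule Ck_SucI[OF W, where f' = "\<lambda>j. conv (pd j v) k"])
     (use assms in \<open>auto intro!: has_pd_conv continuous_on_conv\<close>)

text \<open>The factor \<open>s\<close> is the inner derivative in \<open>y j\<close>. Two instances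
  matter: \<open>g y = y i\<close> at every radius, for the independence of the averages from
  \<open>s\<close>, and \<open>g = 1\<close> with \<open>s = 1\<close>, which moves a derivative
  from \<open>v\<close> to the bump.\<close>

lemma shift_bump_parts:
  assumes v: "Ck n 1 U v" and x: "x \<in> W" and s: "0 \<le> s" "s \<le> 1" and j: "j < n"
    and g: "continuous_on UNIV g" "\<And>y t. g (y(j := t)) = g y"
  shows "s * bint n a (\<lambda>y. g y * pd j v (shift n x s y) * bump n a y) (\<lambda>_. 0)
       = - bint n a (\<lambda>y. g y * v (shift n x s y) * dbump n a j y) (\<lambda>_. 0)"
proof -
  have cv: "continuous_on (cube a) (\<lambda>y. v (shift n x s y))"
    by (rule continuous_on_shift_W) (use v x s in auto)
  have cd: "continuous_on (cube a) (\<lambda>y. pd j v (shift n x s y))"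
    by (rule continuous_on_shift_W) (use v x s j in auto)
  have cg: "continuous_on (cube a) g" using g(1) by (rule continuous_on_subset) simp
  note cs = continuous_on_add continuous_on_mult continuous_on_const cv cd cg
    continuous_on_bump continuous_on_dbump
  have "bint n a (\<lambda>y. s * (g y * pd j v (shift n x s y) * bump n a y)
      + g y * v (shift n x s y) * dbump n a j y) (\<lambda>_. 0) = 0"
  proof (rule bint_partial_derivative_eq_0[where h = "\<lambda>y. g y * v (shift n x s y) * bump n a y"
        and j = j])
    fix y t assume y: "y \<in> cube a" and t: "t \<in> {-a..a}"
    let ?z = "shift n x s (y(j := t))"
    have "?z \<in> U" using cube_upd[OF y t] x s by (intro shift_in_U) auto
    then have "has_pd j v (pd j v ?z) ?z" using v j by simp
    then have "((\<lambda>r. v (?z(j := r))) has_vector_derivative pd j v ?z) (at (x j + s * t))"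
      using j by (simp add: has_pd_def shift_upd_right)
    moreover have "((\<lambda>t. x j + s * t) has_vector_derivative s) (at t within {-a..a})"
      by (auto intro!: derivative_eq_intros)
    ultimately have "(((\<lambda>r. v (?z(j := r))) \<circ> (\<lambda>t. x j + s * t)) has_vector_derivative
        s *\<^sub>R pd j v ?z) (at t within {-a..a})"
      by (intro vector_diff_chain_within) (auto intro: has_vector_derivative_at_within)
    then have 1: "((\<lambda>t. v (shift n x s (y(j := t)))) has_vector_derivative s * pd j v ?z)
        (at t within {-a..a})"
      using j by (simp add: o_def shift_upd_right)
    have "((\<lambda>t. g y * v (shift n x s (y(j := t))) * bump n a (y(j := t))) has_vector_derivative
        g y * v ?z * dbump n a j (y(j := t)) + g y * (s * pd j v ?z) * bump n a (y(j := t)))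
        (at t within {-a..a})"
      by (intro has_vector_derivative_mult has_vector_derivative_mult_right 1
          bump_has_vector_derivative j)
    then show "((\<lambda>t. g (y(j := t)) * v (shift n x s (y(j := t))) * bump n a (y(j := t)))
        has_vector_derivative s * (g (y(j := t)) * pd j v ?z * bump n a (y(j := t)))
          + g (y(j := t)) * v ?z * dbump n a j (y(j := t))) (at t within {-a..a})"
      by (simp add: g(2) algebra_simps del: fun_upd_apply)
  next
    show "continuous_on (cube a) (\<lambda>y. g y * v (shift n x s y) * bump n a y)"
      by (intro cs)
    show "continuous_on (cube a) (\<lambda>y. s * (g y * pd j v (shift n x s y) * bump n a y)
      + g y * v (shift n x s y) * dbump n a j y)"
      by (intro cs)
  next
    fix y
    show "g (y(j := a)) * v (shift n x s (y(j := a))) * bump n a (y(j := a)) = 0"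
      using bump_eq_0[of j n "y(j := a)" a] j a by simp
    show "g (y(j := -a)) * v (shift n x s (y(j := -a))) * bump n a (y(j := -a)) = 0"
      using bump_eq_0[of j n "y(j := -a)" a] j a by simp
  qed (use a j zero_cube in auto)
  moreover have "bint n a (\<lambda>y. s * (g y * pd j v (shift n x s y) * bump n a y)
      + g y * v (shift n x s y) * dbump n a j y) (\<lambda>_. 0)
      = s * bint n a (\<lambda>y. g y * pd j v (shift n x s y) * bump n a y) (\<lambda>_. 0)
       + bint n a (\<lambda>y. g y * v (shift n x s y) * dbump n a j y) (\<lambda>_. 0)"
    by (subst bint_add) (auto simp: bint_cmult zero_cube intro!: cs)
  ultimately show ?thesis by simp
qed

lemma has_vector_derivative_shift:
  assumes v: "Ck n 1 U v" and x: "x \<in> W" and y: "y \<in> cube a" and s: "0 \<le> s" "s \<le> 1"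
  shows "((\<lambda>s. v (shift n x s y)) has_vector_derivative (\<Sum>i<n. y i * pd i v (shift n x s y))) (at s)"
proof -
  \<comment> \<open>The chain rule along a line asks for a direction in R^n, whereas a point of the
    cube may have further nonzero coordinates, which \<open>shift\<close> ignores.\<close>
  define y' where "y' = (\<lambda>i. if i < n then y i else 0)"
  let ?z = "shift n x s y"
  have "((\<lambda>r. v (\<lambda>i. ?z i + r * y' i)) has_vector_derivative (\<Sum>i<n. y' i * pd i v ?z)) (at 0)"
    by (rule has_vector_derivative_along_line[OF U v shift_in_U[OF x y s]]) (simp add: y'_def)
  moreover have "(\<lambda>i. ?z i + r * y' i) = shift n x (r + s) y" for r
    by (auto simp: shift_def y'_def algebra_simps fun_eq_iff)
  moreover have "(\<Sum>i<n. y' i * pd i v ?z) = (\<Sum>i<n. y i * pd i v ?z)"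
    by (simp add: y'_def)
  ultimately have *: "((\<lambda>r. v (shift n x (r + s) y)) has_vector_derivative
      (\<Sum>i<n. y i * pd i v ?z)) (at (s - s))" by simp
  have "((\<lambda>t. t - s) has_vector_derivative 1) (at s)"
    by (auto intro!: derivative_eq_intros)
  from vector_diff_chain_at[OF this *] show ?thesis by (simp add: o_def)
qed

lemma bint_bump_pos: "bint n a (bump n a) (\<lambda>_. 0) > 0"
proof -
  have "bump n a (\<lambda>_. 0) > 0" using a by (simp add: bump_def)
  moreover have "\<And>z. z \<in> cube a \<Longrightarrow> bump n a z \<ge> 0" by (simp add: bump_def)
  ultimately show ?thesis using bint_pos[OF continuous_on_bump _ a zero_cube] by blast
qed

end

section \<open>The mean value property and the gain of derivatives\<close>

lemma continuous_on_bint_param_0: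
  fixes h :: "'s::topological_space \<Rightarrow> (nat \<Rightarrow> real) \<Rightarrow> real"
  assumes "continuous_on (S \<times> cube a) (\<lambda>(s, y). h s y)" "a \<ge> 0"
  shows "continuous_on S (\<lambda>s. bint n a (h s) (\<lambda>_. 0))"
  using continuous_on_compose2[OF continuous_on_bint_param[OF assms(1)], of S "\<lambda>x. (x, \<lambda>_. 0)"] assms(2)
  by (simp add: image_subset_iff continuous_on_Pair cube_def)

lemma Ck_linear_pd:
  assumes "nopen n U" "bounded_linear L" "Ck n (Suc k) U f" "i < n" "x \<in> U"
  shows "pd i (\<lambda>x. L (f x)) x = L (pd i f x)"
  using assms by (intro has_pd_unique has_pd_linear[OF assms(2)]) simp

text \<open>For \<open>i \<noteq> j\<close> the symmetry in \<open>i\<close> and \<open>j\<close> expresses that the rotation \<open>y\<^sub>i \<partial>\<^sub>j - y\<^sub>j \<partial>\<^sub>i\<close> annihilates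
  the radial function \<open>bump\<close>.  By the Clifford relations the radial derivative of a solution is a
  combination of such rotations, so that the spherical means do not depend on the radius.\<close>

lemma (in smoothing) mean_value:
  fixes V :: "(nat \<Rightarrow> real) \<Rightarrow> clifford" and L :: "clifford \<Rightarrow> real" and eps eta :: "nat \<Rightarrow> clifford"
  assumes V: "Ck n 1 U V" and L: "bounded_linear L"
    and sys: "\<And>z. z \<in> U \<Longrightarrow> (\<Sum>j<n. eps j * pd j V z) = 0"
    and cl: "\<And>i j. i < n \<Longrightarrow> j < n \<Longrightarrow> eta i * eps j + eta j * eps i = (if i = j then 2 else 0)"
    and x: "x \<in> W"
  shows "conv (\<lambda>z. L (V z)) (bump n a) x = L (V x) * bint n a (bump n a) (\<lambda>_. 0)"
proof -
  interpret L: bounded_linear L by (rule L)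
  have Lc: "bounded_linear (\<lambda>z. L (c * z))" for c
    by (rule bounded_linear_compose[OF L bounded_linear_mult_right])
  have Vc: "Ck n 1 U (\<lambda>z. L (c * V z))" for c
    by (rule Ck_linear[OF U Lc V])
  have pdc: "pd j (\<lambda>z. L (c * V z)) z = L (c * pd j V z)" if "j < n" "z \<in> U" for j c z
    using Ck_linear_pd[OF U Lc _ that] V unfolding One_nat_def by blast
  have contV: "continuous_on U (\<lambda>z. L (c * V z))" for c
    using Vc by (rule Ck_imp_continuous_on)
  have contpd: "continuous_on U (\<lambda>z. L (c * pd j V z))" if "j < n" for j c
    using V that by (intro bounded_linear.continuous_on[OF Lc]) simp
  \<comment> \<open>The sum of \<open>T s i i 1\<close> over \<open>i\<close> will be the derivative
    of the average in \<open>s\<close>. Independent indices \<open>i\<close>, \<open>j\<close> and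
    the left factor \<open>c\<close> make room for the Clifford relations.\<close>
  define T where "T = (\<lambda>s i j c. bint n a (\<lambda>y. y i * L (c * pd j V (shift n x s y)) * bump n a y) (\<lambda>_. 0))"
  have cT: "continuous_on (cube a) (\<lambda>y. y i * L (c * pd j V (shift n x s y)) * bump n a y)"
    if "0 \<le> s" "s \<le> 1" "j < n" for i j c s
    by (intro continuous_on_mult continuous_on_coord continuous_on_bump
        continuous_on_shift_W[OF contpd] x that)
  have T_add: "T s i j (c + d) = T s i j c + T s i j d" if "0 \<le> s" "s \<le> 1" "j < n" for s i j c d
  proof -
    have "T s i j (c + d) = bint n a (\<lambda>y. y i * L (c * pd j V (shift n x s y)) * bump n a y
        + y i * L (d * pd j V (shift n x s y)) * bump n a y) (\<lambda>_. 0)"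
      unfolding T_def by (simp add: algebra_simps L.add)
    then show ?thesis
      unfolding T_def using bint_add[OF cT[OF that] cT[OF that] zero_cube] by simp
  qed
  have T_0: "T s i j 0 = 0" for s i j
    by (simp add: T_def L.zero bint_zero)
  \<comment> \<open>After integration by parts \<open>s * T s i j c\<close> contains
    \<open>y i * dbump n a j y\<close>, which is symmetric in \<open>i\<close> and \<open>j\<close>.
    Cancelling \<open>s\<close> excludes the radius 0.\<close>
  have T_sym: "T s i j c = T s j i c" if s: "0 < s" "s \<le> 1" and ij: "i < n" "j < n" for s i j c
  proof (cases "i = j")
    case False
    have eq: "s * T s i j c = - bint n a (\<lambda>y. y i * L (c * V (shift n x s y)) * dbump n a j y) (\<lambda>_. 0)"
      if "i \<noteq> j" "j < n" for i j
    proof -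
      have "T s i j c = bint n a (\<lambda>y. y i * pd j (\<lambda>z. L (c * V z)) (shift n x s y) * bump n a y) (\<lambda>_. 0)"
        unfolding T_def using s that
        by (intro bint_cong zero_cube) (simp add: pdc shift_in_U[OF x])
      then show ?thesis
        using shift_bump_parts[OF Vc x _ _ that(2), of s "\<lambda>y. y i" c] s that(1)
        by (simp add: continuous_on_coord)
    qed
    have "(\<lambda>y. y i * L (c * V (shift n x s y)) * dbump n a j y)
        = (\<lambda>y. y j * L (c * V (shift n x s y)) * dbump n a i y)"
      by (simp add: dbump_def fun_eq_iff)
    then have "s * T s i j c = s * T s j i c"
      using eq[of i j] eq[of j i] False ij by simp
    then show ?thesis using s by simp
  qed simp
  have T_sys: "(\<Sum>j<n. T s i j (c * eps j)) = 0" if s: "0 \<le> s" "s \<le> 1" for s i c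
  proof -
    have "(\<Sum>j<n. T s i j (c * eps j))
        = bint n a (\<lambda>y. \<Sum>j<n. y i * L (c * eps j * pd j V (shift n x s y)) * bump n a y) (\<lambda>_. 0)"
      unfolding T_def using s by (intro bint_sum[symmetric] cT zero_cube) auto
    also have "\<dots> = bint n a (\<lambda>_. 0) (\<lambda>_. 0)"
    proof (rule bint_cong[OF _ zero_cube])
      fix y assume "y \<in> cube a"
      then have "shift n x s y \<in> U" using s by (intro shift_in_U x)
      then have "L (c * (\<Sum>j<n. eps j * pd j V (shift n x s y))) = 0" by (simp add: sys L.zero)
      then have "(\<Sum>j<n. L (c * eps j * pd j V (shift n x s y))) = 0"
        by (simp add: sum_distrib_left L.sum mult.assoc)
      then show "(\<Sum>j<n. y i * L (c * eps j * pd j V (shift n x s y)) * bump n a y) = 0"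
        by (simp flip: sum_distrib_left sum_distrib_right)
    qed
    finally show ?thesis by (simp add: bint_zero)
  qed
  have T_radial: "(\<Sum>i<n. T s i i 1) = 0" if s: "0 < s" "s \<le> 1" for s
  proof -
    \<comment> \<open>The relation writes the diagonal \<open>2\<close> as
      \<open>eta i * eps j + eta j * eps i\<close>, with zero off the diagonal. By the symmetry of
      \<open>T\<close> this yields two double sums, each of which vanishes by the system for every
      fixed first index.\<close>
    have "(\<Sum>i<n. T s i i 2) = (\<Sum>i<n. \<Sum>j<n. if i = j then T s i j 2 else 0)"
      by simp
    also have "\<dots> = (\<Sum>i<n. \<Sum>j<n. T s i j (eta i * eps j) + T s j i (eta j * eps i))"
    proof (intro sum.cong refl)
      fix i j assume ij: "i \<in> {..<n}" "j \<in> {..<n}"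
      then have "T s i j (eta i * eps j) + T s j i (eta j * eps i)
          = T s i j (eta i * eps j + eta j * eps i)"
        using s T_sym[OF s, of i j] by (simp add: T_add)
      then show "(if i = j then T s i j 2 else 0) = T s i j (eta i * eps j) + T s j i (eta j * eps i)"
        using ij by (simp add: cl T_0)
    qed
    also have "\<dots> = (\<Sum>i<n. \<Sum>j<n. T s i j (eta i * eps j)) + (\<Sum>j<n. \<Sum>i<n. T s j i (eta j * eps i))"
      by (simp add: sum.distrib) (rule sum.swap)
    also have "\<dots> = 0"
      using s by (simp add: T_sys)
    finally have "(\<Sum>i<n. T s i i 2) = 0" .
    moreover have "T s i i 2 = 2 * T s i i 1" if "i < n" for i
      using T_add[of s i i 1 1] s that by simp
    ultimately show ?thesis by (simp flip: sum_distrib_left)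
  qed
  define h where "h = (\<lambda>s y. L (V (shift n x s y)) * bump n a y)"
  define h' where "h' = (\<lambda>s y. (\<Sum>i<n. y i * L (1 * pd i V (shift n x s y))) * bump n a y)"
  let ?T = "{0..1::real}"
  have cV: "continuous_on (?T \<times> cube a) (\<lambda>z. v (shift n x (fst z) (snd z)))" if "continuous_on U v"
    for v :: "(nat \<Rightarrow> real) \<Rightarrow> real"
    by (intro continuous_on_compose2[OF that] continuous_on_shift continuous_on_fst continuous_on_snd
        continuous_on_id continuous_on_const) (auto intro!: shift_in_U x)
  have ch: "continuous_on (?T \<times> cube a) (\<lambda>(s, y). h s y)"
    unfolding h_def split_beta using contV[of 1]
    by (intro continuous_on_mult cV continuous_on_compose2[OF continuous_on_bump[of UNIV]]
         continuous_on_snd continuous_on_id) auto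
  have ch': "continuous_on (?T \<times> cube a) (\<lambda>(s, y). h' s y)"
    unfolding h'_def split_beta
    by (intro continuous_on_mult continuous_on_sum cV[OF contpd]
        continuous_on_compose2[OF continuous_on_bump[of UNIV]]
        continuous_on_compose2[OF continuous_on_coord[of UNIV]]
         continuous_on_snd continuous_on_id) auto
  have deriv: "((\<lambda>s. bint n a (h s) (\<lambda>_. 0)) has_vector_derivative bint n a (h' s) (\<lambda>_. 0))
      (at s within ?T)" if s: "s \<in> ?T" for s
  proof (rule bint_has_vector_derivative[OF _ ch ch'])
    fix s y assume "s \<in> ?T" "y \<in> cube a"
    then have "((\<lambda>s. L (1 * V (shift n x s y))) has_vector_derivative
        (\<Sum>i<n. y i * pd i (\<lambda>z. L (1 * V z)) (shift n x s y))) (at s)"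
      by (intro has_vector_derivative_shift[OF Vc] x) auto
    moreover have "(\<Sum>i<n. y i * pd i (\<lambda>z. L (1 * V z)) (shift n x s y))
        = (\<Sum>i<n. y i * L (1 * pd i V (shift n x s y)))"
      using \<open>s \<in> ?T\<close> \<open>y \<in> cube a\<close> by (intro sum.cong refl) (subst pdc, auto intro!: shift_in_U x)
    ultimately have "((\<lambda>s. L (V (shift n x s y))) has_vector_derivative
        (\<Sum>i<n. y i * L (1 * pd i V (shift n x s y)))) (at s)"
      by simp
    from has_vector_derivative_mult_left[OF has_vector_derivative_at_within[OF this]]
    show "((\<lambda>s. h s y) has_vector_derivative h' s y) (at s within ?T)"
      unfolding h_def h'_def .
  qed (use s zero_cube in auto)
  have "bint n a (h' s) (\<lambda>_. 0) = 0" if s: "0 < s" "s < 1" for s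
  proof -
    have "bint n a (h' s) (\<lambda>_. 0) = (\<Sum>i<n. T s i i 1)"
      unfolding T_def h'_def sum_distrib_right using s by (intro bint_sum cT zero_cube) auto
    then show ?thesis using T_radial s by simp
  qed
  then have "((\<lambda>s. bint n a (h s) (\<lambda>_. 0)) has_field_derivative 0) (at s)" if "0 < s" "s < 1" for s
    using deriv[of s] that at_within_interior[of s ?T]
    by (simp add: has_real_derivative_iff_has_vector_derivative)
  \<comment> \<open>The derivative is known to vanish for \<open>0 < s < 1\<close> only. Continuity
    up to both ends compares radius 1, the average, with radius 0, where \<open>V\<close> is
    evaluated at \<open>x\<close> alone.\<close>
  moreover have "continuous_on ?T (\<lambda>s. bint n a (h s) (\<lambda>_. 0))"
    by (rule continuous_on_bint_param_0[OF ch]) (use a in simp)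
  ultimately have "bint n a (h 1) (\<lambda>_. 0) = bint n a (h 0) (\<lambda>_. 0)"
    by (intro DERIV_isconst_end) auto
  moreover have "shift n x 0 y = x" for y
    by (simp add: shift_def fun_eq_iff)
  then have "h 0 = (\<lambda>y. L (V x) * bump n a y)"
    by (simp add: h_def)
  ultimately show ?thesis
    by (simp add: conv_def h_def bint_cmult)
qed

text \<open>By the mean value property \<open>V\<close> is its own average up to the constant
  \<open>N\<close>, so integration by parts makes \<open>pd k V\<close> a constant times the average
  of \<open>V\<close> against \<open>dbump\<close>. Averages of a \<open>C^1\<close> function are
  \<open>C^1\<close>: one derivative has been gained. The \<open>eps j\<close> are constant, so
  \<open>pd k V\<close> solves the same system.\<close>

lemma (in smoothing) regularity_step:
  fixes V :: "(nat \<Rightarrow> real) \<Rightarrow> clifford" and eps eta :: "nat \<Rightarrow> clifford"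
  assumes V: "Ck n 1 U V"
    and sys: "\<And>z. z \<in> U \<Longrightarrow> (\<Sum>j<n. eps j * pd j V z) = 0"
    and cl: "\<And>i j. i < n \<Longrightarrow> j < n \<Longrightarrow> eta i * eps j + eta j * eps i = (if i = j then 2 else 0)"
    and S: "finite S" "\<And>x A. x \<in> U \<Longrightarrow> A \<notin> S \<Longrightarrow> coeff (V x) A = 0"
    and k: "k < n"
  shows "Ck n 1 W (pd k V)" and "x \<in> W \<Longrightarrow> (\<Sum>j<n. eps j * pd j (pd k V) x) = 0"
proof -
  define N where "N = bint n a (bump n a) (\<lambda>_. 0)"
  have N: "N > 0" unfolding N_def by (rule bint_bump_pos)
  have VL: "Ck n 1 U (\<lambda>z. L (V z))" if "bounded_linear L" for L :: "clifford \<Rightarrow> real"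
    by (rule Ck_linear[OF U that V])
  have Vpd: "pd j (\<lambda>z. L (V z)) z = L (pd j V z)"
    if "bounded_linear L" "j < n" "z \<in> U" for L :: "clifford \<Rightarrow> real" and j z
    using Ck_linear_pd[OF U that(1) _ that(2,3)] V unfolding One_nat_def by blast
  have rep: "L (pd k V z) = - inverse N * conv (\<lambda>z. L (V z)) (dbump n a k) z"
    if L: "bounded_linear L" and z: "z \<in> W" for L :: "clifford \<Rightarrow> real" and z
  proof -
    have "has_pd k (conv (\<lambda>z. L (V z)) (bump n a)) (conv (pd k (\<lambda>z. L (V z))) (bump n a) z) z"
      by (rule has_pd_conv[OF VL[OF L] continuous_on_bump z k])
    moreover have "has_pd k (conv (\<lambda>z. L (V z)) (bump n a)) (L (pd k V z) * N) z"
    proof (rule has_pd_cong[OF W z k])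
      show "L (V y) * N = conv (\<lambda>z. L (V z)) (bump n a) y" if "y \<in> W" for y
        unfolding N_def using mean_value[OF V L sys cl that] by simp
      have "has_pd k V (pd k V z) z" using V k z W_subset by auto
      then show "has_pd k (\<lambda>z. L (V z) * N) (L (pd k V z) * N) z"
        by (intro has_pd_linear[OF bounded_linear_mult_left] has_pd_linear[OF L])
    qed
    ultimately have "L (pd k V z) * N = conv (pd k (\<lambda>z. L (V z))) (bump n a) z"
      using has_pd_unique by metis
    also have "\<dots> = - conv (\<lambda>z. L (V z)) (dbump n a k) z"
      using shift_bump_parts[OF VL[OF L] z _ _ k, of 1 "\<lambda>_. 1"] by (simp add: conv_def)
    finally show ?thesis using N by (simp add: field_simps)
  qed
  have Ck1: "Ck n 1 W (\<lambda>z. L (pd k V z))" if L: "bounded_linear L" for L :: "clifford \<Rightarrow> real"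
    by (rule Ck_cong[OF W _ Ck_linear[OF W bounded_linear_mult_right Ck_conv[OF VL[OF L] continuous_on_dbump[of _ n a k]],
          of "- inverse N"]]) (simp add: rep[OF L])
  show C1: "Ck n 1 W (pd k V)"
  proof (rule Ck_coeffI[OF W S(1)])
    show "coeff (pd k V x) A = 0" if "x \<in> W" "A \<notin> S" for x A
      by (rule coeff_pd_eq_0[OF U, of 0]) (use V that S(2) k W_subset in auto)
    show "Ck n 1 W (\<lambda>x. coeff (pd k V x) A)" for A
      by (rule Ck1[OF bounded_linear_coeff])
  qed
  assume x: "x \<in> W"
  show "(\<Sum>j<n. eps j * pd j (pd k V) x) = 0"
  proof (rule clifford_eqI)
    fix A
    define L where "L = (\<lambda>j z. coeff (eps j * z) A)"
    have L: "bounded_linear (L j)" for j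
      unfolding L_def by (rule bounded_linear_compose[OF bounded_linear_coeff bounded_linear_mult_right])
    \<comment> \<open>The second derivative is again put on \<open>V\<close>, so that the sum over
      \<open>j\<close> becomes an average of the system itself.\<close>
    have eq: "L j (pd j (pd k V) x) = - inverse N * conv (\<lambda>z. L j (pd j V z)) (dbump n a k) x"
      if j: "j < n" for j
    proof -
      have "has_pd j (conv (\<lambda>z. L j (V z)) (dbump n a k)) (conv (pd j (\<lambda>z. L j (V z))) (dbump n a k) x) x"
        by (rule has_pd_conv[OF VL[OF L] continuous_on_dbump x j])
      then have "has_pd j (\<lambda>x. - inverse N * conv (\<lambda>z. L j (V z)) (dbump n a k) x)
          (- inverse N * conv (pd j (\<lambda>z. L j (V z))) (dbump n a k) x) x"
        by (rule has_pd_linear[OF bounded_linear_mult_right])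
      then have "has_pd j (\<lambda>z. L j (pd k V z)) (- inverse N * conv (pd j (\<lambda>z. L j (V z))) (dbump n a k) x) x"
        by (rule has_pd_cong[OF W x j, rotated]) (simp add: rep[OF L])
      moreover have "has_pd j (\<lambda>z. L j (pd k V z)) (L j (pd j (pd k V) x)) x"
        using C1 x j by (intro has_pd_linear[OF L]) simp
      moreover have "conv (pd j (\<lambda>z. L j (V z))) (dbump n a k) x = conv (\<lambda>z. L j (pd j V z)) (dbump n a k) x"
        unfolding conv_def
        by (intro bint_cong zero_cube) (simp add: Vpd[OF L j] shift_in_U[OF x])
      ultimately show ?thesis using has_pd_unique by metis
    qed
    have cont: "continuous_on (cube a) (\<lambda>y. L j (pd j V (shift n x 1 y)) * dbump n a k y)" if "j < n" for j
      using V that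
      by (intro continuous_on_mult continuous_on_dbump continuous_on_shift_W x
          bounded_linear.continuous_on[OF L]) auto
    have "coeff (\<Sum>j<n. eps j * pd j (pd k V) x) A = (\<Sum>j<n. L j (pd j (pd k V) x))"
      by (simp add: coeff_sum L_def)
    also have "\<dots> = - inverse N * (\<Sum>j<n. conv (\<lambda>z. L j (pd j V z)) (dbump n a k) x)"
      by (simp add: eq sum_distrib_left)
    also have "(\<Sum>j<n. conv (\<lambda>z. L j (pd j V z)) (dbump n a k) x)
        = bint n a (\<lambda>y. \<Sum>j<n. L j (pd j V (shift n x 1 y)) * dbump n a k y) (\<lambda>_. 0)"
      unfolding conv_def by (intro bint_sum[symmetric] cont zero_cube) auto
    also have "\<dots> = bint n a (\<lambda>_. 0) (\<lambda>_. 0)"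
    proof (rule bint_cong[OF _ zero_cube])
      fix y assume "y \<in> cube a"
      then have "coeff (\<Sum>j<n. eps j * pd j V (shift n x 1 y)) A = 0"
        by (simp add: sys shift_in_U[OF x])
      then show "(\<Sum>j<n. L j (pd j V (shift n x 1 y)) * dbump n a k y) = 0"
        by (simp add: L_def coeff_sum flip: sum_distrib_right)
    qed
    finally show "coeff (\<Sum>j<n. eps j * pd j (pd k V) x) A = coeff 0 A"
      by (simp add: bint_zero)
  qed
qed

text \<open>The averaging radius depends on the point, so each gain is local and glued by
  \<open>Ck_local\<close>. The induction ranges over all solutions supported in \<open>S\<close>,
  because the next round is applied to \<open>pd i V\<close>.\<close>

theorem regularity:
  fixes V :: "(nat \<Rightarrow> real) \<Rightarrow> clifford" and eps eta :: "nat \<Rightarrow> clifford"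
  assumes U: "nopen n U" and V: "Ck n 1 U V"
    and sys: "\<And>z. z \<in> U \<Longrightarrow> (\<Sum>j<n. eps j * pd j V z) = 0"
    and cl: "\<And>i j. i < n \<Longrightarrow> j < n \<Longrightarrow> eta i * eps j + eta j * eps i = (if i = j then 2 else 0)"
    and S: "finite S" "\<And>x A. x \<in> U \<Longrightarrow> A \<notin> S \<Longrightarrow> coeff (V x) A = 0"
  shows "smooth n U V"
proof -
  have nbhd: "\<exists>a. smoothing n U x a" if "x \<in> U" for x
  proof -
    obtain e where "e > 0" "box_nbhd n x e \<subseteq> U" using U \<open>x \<in> U\<close> by (rule nopenE)
    then have "smoothing n U x (e / 2)" using U that by (simp add: smoothing_def)
    then show ?thesis ..
  qed
  have "Ck n (Suc k) U V" for k
    using V sys S(2)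
  proof (induction k arbitrary: V)
    case (Suc k)
    have "Ck n (Suc k) U (pd i V)" if i: "i < n" for i
    proof (rule Suc.IH)
      have step: "Ck n 1 (box_nbhd n x a) (pd i V)" "(\<Sum>j<n. eps j * pd j (pd i V) x) = 0"
        if "smoothing n U x a" "x \<in> U" for x a
      proof -
        have "x \<in> box_nbhd n x a" using smoothing.a[OF that(1)] by (simp add: box_nbhd_def)
        with smoothing.regularity_step[OF that(1) Suc.prems(1,2) cl S(1) Suc.prems(3) i]
        show "Ck n 1 (box_nbhd n x a) (pd i V)" "(\<Sum>j<n. eps j * pd j (pd i V) x) = 0"
          by blast+
      qed
      show "Ck n 1 U (pd i V)"
      proof (rule Ck_local[OF U])
        fix x assume "x \<in> U"
        then obtain a where a: "smoothing n U x a" using nbhd by blast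
        have "Ck n 1 (U \<inter> box_nbhd n x a) (pd i V)"
          by (rule Ck_subset[OF step(1)[OF a \<open>x \<in> U\<close>]]) auto
        then show "\<exists>e>0. Ck n 1 (U \<inter> box_nbhd n x e) (pd i V)"
          using smoothing.a[OF a] by blast
      qed
      show "(\<Sum>j<n. eps j * pd j (pd i V) z) = 0" if "z \<in> U" for z
        using nbhd[OF that] step(2) that by blast
      show "coeff (pd i V x) A = 0" if "x \<in> U" "A \<notin> S" for x A
        by (rule coeff_pd_eq_0[OF U, of 0]) (use that Suc.prems i in auto)
    qed
    then show ?case using Suc.prems(1) by simp
  qed simp
  then show ?thesis unfolding smooth_def using Ck_lower by blast
qed

section \<open>Regularity for the Vekua-type system\<close>

lemma clifford_algebra_coeff_eq_0:
  assumes "a \<in> clifford_algebra N" "A \<notin> Pow {..<N}"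
  shows "coeff a A = 0"
  using assms(1) unfolding clifford_algebra_def
proof (induction rule: span_induct)
  case base
  have "subspace {a. coeff a A = 0}" by (simp add: subspace_def)
  then show ?case by (simp add: subspace_def)
next
  case (step a)
  then show ?case using assms(2) by (auto split: if_splits)
qed

text \<open>Left multiplication by the new generator turns blades over \<open>{..<N}\<close> into
  blades containing \<open>N\<close>. Hence \<open>F1\<close> can be read off from
  \<open>F1 + gen N * F2\<close>.\<close>

lemma coeff_gen_mult_eq_0:
  assumes "\<And>A. A \<notin> Pow {..<N} \<Longrightarrow> coeff b A = 0" "A \<subseteq> {..<N}"
  shows "coeff (gen N * b) A = 0"
proof -
  have "coeff (gen N * b) A = (\<Sum>A'\<in>{{N}}. blade_sign A' (sym_diff A' A) * coeff (gen N) A' * coeff b (sym_diff A' A))"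
    by (rule coeff_mult) (auto simp: gen_def supp_def split: if_splits)
  moreover have "N \<in> sym_diff {N} A" using assms(2) by auto
  then have "coeff b (sym_diff {N} A) = 0" by (intro assms(1)) auto
  ultimately show ?thesis by simp
qed

text \<open>This supplies the common finite set of blades that \<open>regularity\<close> asks for
  after adjoining \<open>gen N\<close>.\<close>

lemma coeff_gen_mult_outside:
  assumes "\<And>A. A \<notin> Pow {..<N} \<Longrightarrow> coeff b A = 0" "A \<notin> Pow {..<Suc N}"
  shows "coeff (gen N * b) A = 0"
proof -
  have "coeff (gen N * b) A = (\<Sum>A'\<in>{{N}}. blade_sign A' (sym_diff A' A) * coeff (gen N) A' * coeff b (sym_diff A' A))"
    by (rule coeff_mult) (auto simp: gen_def supp_def split: if_splits)
  moreover from assms(2) obtain i where "i \<in> A" "i \<ge> Suc N" by force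
  then have "i \<in> sym_diff {N} A" "i \<notin> {..<N}" by auto
  then have "sym_diff {N} A \<notin> Pow {..<N}" by blast
  then have "coeff b (sym_diff {N} A) = 0" by (rule assms(1))
  ultimately show ?thesis by simp
qed

lemma gen_square: "gen i * gen i = -1"
  by (simp add: gen_def blade_mult blade_sign_def one_clifford_def)

lemma gen_swap: "i \<noteq> j \<Longrightarrow> gen i * gen j = - (gen j * gen i)"
  using gen_anticommute[of i j] by (simp add: eq_neg_iff_add_eq_0)

section \<open>Closure properties of smooth functions\<close>

lemma smooth_cong:
  "nopen n U \<Longrightarrow> (\<And>x. x \<in> U \<Longrightarrow> f x = g x) \<Longrightarrow> smooth n U f \<Longrightarrow> smooth n U g"
  unfolding smooth_def by (blast intro: Ck_cong)

lemma smooth_subset: "smooth m U f \<Longrightarrow> W \<subseteq> U \<Longrightarrow> n \<le> m \<Longrightarrow> smooth n W f"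
  unfolding smooth_def by (blast intro: Ck_subset)

lemma smooth_linear: "nopen n U \<Longrightarrow> bounded_linear L \<Longrightarrow> smooth n U f \<Longrightarrow> smooth n U (\<lambda>x. L (f x))"
  unfolding smooth_def by (blast intro: Ck_linear)

lemma smooth_mult_left:
  fixes c :: "'b::real_normed_algebra"
  shows "nopen n U \<Longrightarrow> smooth n U f \<Longrightarrow> smooth n U (\<lambda>x. c * f x)"
  by (rule smooth_linear[OF _ bounded_linear_mult_right])

lemma smooth_scaleR_const: "nopen n U \<Longrightarrow> smooth n U f \<Longrightarrow> smooth n U (\<lambda>x. c *\<^sub>R f x)"
  by (rule smooth_linear[OF _ bounded_linear_scaleR_right])

lemma smooth_add: "nopen n U \<Longrightarrow> smooth n U f \<Longrightarrow> smooth n U g \<Longrightarrow> smooth n U (\<lambda>x. f x + g x)"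
  unfolding smooth_def by (blast intro: Ck_add)

lemma smooth_sum:
  "nopen n U \<Longrightarrow> (\<And>j. j \<in> S \<Longrightarrow> smooth n U (f j)) \<Longrightarrow> smooth n U (\<lambda>x. \<Sum>j\<in>S. f j x)"
  unfolding smooth_def by (blast intro: Ck_sum)

lemma smooth_scaleR:
  "nopen n U \<Longrightarrow> smooth n U f \<Longrightarrow> smooth n U g \<Longrightarrow> smooth n U (\<lambda>x. f x *\<^sub>R g x)"
  unfolding smooth_def by (blast intro: Ck_bilinear[OF _ bounded_bilinear_scaleR])

lemma smooth_mult:
  fixes f g :: "(nat \<Rightarrow> real) \<Rightarrow> 'b::real_normed_algebra"
  shows "nopen n U \<Longrightarrow> smooth n U f \<Longrightarrow> smooth n U g \<Longrightarrow> smooth n U (\<lambda>x. f x * g x)"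
  unfolding smooth_def by (blast intro: Ck_bilinear[OF _ bounded_bilinear_mult])

lemma smooth_coord: "nopen n U \<Longrightarrow> smooth n U (\<lambda>x. x j)"
  unfolding smooth_def by (blast intro: Ck_coord)

lemma smooth_const: "nopen n U \<Longrightarrow> smooth n U (\<lambda>_. c)"
  unfolding smooth_def by (blast intro: Ck_const)

lemma smooth_coeffI:
  assumes "nopen n U" "finite S" "\<And>x A. x \<in> U \<Longrightarrow> A \<notin> S \<Longrightarrow> coeff (f x) A = 0"
    and "\<And>A. A \<in> S \<Longrightarrow> smooth n U (\<lambda>x. coeff (f x) A)"
  shows "smooth n U f"
  unfolding smooth_def
proof
  fix k show "Ck n k U f"
    by (rule Ck_coeffI[OF assms(1-3)]) (auto intro: smooth_Ck[OF assms(4)])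
qed

lemma has_pd_upd:
  assumes "i \<noteq> m" "has_pd i G d (x(m := c))"
  shows "has_pd i (\<lambda>x. G (x(m := c))) d x"
  using assms by (simp add: has_pd_def fun_upd_twist del: fun_upd_apply) (simp add: fun_upd_twist)

text \<open>With a further anticommuting generator \<open>\<epsilon>\<close> the system reads \<open>(D + \<epsilon> \<partial>\<^sub>r) G = \<lambda> G\<close> for
  \<open>G = F\<^sub>1 + \<epsilon> F\<^sub>2\<close>; the term with \<open>\<lambda>\<close> is absorbed by the additional variable of \<open>e\<^bsup>\<lambda> t\<^esup> G\<close>.\<close>

lemma vekua_smooth:
  fixes F1 F2 :: "(nat \<Rightarrow> real) \<Rightarrow> clifford"
  assumes D: "nopen (Suc p) D" and C1: "Ck (Suc p) 1 D F1" "Ck (Suc p) 1 D F2" and pN: "p \<le> N"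
    and v1: "\<And>x A. x \<in> D \<Longrightarrow> A \<notin> Pow {..<N} \<Longrightarrow> coeff (F1 x) A = 0"
    and v2: "\<And>x A. x \<in> D \<Longrightarrow> A \<notin> Pow {..<N} \<Longrightarrow> coeff (F2 x) A = 0"
    and s1: "\<And>x. x \<in> D \<Longrightarrow> (\<Sum>i<p. gen i * pd i F1 x) - pd p F2 x = lam *\<^sub>R F1 x"
    and s2: "\<And>x. x \<in> D \<Longrightarrow> - (\<Sum>i<p. gen i * pd i F2 x) + pd p F1 x = lam *\<^sub>R F2 x"
  shows "smooth (Suc p) D F1" "smooth (Suc p) D F2"
proof -
  let ?m = "Suc p"
  define G where "G = (\<lambda>x. F1 x + gen N * F2 x)"
  have G1: "Ck ?m 1 D G" unfolding G_def
    by (intro Ck_add[OF D] Ck_linear[OF D bounded_linear_mult_right] C1)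
  have hG: "has_pd i G (pd i F1 x + gen N * pd i F2 x) x" if "i < ?m" "x \<in> D" for i x
    unfolding G_def using that C1
    by (intro has_pd_add has_pd_linear[OF bounded_linear_mult_right]) auto
  have pG: "pd i G x = pd i F1 x + gen N * pd i F2 x" if "i < ?m" "x \<in> D" for i x
    by (rule has_pd_unique[OF hG[OF that]])
  have sysG: "(\<Sum>i<p. gen i * pd i G x) + gen N * pd p G x = lam *\<^sub>R G x" if x: "x \<in> D" for x
  proof -
    have "gen i * pd i G x = gen i * pd i F1 x - gen N * (gen i * pd i F2 x)" if "i < p" for i
    proof -
      have "gen i * (gen N * pd i F2 x) = - (gen N * (gen i * pd i F2 x))"
        using gen_swap[of i N] that pN by (simp flip: mult.assoc)
      then show ?thesis using pG[of i x] x that by (simp add: distrib_left)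
    qed
    then have "(\<Sum>i<p. gen i * pd i G x)
        = (\<Sum>i<p. gen i * pd i F1 x) - gen N * (\<Sum>i<p. gen i * pd i F2 x)"
      by (simp add: sum_subtractf sum_distrib_left)
    moreover have "gen N * pd p G x = gen N * pd p F1 x - pd p F2 x"
      using pG[of p x] x by (simp add: distrib_left gen_square flip: mult.assoc)
    ultimately have "(\<Sum>i<p. gen i * pd i G x) + gen N * pd p G x
        = ((\<Sum>i<p. gen i * pd i F1 x) - pd p F2 x)
          + gen N * (- (\<Sum>i<p. gen i * pd i F2 x) + pd p F1 x)"
      by (simp add: algebra_simps)
    then show ?thesis
      unfolding s1[OF x] s2[OF x] G_def by (simp add: scaleR_add_right)
  qed
  \<comment> \<open>The cylinder over \<open>D\<close>: the new coordinate has index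
    \<open>?m\<close>, one past the index \<open>p\<close> of \<open>r\<close>.\<close>
  define U where "U = {x. x(?m := 0) \<in> D}"
  have U: "nopen (Suc ?m) U"
    unfolding nopen_def
  proof (intro ballI conjI allI impI)
    fix x i assume x: "x \<in> U" and i: "Suc ?m \<le> i"
    then show "x i = 0" using nopenD_zero[OF D, of "x(?m := 0)" i] by (simp add: U_def)
  next
    fix x assume "x \<in> U"
    then obtain e where e: "e > 0" "box_nbhd ?m (x(?m := 0)) e \<subseteq> D"
      using D by (auto simp: U_def elim: nopenE)
    have "y(?m := 0) \<in> box_nbhd ?m (x(?m := 0)) e" if "y \<in> box_nbhd (Suc ?m) x e" for y
      using that by (auto simp: box_nbhd_def)
    then show "\<exists>e>0. box_nbhd (Suc ?m) x e \<subseteq> U" using e by (auto simp: U_def)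
  qed
  define E where "E = (\<lambda>x::nat \<Rightarrow> real. exp (lam * x ?m))"
  define V where "V = (\<lambda>x. E x *\<^sub>R G (x(?m := 0)))"
  define V' where "V' = (\<lambda>i x. if i = ?m then lam *\<^sub>R V x else E x *\<^sub>R pd i G (x(?m := 0)))"
  have hE: "has_pd i E (if i = ?m then lam * E x else 0) x" for i x
    unfolding has_pd_def E_def by (auto intro!: derivative_eq_intros simp: has_real_derivative_iff_has_vector_derivative[symmetric])
  have hV: "has_pd i V (V' i x) x" if i: "i < Suc ?m" and x: "x \<in> U" for i x
  proof -
    have "has_pd i (\<lambda>x. G (x(?m := 0))) (if i = ?m then 0 else pd i G (x(?m := 0))) x"
    proof (cases "i = ?m")
      case True
      then show ?thesis by (simp add: has_pd_def)
    next
      case False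
      with i x G1 show ?thesis by (auto simp: U_def intro!: has_pd_upd)
    qed
    from has_pd_bilinear[OF bounded_bilinear_scaleR hE this]
    show ?thesis by (auto simp: V_def V'_def split: if_splits)
  qed
  have pV: "pd i V x = V' i x" if "i < Suc ?m" "x \<in> U" for i x
    by (rule has_pd_unique[OF hV[OF that]])
  have cE: "continuous_on U E"
    unfolding E_def by (intro continuous_intros continuous_on_coord)
  have cU: "continuous_on U (\<lambda>x. g (x(?m := 0)))" if "continuous_on D g" for g :: "(nat \<Rightarrow> real) \<Rightarrow> clifford"
    by (rule continuous_on_compose2[OF that])
       (auto simp: U_def simp del: fun_upd_apply intro!: continuous_on_fun_upd continuous_on_const continuous_on_id)
  have cV: "continuous_on U V"
    unfolding V_def by (intro continuous_on_scaleR cE cU Ck_imp_continuous_on[OF G1])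
  have V1: "Ck (Suc ?m) 1 U V"
    unfolding One_nat_def
  proof (rule Ck_SucI[OF U cV])
    show "has_pd i V (V' i x) x" if "i < Suc ?m" "x \<in> U" for i x
      by (rule hV[OF that])
    show "Ck (Suc ?m) 0 U (V' i)" if "i < Suc ?m" for i
      using that G1 by (cases "i = ?m") (auto simp: V'_def intro!: continuous_on_scaleR cE cU cV continuous_on_const)
  qed
  have sV: "smooth (Suc ?m) U V"
  proof (rule regularity[OF U V1])
    \<comment> \<open>The entry \<open>- 1\<close> belongs to the extra variable, where
      \<open>pd ?m V\<close> is \<open>lam *\<^sub>R V\<close>. The \<open>?eta\<close> are the
      Clifford conjugates of the \<open>?eps\<close>, which gives the required relation.\<close>
    let ?eps = "\<lambda>j. if j < p then gen j else if j = p then gen N else - 1"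
    let ?eta = "\<lambda>j. if j < p then - gen j else if j = p then - gen N else - 1"
    show "(\<Sum>j<Suc ?m. ?eps j * pd j V x) = 0" if x: "x \<in> U" for x
    proof -
      let ?x = "x(?m := 0)"
      have "(\<Sum>j<Suc ?m. ?eps j * pd j V x) = (\<Sum>j<Suc ?m. ?eps j * V' j x)"
        by (intro sum.cong refl) (simp only: pV x lessThan_iff)
      also have "\<dots> = (\<Sum>j<p. gen j * (E x *\<^sub>R pd j G ?x)) + gen N * (E x *\<^sub>R pd p G ?x) - lam *\<^sub>R V x"
        by (simp add: V'_def)
      also have "\<dots> = E x *\<^sub>R ((\<Sum>j<p. gen j * pd j G ?x) + gen N * pd p G ?x) - lam *\<^sub>R V x"
        by (simp add: scaleR_add_right scaleR_sum_right)
      also have "\<dots> = 0"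
        using x by (subst sysG) (simp_all add: U_def V_def)
      finally show ?thesis .
    qed
    show "?eta i * ?eps j + ?eta j * ?eps i = (if i = j then 2 else 0)"
      if "i < Suc ?m" "j < Suc ?m" for i j
      using gen_swap[of i j] gen_swap[of i N] gen_swap[of j N] that pN
      by (auto simp: gen_square)
    show "finite (Pow {..<Suc N})" by simp
    show "coeff (V x) A = 0" if "x \<in> U" "A \<notin> Pow {..<Suc N}" for x A
    proof -
      have "A \<notin> Pow {..<N}" using that(2) by force
      then show ?thesis
        using that coeff_gen_mult_outside[OF v2 that(2)] by (simp add: V_def G_def U_def v1)
    qed
  qed
  \<comment> \<open>\<open>D\<close> is the slice of the cylinder at which the extra coordinate is 0
    and the exponential is 1, so smoothness of \<open>V\<close> restricts to
    \<open>G\<close>.\<close>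
  have idem: "x(?m := 0) = x" if "x \<in> D" for x
    using nopenD_zero[OF D that, of ?m] by (simp add: fun_upd_idem)
  have VG: "V x = G x" if "x \<in> D" for x
    using idem[OF that] by (simp add: V_def E_def nopenD_zero[OF D that])
  have sub: "D \<subseteq> U"
    using idem by (auto simp: U_def)
  have "smooth ?m D V"
    by (rule smooth_subset[OF sV sub]) simp
  from smooth_cong[OF D VG this] have sG: "smooth ?m D G" .
  have "smooth ?m D (\<lambda>x. coeff (F1 x) A)" if "A \<in> Pow {..<N}" for A
  proof (rule smooth_cong[OF D])
    show "smooth ?m D (\<lambda>x. coeff (G x) A)"
      by (rule smooth_linear[OF D bounded_linear_coeff sG])
    show "coeff (G x) A = coeff (F1 x) A" if "x \<in> D" for x
      using coeff_gen_mult_eq_0[OF v2[OF that], where A = A] \<open>A \<in> Pow {..<N}\<close> by (simp add: G_def)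
  qed
  then show sF1: "smooth ?m D F1"
    by (intro smooth_coeffI[where S = "Pow {..<N}"] D v1) auto
  \<comment> \<open>Since \<open>gen N\<close> squares to \<open>-1\<close>, multiplying the
    remainder \<open>G - F1\<close> by \<open>- gen N\<close> isolates \<open>F2\<close>.\<close>
  have "smooth ?m D (\<lambda>x. (- gen N) * (G x + (- 1) *\<^sub>R F1 x))"
    by (intro smooth_mult_left smooth_add smooth_scaleR_const D sF1 sG)
  then show "smooth ?m D F2"
    by (rule smooth_cong[OF D, rotated]) (simp add: G_def gen_square flip: mult.assoc)
qed

section \<open>Division by a coordinate\<close>

lemma has_pd_line:
  assumes "has_pd i f d (x(i := s))"
  shows "((\<lambda>t. f (x(i := t))) has_vector_derivative d) (at s within T)"
  using assms by (simp add: has_pd_def has_vector_derivative_at_within)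

text \<open>Both iterated derivatives arise from \<open>f(s,t) - f(s,t\<^sub>0) = \<integral> \<partial>\<^sub>j f(s,\<tau>) d\<tau>\<close> by differentiating
  under the integral sign.\<close>

lemma pd_swap_real:
  fixes f :: "(nat \<Rightarrow> real) \<Rightarrow> real"
  assumes U: "nopen n U" and f: "Ck n (Suc (Suc 0)) U f" and ij: "i < n" "j < n" and x: "x \<in> U"
  shows "pd i (pd j f) x = pd j (pd i f) x"
proof (cases "i = j")
  case False
  obtain e where e: "e > 0" "box_nbhd n x e \<subseteq> U" using U x by (rule nopenE)
  \<comment> \<open>Half the radius keeps the closed intervals used for integration inside the open
    box.\<close>
  define d where "d = e / 2"
  have d: "0 < d" "d < e" using e by (auto simp: d_def)
  let ?I = "{x i - d..x i + d}" and ?J = "{x j - d..x j + d}" and ?t0 = "x j - d"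
  define pt where "pt = (\<lambda>s t. x(i := s, j := t))"
  have ptU: "pt s t \<in> U" if "s \<in> ?I" "t \<in> ?J" for s t
    using that d ij x by (intro subsetD[OF e(2)]) (auto simp: box_nbhd_def pt_def)
  have pti: "pt s t = (pt s' t)(i := s)" and ptj: "pt s t = (pt s t')(j := t)" for s t s' t'
    using False by (auto simp: pt_def fun_eq_iff)
  have di: "((\<lambda>s. g (pt s t)) has_vector_derivative pd i g (pt s t)) (at s within T)"
    if "Ck n (Suc 0) U g" "s \<in> ?I" "t \<in> ?J" for g :: "(nat \<Rightarrow> real) \<Rightarrow> real" and s t T
  proof -
    have "has_pd i g (pd i g (pt s t)) (pt s t)" using that ij ptU by simp
    then have "((\<lambda>r. g ((pt s t)(i := r))) has_vector_derivative pd i g (pt s t)) (at s within T)"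
      by (intro has_pd_line) (simp flip: pti)
    then show ?thesis by (simp flip: pti)
  qed
  have dj: "((\<lambda>t. g (pt s t)) has_vector_derivative pd j g (pt s t)) (at t within T)"
    if "Ck n (Suc 0) U g" "s \<in> ?I" "t \<in> ?J" for g :: "(nat \<Rightarrow> real) \<Rightarrow> real" and s t T
  proof -
    have "has_pd j g (pd j g (pt s t)) (pt s t)" using that ij ptU by simp
    then have "((\<lambda>r. g ((pt s t)(j := r))) has_vector_derivative pd j g (pt s t)) (at t within T)"
      by (intro has_pd_line) (simp flip: ptj)
    then show ?thesis by (simp flip: ptj)
  qed
  have cpt: "continuous_on (?I \<times> ?J) (\<lambda>z. g (pt (fst z) (snd z)))" if "continuous_on U g"
    for g :: "(nat \<Rightarrow> real) \<Rightarrow> real"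
    by (rule continuous_on_compose2[OF that])
       (auto simp: pt_def[symmetric] intro!: ptU, unfold pt_def, intro continuous_on_fun_upd
          continuous_on_const continuous_on_fst continuous_on_snd continuous_on_id)
  have cpts: "continuous_on ?J (\<lambda>t. g (pt s t))" if "continuous_on U g" "s \<in> ?I"
    for g :: "(nat \<Rightarrow> real) \<Rightarrow> real" and s
    using continuous_on_compose2[OF cpt[OF that(1)], of ?J "\<lambda>t. (s, t)"] that(2)
    by (simp add: continuous_on_Pair image_subset_iff)
  have f1: "Ck n (Suc 0) U f" by (rule Ck_lower[OF f])
  have fj: "Ck n (Suc 0) U (pd j f)" and fi: "Ck n (Suc 0) U (pd i f)" using f ij by auto
  have xi: "x i \<in> ?I" and xj: "x j \<in> ?J" using d by auto
  have int: "pd i f (pt (x i) t) - pd i f (pt (x i) ?t0)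
      = integral {?t0..t} (\<lambda>\<tau>. pd i (pd j f) (pt (x i) \<tau>))" if t: "t \<in> ?J" for t
  proof -
    have sub: "{?t0..t} \<subseteq> ?J" using t by auto
    have eq: "integral {?t0..t} (\<lambda>\<tau>. pd j f (pt s \<tau>)) = f (pt s t) - f (pt s ?t0)" if "s \<in> ?I" for s
      by (intro integral_unique fundamental_theorem_of_calculus dj f1) (use t that in auto)
    have "((\<lambda>s. integral (cbox ?t0 t) (\<lambda>\<tau>. pd j f (pt s \<tau>))) has_vector_derivative
        integral (cbox ?t0 t) (\<lambda>\<tau>. pd i (pd j f) (pt (x i) \<tau>))) (at (x i) within ?I)"
    proof (rule leibniz_rule_vector_derivative)
      show "((\<lambda>s. pd j f (pt s \<tau>)) has_vector_derivative pd i (pd j f) (pt s \<tau>)) (at s within ?I)"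
        if "s \<in> ?I" "\<tau> \<in> cbox ?t0 t" for s \<tau>
        using that sub by (intro di fj) auto
      show "(\<lambda>\<tau>. pd j f (pt s \<tau>)) integrable_on cbox ?t0 t" if "s \<in> ?I" for s
      proof -
        have "continuous_on U (pd j f)" using fj by simp
        from cpts[OF this that] show ?thesis
          using sub by (auto intro!: integrable_continuous_real elim: continuous_on_subset)
      qed
      have "continuous_on U (pd i (pd j f))" using fj ij by simp
      from cpt[OF this] show "continuous_on (?I \<times> cbox ?t0 t) (\<lambda>(s, \<tau>). pd i (pd j f) (pt s \<tau>))"
        unfolding split_beta by (rule continuous_on_subset) (use sub in auto)
    qed (use xi in auto)
    then have "((\<lambda>s. f (pt s t) - f (pt s ?t0)) has_vector_derivative
        integral {?t0..t} (\<lambda>\<tau>. pd i (pd j f) (pt (x i) \<tau>))) (at (x i) within ?I)"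
      unfolding cbox_interval by (rule has_vector_derivative_transform[rotated 2]) (use eq xi in auto)
    moreover have "((\<lambda>s. f (pt s t) - f (pt s ?t0)) has_vector_derivative
        pd i f (pt (x i) t) - pd i f (pt (x i) ?t0)) (at (x i) within ?I)"
      using t d by (intro has_vector_derivative_diff di f1 xi) auto
    moreover have "at (x i) within ?I \<noteq> bot"
      using d by (simp add: trivial_limit_within islimpt_Icc)
    ultimately show ?thesis by (metis vector_derivative_unique_within)
  qed
  have "continuous_on U (pd i (pd j f))" using fj ij by simp
  from integral_has_vector_derivative[OF cpts[OF this xi] xj]
  have "((\<lambda>t. integral {?t0..t} (\<lambda>\<tau>. pd i (pd j f) (pt (x i) \<tau>))) has_vector_derivative
      pd i (pd j f) (pt (x i) (x j))) (at (x j) within ?J)" .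
  then have "((\<lambda>t. pd i f (pt (x i) t) - pd i f (pt (x i) ?t0)) has_vector_derivative
      pd i (pd j f) (pt (x i) (x j))) (at (x j) within ?J)"
    by (rule has_vector_derivative_transform[rotated 2]) (use int xj in auto)
  moreover have "((\<lambda>t. pd i f (pt (x i) t) - pd i f (pt (x i) ?t0)) has_vector_derivative
      pd j (pd i f) (pt (x i) (x j)) - 0) (at (x j) within ?J)"
    by (intro has_vector_derivative_diff dj fi xi xj has_vector_derivative_const)
  moreover have "at (x j) within ?J \<noteq> bot"
    using d by (simp add: trivial_limit_within islimpt_Icc)
  moreover have "pt (x i) (x j) = x" by (simp add: pt_def)
  ultimately show ?thesis by (metis vector_derivative_unique_within diff_zero)
qed simp

lemma pd_swap:
  fixes f :: "(nat \<Rightarrow> real) \<Rightarrow> clifford"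
  assumes U: "nopen n U" and f: "smooth n U f" and ij: "i < n" "j < n" and x: "x \<in> U"
  shows "pd i (pd j f) x = pd j (pd i f) x"
proof (rule clifford_eqI)
  fix A
  let ?c = "\<lambda>x. coeff (f x) A"
  have f2: "Ck n (Suc (Suc 0)) U f" by (rule smooth_Ck[OF f])
  have c: "pd i (pd j ?c) x = coeff (pd i (pd j f) x) A" if ij: "i < n" "j < n" for i j
  proof -
    have "pd j ?c y = coeff (pd j f y) A" if "y \<in> U" for y
      by (rule Ck_linear_pd[OF U bounded_linear_coeff f2 ij(2) that])
    then have "pd i (pd j ?c) x = pd i (\<lambda>y. coeff (pd j f y) A) x"
      by (intro pd_cong[OF U x ij(1)])
    also have "\<dots> = coeff (pd i (pd j f) x) A"
      using f2 ij by (intro Ck_linear_pd[OF U bounded_linear_coeff _ ij(1) x, of 0]) auto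
    finally show ?thesis .
  qed
  have "Ck n (Suc (Suc 0)) U ?c" by (rule Ck_linear[OF U bounded_linear_coeff f2])
  from pd_swap_real[OF U this ij x]
  show "coeff (pd i (pd j f) x) A = coeff (pd j (pd i f) x) A"
    using c[of i j] c[of j i] ij by simp
qed

lemma Ck_inverse_coord:
  assumes "nopen n U" "\<And>x. x \<in> U \<Longrightarrow> x p \<noteq> 0"
  shows "Ck n k U (\<lambda>x. inverse (x p))"
proof (induction k)
  case 0
  show ?case by (simp add: assms(2) continuous_on_inverse continuous_on_coord)
next
  case (Suc k)
  let ?d = "\<lambda>i x. - (if i = p then 1 else 0) * (inverse (x p) * inverse (x p))"
  show ?case
  proof (rule Ck_SucI[OF assms(1), where f' = ?d])
    show "continuous_on U (\<lambda>x. inverse (x p))"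
      by (simp add: assms(2) continuous_on_inverse continuous_on_coord)
    show "Ck n k U (?d i)" for i
      by (intro Ck_linear[OF assms(1) bounded_linear_mult_right]
          Ck_bilinear[OF assms(1) bounded_bilinear_mult] Suc)
    show "has_pd i (\<lambda>x. inverse (x p)) (?d i x) x" if "x \<in> U" for i x
    proof (cases "i = p")
      case True
      have "((\<lambda>t. inverse t) has_field_derivative - (inverse (x p) * inverse (x p))) (at (x p))"
        using assms(2)[OF that] by (auto intro!: derivative_eq_intros simp: power2_eq_square)
      with True show ?thesis
        by (simp add: has_pd_def has_real_derivative_iff_has_vector_derivative)
    qed (simp add: has_pd_def)
  qed
qed

text \<open>Differentiation in direction \<open>p\<close> brings out a factor \<open>s\<close> from
  the inner map. The arbitrary continuous weight \<open>w\<close> absorbs it, so the induction stays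
  within one family of averages.\<close>

lemma Ck_avg:
  fixes g :: "(nat \<Rightarrow> real) \<Rightarrow> real"
  assumes U: "nopen n U" and star: "\<And>y s. y \<in> U \<Longrightarrow> s \<in> {0..1} \<Longrightarrow> y(p := s * y p) \<in> U" and p: "p < n"
  shows "Ck n k U g \<Longrightarrow> continuous_on {0..1} w \<Longrightarrow>
    Ck n k U (\<lambda>y. integral {0..1} (\<lambda>s. w s * g (y(p := s * y p))))"
proof (induction k arbitrary: g w)
  case 0
  have "continuous_on (U \<times> cbox 0 1) (\<lambda>z. w (snd z) * g ((fst z)(p := snd z * (fst z) p)))"
    by (intro continuous_on_mult continuous_on_compose2[OF 0(2)]
        continuous_on_compose2[OF 0(1)[unfolded Ck.simps]] continuous_on_fun_upd continuous_on_fst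
        continuous_on_snd continuous_on_id continuous_on_compose2[OF continuous_on_coord[of UNIV p]])
       (auto intro!: star simp del: fun_upd_apply)
  then have "continuous_on (U \<times> cbox 0 1) (\<lambda>(y, s). w s * g (y(p := s * y p)))"
    by (simp add: split_beta)
  from integral_continuous_on_param[OF this] show ?case by (simp del: fun_upd_apply)
next
  case (Suc k)
  let ?F = "\<lambda>(w::real \<Rightarrow> real) (g::(nat \<Rightarrow> real) \<Rightarrow> real) y. integral {0..1} (\<lambda>s. w s * g (y(p := s * y p)))"
  define w' where "w' = (\<lambda>i s. if i = p then w s * s else w s)"
  have w': "continuous_on {0..1} (w' i)" for i
    using Suc.prems(2) by (cases "i = p") (auto simp: w'_def[abs_def] intro!: continuous_intros)
  have cont: "continuous_on (U \<times> cbox 0 1) (\<lambda>z. w (snd z) * g ((fst z)(p := snd z * (fst z) p)))"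
    if "continuous_on {0..1} w" "continuous_on U g" for w and g :: "(nat \<Rightarrow> real) \<Rightarrow> real"
    by (intro continuous_on_mult continuous_on_compose2[OF that(1)]
        continuous_on_compose2[OF that(2)] continuous_on_fun_upd continuous_on_fst
        continuous_on_snd continuous_on_id continuous_on_compose2[OF continuous_on_coord[of UNIV p]])
       (auto intro!: star simp del: fun_upd_apply)
  have "Ck n (Suc k) U (?F w g)"
  proof (rule Ck_SucI[OF U, where f' = "\<lambda>i. ?F (w' i) (pd i g)"])
    show "continuous_on U (?F w g)"
      using integral_continuous_on_param[of U 0 1 "\<lambda>y s. w s * g (y(p := s * y p))"]
        cont[of w g] Suc.prems by (simp add: split_beta)
    show "Ck n k U (?F (w' i) (pd i g))" if "i < n" for i
      using Suc.prems that by (intro Suc.IH w') simp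
    fix i x assume i: "i < n" and x: "x \<in> U"
    obtain e where e: "e > 0" "box_nbhd n x e \<subseteq> U" using U x by (rule nopenE)
    let ?T = "{x i - e<..<x i + e}"
    have xt: "x(i := t) \<in> U" if "t \<in> ?T" for t
      using that e i by (intro subsetD[OF e(2)]) (auto simp: box_nbhd_def)
    let ?z = "\<lambda>t s. (x(i := t))(p := s * (x(i := t)) p)"
    have z: "?z t s \<in> U" if "t \<in> ?T" "s \<in> {0..1}" for t s
      by (rule star[OF xt[OF that(1)] that(2)])
    have contT: "continuous_on (?T \<times> cbox 0 1) (\<lambda>(t, s). w s * g (?z t s))"
      if "continuous_on {0..1} w" "continuous_on U g" for w and g :: "(nat \<Rightarrow> real) \<Rightarrow> real"
    proof -
      have "continuous_on (?T \<times> cbox 0 1) (\<lambda>q. (x(i := fst q), snd q))"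
        by (intro continuous_on_Pair continuous_on_fun_upd continuous_on_const continuous_on_fst
            continuous_on_snd continuous_on_id)
      moreover have "(\<lambda>q. (x(i := fst q), snd q)) ` (?T \<times> cbox 0 1) \<subseteq> U \<times> cbox 0 1"
        using xt by auto
      ultimately show ?thesis
        using continuous_on_compose2[OF cont[OF that], of "?T \<times> cbox 0 1" "\<lambda>q. (x(i := fst q), snd q)"]
        by (simp only: case_prod_unfold fst_conv snd_conv)
    qed
    have cg: "continuous_on U g" "continuous_on U (pd i g)"
      using Suc.prems(1) i by (auto intro: Ck_imp_continuous_on)
    have "((\<lambda>t. integral (cbox 0 1) (\<lambda>s. w s * g (?z t s))) has_vector_derivative
        integral (cbox 0 1) (\<lambda>s. w' i s * pd i g (?z (x i) s))) (at (x i) within ?T)"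
    proof (rule leibniz_rule_vector_derivative)
      fix t s :: real assume t: "t \<in> ?T" and s: "s \<in> cbox 0 1"
      have "has_pd i g (pd i g (?z t s)) (?z t s)" using z[OF t] s Suc.prems i by simp
      then have "((\<lambda>r. g ((?z t s)(i := r))) has_vector_derivative pd i g (?z t s)) (at (?z t s i))"
        by (simp only: has_pd_def)
      moreover have "((\<lambda>t. ?z t s i) has_vector_derivative (if i = p then s else 1)) (at t within ?T)"
        by (auto intro!: derivative_eq_intros)
      ultimately have "(((\<lambda>r. g ((?z t s)(i := r))) \<circ> (\<lambda>t. ?z t s i)) has_vector_derivative
          (if i = p then s else 1) *\<^sub>R pd i g (?z t s)) (at t within ?T)"
        by (intro vector_diff_chain_within) (blast intro: has_vector_derivative_at_within)+
      moreover have "(?z t s)(i := ?z r s i) = ?z r s" for r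
        by (auto simp: fun_eq_iff)
      ultimately have "((\<lambda>t. g (?z t s)) has_vector_derivative
          (if i = p then s else 1) *\<^sub>R pd i g (?z t s)) (at t within ?T)"
        by (simp only: o_def)
      from has_vector_derivative_mult_right[OF this, of "w s"]
      show "((\<lambda>t. w s * g (?z t s)) has_vector_derivative w' i s * pd i g (?z t s)) (at t within ?T)"
        by (simp only: w'_def) (auto simp: mult.assoc simp del: fun_upd_apply split: if_splits)
    next
      fix t assume t: "t \<in> ?T"
      have "continuous_on (cbox 0 1) (\<lambda>s. w s * g (?z t s))"
        using continuous_on_compose2[OF contT[OF Suc.prems(2) cg(1)], of "cbox 0 1" "Pair t"] t
        by (simp add: continuous_on_Pair image_subset_iff del: fun_upd_apply)
      then show "(\<lambda>s. w s * g (?z t s)) integrable_on cbox 0 1"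
        by (rule integrable_continuous)
    next
      show "continuous_on (?T \<times> cbox 0 1) (\<lambda>(t, s). w' i s * pd i g (?z t s))"
        by (rule contT[OF w' cg(2)])
    qed (use e in auto)
    moreover have "at (x i) within ?T = at (x i)" using e by (intro at_within_open) auto
    ultimately show "has_pd i (?F w g) (?F (w' i) (pd i g) x) x"
      by (simp add: has_pd_def del: fun_upd_apply)
  qed
  then show ?case .
qed

text \<open>For \<open>G\<close> vanishing on \<open>x p = 0\<close> the value there is the limit of
  the quotient.\<close>

definition rquot :: "nat \<Rightarrow> ((nat \<Rightarrow> real) \<Rightarrow> 'b::real_normed_vector) \<Rightarrow> (nat \<Rightarrow> real) \<Rightarrow> 'b" where
  "rquot p G x = (if x p = 0 then pd p G x else inverse (x p) *\<^sub>R G x)"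

text \<open>Near the axis this is Hadamard's lemma: \<open>G y\<close> is \<open>y p\<close> times
  the average of \<open>pd p G\<close> over the segment from the axis to \<open>y\<close>, and such
  averages inherit smoothness. Off the axis \<open>inverse (x p)\<close> is itself smooth.\<close>

lemma smooth_rquot_real:
  fixes G :: "(nat \<Rightarrow> real) \<Rightarrow> real"
  assumes D: "nopen n D" and p: "p < n" and G: "smooth n D G" and G0: "\<And>x. x \<in> D \<Longrightarrow> x p = 0 \<Longrightarrow> G x = 0"
  shows "smooth n D (rquot p G)"
  unfolding smooth_def
proof
  fix k
  show "Ck n k D (rquot p G)"
  proof (rule Ck_local[OF D])
    fix x assume x: "x \<in> D"
    obtain e where e: "e > 0" "box_nbhd n x e \<subseteq> D" using D x by (rule nopenE)
    show "\<exists>e>0. Ck n k (D \<inter> box_nbhd n x e) (rquot p G)"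
    proof (cases "x p = 0")
      case False
      \<comment> \<open>The bound by the distance to \<open>x p = 0\<close> keeps the box off the
        axis.\<close>
      define d where "d = min e \<bar>x p\<bar>"
      have d: "d > 0" "d \<le> e" "d \<le> \<bar>x p\<bar>" using e False by (auto simp: d_def)
      let ?B = "box_nbhd n x d"
      have sub: "?B \<subseteq> D" using d e by (force simp: box_nbhd_def)
      have B: "nopen n ?B" by (rule nopen_box_nbhd[OF nopenD_zero[OF D x]])
      have nz: "y p \<noteq> 0" if "y \<in> ?B" for y
        using that d p by (auto simp: box_nbhd_def)
      have "Ck n k ?B (\<lambda>y. inverse (y p) *\<^sub>R G y)"
        by (intro Ck_bilinear[OF B bounded_bilinear_scaleR] Ck_inverse_coord B nz
            Ck_subset[OF smooth_Ck[OF G] sub]) auto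
      then have "Ck n k ?B (rquot p G)"
        by (rule Ck_cong[OF B, rotated]) (simp add: rquot_def nz)
      then show ?thesis using d(1) sub by (metis Int_absorb1)
    next
      case True
      let ?B = "box_nbhd n x e"
      have B: "nopen n ?B" by (rule nopen_box_nbhd[OF nopenD_zero[OF D x]])
      \<comment> \<open>The box is centred on the axis, so shrinking the \<open>p\<close>-th
        coordinate towards 0 does not leave it.\<close>
      have star: "y(p := s * y p) \<in> ?B" if "y \<in> ?B" "s \<in> {0..1}" for y s
      proof -
        have "\<bar>s * y p\<bar> \<le> 1 * \<bar>y p\<bar>" unfolding abs_mult using that by (intro mult_right_mono) auto
        then show ?thesis using that p True by (auto simp: box_nbhd_def)
      qed
      have "Ck n k ?B (\<lambda>y. integral {0..1} (\<lambda>s. 1 * pd p G (y(p := s * y p))))"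
        by (rule Ck_avg[OF B star p Ck_subset[OF smooth_Ck[OF smooth_pd[OF G p]] e(2)]]) auto
      then have "Ck n k ?B (rquot p G)"
      proof (rule Ck_cong[OF B, rotated])
        fix y assume y: "y \<in> ?B"
        show "integral {0..1} (\<lambda>s. 1 * pd p G (y(p := s * y p))) = rquot p G y"
        proof (cases "y p = 0")
          case True
          then have "y(p := s * y p) = y" for s by (simp add: fun_upd_idem)
          with True show ?thesis by (simp add: rquot_def)
        next
          case False
          have "((\<lambda>s. G (y(p := s * y p))) has_vector_derivative y p * pd p G (y(p := s * y p)))
              (at s within {0..1})" if s: "s \<in> {0..1}" for s
          proof -
            have "has_pd p G (pd p G (y(p := s * y p))) (y(p := s * y p))"
              using star[OF y s] e by (intro smooth_has_pd[OF G p]) auto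
            then have "((\<lambda>t. G (y(p := t))) has_vector_derivative pd p G (y(p := s * y p))) (at (s * y p))"
              by (simp add: has_pd_def)
            moreover have "((\<lambda>s. s * y p) has_vector_derivative y p) (at s within {0..1})"
              by (auto intro!: derivative_eq_intros)
            ultimately have "(((\<lambda>t. G (y(p := t))) \<circ> (\<lambda>s. s * y p)) has_vector_derivative
                y p *\<^sub>R pd p G (y(p := s * y p))) (at s within {0..1})"
              by (intro vector_diff_chain_within) (blast intro: has_vector_derivative_at_within)+
            then show ?thesis by (simp add: o_def)
          qed
          then have "((\<lambda>s. y p * pd p G (y(p := s * y p))) has_integral
              G (y(p := 1 * y p)) - G (y(p := 0 * y p))) {0..1}"
            by (intro fundamental_theorem_of_calculus) (auto simp del: fun_upd_apply)
          moreover have "G (y(p := 0 * y p)) = 0"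
            using star[OF y, of 0] e by (intro G0) auto
          ultimately have "((\<lambda>s. y p * pd p G (y(p := s * y p))) has_integral G y) {0..1}"
            by simp
          then have "y p * integral {0..1} (\<lambda>s. pd p G (y(p := s * y p))) = G y"
            by (simp only: integral_mult_right[symmetric] integral_unique)
          with False show ?thesis by (simp add: rquot_def field_simps)
        qed
      qed
      then show ?thesis using e by (metis Int_absorb1)
    qed
  qed
qed

lemma smooth_rquot:
  fixes G :: "(nat \<Rightarrow> real) \<Rightarrow> clifford"
  assumes D: "nopen n D" and p: "p < n" and G: "smooth n D G" and G0: "\<And>x. x \<in> D \<Longrightarrow> x p = 0 \<Longrightarrow> G x = 0"
    and S: "finite S" "\<And>x A. x \<in> D \<Longrightarrow> A \<notin> S \<Longrightarrow> coeff (G x) A = 0"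
  shows "smooth n D (rquot p G)" "\<And>x A. x \<in> D \<Longrightarrow> A \<notin> S \<Longrightarrow> coeff (rquot p G x) A = 0"
proof -
  show c0: "coeff (rquot p G x) A = 0" if "x \<in> D" "A \<notin> S" for x A
    using coeff_pd_eq_0[OF D smooth_Ck[OF G] that(1) p S(2)[OF _ that(2)]] S(2)[OF that]
    by (simp add: rquot_def)
  show "smooth n D (rquot p G)"
  proof (rule smooth_coeffI[OF D S(1) c0])
    fix A
    have "smooth n D (rquot p (\<lambda>x. coeff (G x) A))"
      by (intro smooth_rquot_real[OF D p] smooth_linear[OF D bounded_linear_coeff G]) (simp add: G0)
    then show "smooth n D (\<lambda>x. coeff (rquot p G x) A)"
      by (rule smooth_cong[OF D, rotated])
         (simp add: rquot_def Ck_linear_pd[OF D bounded_linear_coeff smooth_Ck[OF G, of "Suc 0"] p])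
  qed
qed

section \<open>Slice functions\<close>

text \<open>Anticommutation cancels the off-diagonal terms in pairs, and squares of generators are
  \<open>-1\<close>. It serves twice: with mixed derivatives for the square of \<open>Dp\<close>,
  and with the numbers \<open>x i * x j\<close> for the square of \<open>xq\<close>.\<close>

lemma sum_gen_gen_symmetric:
  fixes P :: "nat \<Rightarrow> nat \<Rightarrow> clifford"
  assumes "\<And>i j. i \<in> I \<Longrightarrow> j \<in> I \<Longrightarrow> P i j = P j i" "finite I"
  shows "(\<Sum>i\<in>I. \<Sum>j\<in>I. gen i * gen j * P i j) = - (\<Sum>i\<in>I. P i i)"
proof -
  let ?X = "\<Sum>i\<in>I. \<Sum>j\<in>I. gen i * gen j * P i j"
  have "?X + ?X = ?X + (\<Sum>i\<in>I. \<Sum>j\<in>I. gen j * gen i * P j i)"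
    by (subst (2) sum.swap) simp
  also have "\<dots> = (\<Sum>i\<in>I. \<Sum>j\<in>I. (gen i * gen j + gen j * gen i) * P i j)"
    unfolding sum.distrib[symmetric] by (intro sum.cong refl) (simp add: assms(1) distrib_right)
  also have "\<dots> = (\<Sum>i\<in>I. \<Sum>j\<in>I. if i = j then - 2 * P i j else 0)"
    by (intro sum.cong refl) (simp add: gen_anticommute)
  also have "\<dots> = (\<Sum>i\<in>I. - 2 * P i i)"
    by (intro sum.cong refl) (simp add: assms(2) sum.delta)
  also have "\<dots> = (- (\<Sum>i\<in>I. P i i)) + (- (\<Sum>i\<in>I. P i i))"
    by (simp add: sum_negf sum.distrib flip: mult_2)  (simp add: sum_distrib_left)
  finally have "2 *\<^sub>R ?X = 2 *\<^sub>R (- (\<Sum>i\<in>I. P i i))"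
    by (simp add: scaleR_2)
  then show ?thesis by (simp only: scaleR_cancel_left) simp
qed

locale slice =
  fixes p q :: nat and D :: "(nat \<Rightarrow> real) set"
  assumes openD: "openin (Euclidean_space (Suc p)) D" and reflD: "reflect p ` D = D"
begin

lemma D: "nopen (Suc p) D"
  by (rule openin_Euclidean_space_imp_nopen[OF openD])

lemma reflect_in: "x \<in> D \<Longrightarrow> reflect p x \<in> D"
  using reflD by blast

text \<open>The clause on coefficients confines the values to a finite-dimensional subspace, as
  division by \<open>r\<close> requires. The class is closed under \<open>pd i\<close> for
  \<open>i < p\<close> and under division of the radial derivative by \<open>r\<close>, which is
  what the later inductions run on.\<close>

definition even_smooth :: "((nat \<Rightarrow> real) \<Rightarrow> clifford) \<Rightarrow> bool" where
  "even_smooth A \<longleftrightarrow> smooth (Suc p) D A \<and> (\<forall>x\<in>D. A (reflect p x) = A x)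
     \<and> (\<forall>x\<in>D. \<forall>B. B \<notin> Pow {..<p + q} \<longrightarrow> coeff (A x) B = 0)"

text \<open>\<open>r\<^sup>-\<^sup>1 \<partial>\<^sub>r A\<close>; for even \<open>A\<close> the value \<open>\<partial>\<^sub>r\<^sup>2 A\<close> that \<^const>\<open>rquot\<close> takes on the axis is the limit.\<close>

definition radial_quot :: "((nat \<Rightarrow> real) \<Rightarrow> clifford) \<Rightarrow> (nat \<Rightarrow> real) \<Rightarrow> clifford" where
  "radial_quot A = rquot p (pd p A)"

definition Dp :: "((nat \<Rightarrow> real) \<Rightarrow> clifford) \<Rightarrow> (nat \<Rightarrow> real) \<Rightarrow> clifford" where
  "Dp A x = (\<Sum>i<p. gen i * pd i A x)"

lemma even_smoothD:
  assumes "even_smooth A"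
  shows "smooth (Suc p) D A" "\<And>x. x \<in> D \<Longrightarrow> A (reflect p x) = A x"
    "\<And>x B. x \<in> D \<Longrightarrow> B \<notin> Pow {..<p + q} \<Longrightarrow> coeff (A x) B = 0"
  using assms by (auto simp: even_smooth_def)

lemma even_has_pd:
  "even_smooth A \<Longrightarrow> i < Suc p \<Longrightarrow> x \<in> D \<Longrightarrow> has_pd i A (pd i A x) x"
  using smooth_has_pd[OF even_smoothD(1)] .

lemma pd_reflect_other:
  assumes A: "even_smooth A" and i: "i < p" and x: "x \<in> D"
  shows "pd i A (reflect p x) = pd i A x"
proof (rule has_pd_unique)
  have "has_pd i A (pd i A x) x" using even_has_pd[OF A _ x] i by simp
  then have "has_pd i (\<lambda>y. A (reflect p y)) (pd i A x) x"
    by (rule has_pd_cong[OF D x _ _, rotated 2]) (use i even_smoothD(2)[OF A] in auto)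
  moreover have "reflect p (x(i := t)) = (reflect p x)(i := t)" for t
    using i by (auto simp: reflect_def fun_eq_iff)
  ultimately show "has_pd i A (pd i A x) (reflect p x)"
    using i by (simp add: has_pd_def reflect_def)
qed

lemma pd_reflect:
  assumes A: "even_smooth A" and x: "x \<in> D"
  shows "pd p A (reflect p x) = - pd p A x"
proof -
  have "has_pd p A (pd p A (reflect p x)) (reflect p x)"
    by (rule even_has_pd[OF A _ reflect_in[OF x]]) simp
  then have "((\<lambda>t. A (x(p := t))) has_vector_derivative pd p A (reflect p x)) (at (- x p))"
    by (simp add: has_pd_def reflect_def)
  moreover have "(uminus has_vector_derivative -1) (at (x p))"
    by (auto intro!: derivative_eq_intros)
  ultimately have "((\<lambda>t. A (x(p := t))) \<circ> uminus has_vector_derivative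
      (-1) *\<^sub>R pd p A (reflect p x)) (at (x p))"
    by (intro vector_diff_chain_at) auto
  then have "has_pd p (\<lambda>y. A (reflect p y)) (- pd p A (reflect p x)) x"
    by (simp add: has_pd_def reflect_def o_def)
  then have "has_pd p A (- pd p A (reflect p x)) x"
    by (rule has_pd_cong[OF D x _ _, rotated 2]) (use even_smoothD(2)[OF A] in auto)
  then show ?thesis using has_pd_unique by fastforce
qed

lemma pd_axis: "even_smooth A \<Longrightarrow> x \<in> D \<Longrightarrow> x p = 0 \<Longrightarrow> pd p A x = 0"
proof -
  assume A: "even_smooth A" "x \<in> D" "x p = 0"
  then have "reflect p x = x" by (auto simp: reflect_def)
  then have "pd p A x = - pd p A x" using pd_reflect[OF A(1,2)] by simp
  then have "2 *\<^sub>R pd p A x = 0" by (simp add: scaleR_2 eq_neg_iff_add_eq_0)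
  then show ?thesis by simp
qed

lemma even_smooth_pd:
  assumes A: "even_smooth A" and i: "i < p"
  shows "even_smooth (pd i A)"
  unfolding even_smooth_def
proof (intro conjI ballI allI impI)
  show "smooth (Suc p) D (pd i A)" using i by (intro smooth_pd even_smoothD(1)[OF A]) simp
  show "pd i A (reflect p x) = pd i A x" if "x \<in> D" for x
    by (rule pd_reflect_other[OF A i that])
  show "coeff (pd i A x) B = 0" if "x \<in> D" "B \<notin> Pow {..<p + q}" for x B
    by (rule coeff_pd_eq_0[OF D smooth_Ck[OF even_smoothD(1)[OF A], of "Suc 0"] that(1)])
       (use i even_smoothD(3)[OF A _ that(2)] in auto)
qed

text \<open>The radial derivative of an even function is odd, so it vanishes on the axis and is
  divisible by \<open>r\<close>; a quotient of two odd functions is even again.\<close>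

lemma even_smooth_radial_quot:
  assumes A: "even_smooth A"
  shows "even_smooth (radial_quot A)"
  unfolding even_smooth_def
proof (intro conjI ballI allI impI)
  have S: "coeff (pd p A x) B = 0" if "x \<in> D" "B \<notin> Pow {..<p + q}" for x B
    by (rule coeff_pd_eq_0[OF D smooth_Ck[OF even_smoothD(1)[OF A], of "Suc 0"] that(1)])
       (use even_smoothD(3)[OF A _ that(2)] in auto)
  have sm: "smooth (Suc p) D (pd p A)" by (intro smooth_pd even_smoothD(1)[OF A]) simp
  note r = smooth_rquot[where S = "Pow {..<p + q}", OF D _ sm pd_axis[OF A] _ S]
  show "smooth (Suc p) D (radial_quot A)" unfolding radial_quot_def by (rule r(1)) auto
  show "coeff (radial_quot A x) B = 0" if "x \<in> D" "B \<notin> Pow {..<p + q}" for x B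
    unfolding radial_quot_def by (rule r(2)) (use that in auto)
  show "radial_quot A (reflect p x) = radial_quot A x" if "x \<in> D" for x
  proof (cases "x p = 0")
    case True
    then have "reflect p x = x" by (auto simp: reflect_def)
    then show ?thesis by simp
  next
    case False
    then show ?thesis using pd_reflect[OF A that] by (simp add: radial_quot_def rquot_def) (simp add: reflect_def)
  qed
qed

lemma even_smooth_scaleR: "even_smooth A \<Longrightarrow> even_smooth (\<lambda>x. c *\<^sub>R A x)"
  by (simp add: even_smooth_def smooth_scaleR_const[OF D])

text \<open>In this multiplied form the relation holds on the axis too, where both sides are
  zero.\<close>

lemma scaleR_radial_quot:
  assumes "even_smooth A" "x \<in> D"
  shows "x p *\<^sub>R radial_quot A x = pd p A x"
  using pd_axis[OF assms] by (simp add: radial_quot_def rquot_def)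

lemma radial_quot_scaleR:
  assumes A: "even_smooth A" and x: "x \<in> D"
  shows "radial_quot (\<lambda>x. c *\<^sub>R A x) x = c *\<^sub>R radial_quot A x"
proof -
  have pd: "pd p (\<lambda>x. c *\<^sub>R A x) y = c *\<^sub>R pd p A y" if "y \<in> D" for y
    by (intro has_pd_unique has_pd_linear[OF bounded_linear_scaleR_right] even_has_pd A that) simp
  have "has_pd p (pd p A) (pd p (pd p A) x) x"
    by (rule smooth_has_pd[OF smooth_pd[OF even_smoothD(1)[OF A]] _ x]) auto
  then have "has_pd p (\<lambda>x. c *\<^sub>R pd p A x) (c *\<^sub>R pd p (pd p A) x) x"
    by (rule has_pd_linear[OF bounded_linear_scaleR_right])
  then have "pd p (pd p (\<lambda>x. c *\<^sub>R A x)) x = c *\<^sub>R pd p (pd p A) x"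
    by (rule has_pd_unique[OF has_pd_cong[OF D x, of p, rotated 2]]) (auto simp: pd)
  then show ?thesis using pd[OF x] by (simp add: radial_quot_def rquot_def)
qed

lemma has_pd_coord_scaleR:
  assumes "has_pd p H d x"
  shows "has_pd p (\<lambda>y. y p *\<^sub>R H y) (H x + x p *\<^sub>R d) x"
  using has_pd_bilinear[OF bounded_bilinear_scaleR has_pd_coord assms, of p] by (simp add: add.commute)

text \<open>Off the axis one divides; on the axis, differentiating both sides in \<open>x p\<close>
  leaves \<open>H1 x = H2 x\<close>. Identities for \<open>radial_quot\<close> can thus be checked
  after multiplication by \<open>r\<close>.\<close>

lemma scaleR_coord_cancel:
  fixes H1 H2 :: "(nat \<Rightarrow> real) \<Rightarrow> clifford"
  assumes H: "smooth (Suc p) D H1" "smooth (Suc p) D H2"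
    and eq: "\<And>x. x \<in> D \<Longrightarrow> x p *\<^sub>R H1 x = x p *\<^sub>R H2 x" and x: "x \<in> D"
  shows "H1 x = H2 x"
proof (cases "x p = 0")
  case True
  have "has_pd p (\<lambda>y. y p *\<^sub>R H1 y) (H1 x + x p *\<^sub>R pd p H1 x) x"
    by (intro has_pd_coord_scaleR smooth_has_pd[OF H(1) _ x]) simp
  then have "has_pd p (\<lambda>y. y p *\<^sub>R H2 y) (H1 x + x p *\<^sub>R pd p H1 x) x"
    by (rule has_pd_cong[OF D x, rotated 2]) (use eq in auto)
  moreover have "has_pd p (\<lambda>y. y p *\<^sub>R H2 y) (H2 x + x p *\<^sub>R pd p H2 x) x"
    by (intro has_pd_coord_scaleR smooth_has_pd[OF H(2) _ x]) simp
  ultimately have "H1 x + x p *\<^sub>R pd p H1 x = H2 x + x p *\<^sub>R pd p H2 x"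
    by (metis has_pd_unique)
  then show ?thesis using True by simp
next
  case False
  then show ?thesis using eq[OF x] by simp
qed

lemma smooth_Dp: "smooth (Suc p) D A \<Longrightarrow> smooth (Suc p) D (Dp A)"
  unfolding Dp_def[abs_def]
  by (intro smooth_sum[OF D] smooth_mult_left[OF D] smooth_pd) auto

lemma has_pd_Dp:
  assumes A: "smooth (Suc p) D A" and i: "i < Suc p" and x: "x \<in> D"
  shows "has_pd i (Dp A) (\<Sum>j<p. gen j * pd i (pd j A) x) x"
  unfolding Dp_def[abs_def]
  using i by (intro has_pd_sum has_pd_linear[OF bounded_linear_mult_right]
      smooth_has_pd[OF smooth_pd[OF A] _ x]) auto

text \<open>\<open>radial_quot\<close> commutes with \<open>Dp\<close>: mixed derivatives commute,
  and \<open>x p\<close> is a constant for \<open>pd j\<close> with \<open>j < p\<close>. The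
  multiplied form matches \<open>scaleR_coord_cancel\<close>.\<close>

lemma pd_p_Dp:
  assumes A: "even_smooth A" and x: "x \<in> D"
  shows "pd p (Dp A) x = x p *\<^sub>R Dp (radial_quot A) x"
proof -
  have "pd p (pd j A) x = x p *\<^sub>R pd j (radial_quot A) x" if j: "j < p" for j
  proof -
    have "pd p (pd j A) x = pd j (pd p A) x"
      using j by (intro pd_swap[OF D even_smoothD(1)[OF A] _ _ x]) auto
    also have "\<dots> = x p *\<^sub>R pd j (radial_quot A) x"
    proof (rule has_pd_unique)
      have "has_pd j (radial_quot A) (pd j (radial_quot A) x) x"
        using j by (intro even_has_pd even_smooth_radial_quot A x) auto
      then have "has_pd j (\<lambda>y. y p *\<^sub>R radial_quot A y) (x p *\<^sub>R pd j (radial_quot A) x) x"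
        using has_pd_bilinear[OF bounded_bilinear_scaleR has_pd_coord, of j "radial_quot A" _ x p] j by simp
      then show "has_pd j (pd p A) (x p *\<^sub>R pd j (radial_quot A) x) x"
        by (rule has_pd_cong[OF D x, of j "\<lambda>y. y p *\<^sub>R radial_quot A y", rotated 2])
           (use j scaleR_radial_quot[OF A] in auto)
    qed
    finally show ?thesis .
  qed
  then show ?thesis
    unfolding has_pd_unique[OF has_pd_Dp[OF even_smoothD(1)[OF A] lessI x]]
    by (simp add: Dp_def scaleR_sum_right)
qed

lemma Dp_Dp:
  assumes A: "smooth (Suc p) D A" and x: "x \<in> D"
  shows "Dp (Dp A) x = - (\<Sum>i<p. pd i (pd i A) x)"
proof -
  have "Dp (Dp A) x = (\<Sum>i<p. gen i * (\<Sum>j<p. gen j * pd i (pd j A) x))"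
    unfolding Dp_def[of "Dp A"]
    by (intro sum.cong refl arg_cong2[where f = "(*)"] has_pd_unique has_pd_Dp A x) auto
  also have "\<dots> = (\<Sum>i<p. \<Sum>j<p. gen i * gen j * pd i (pd j A) x)"
    by (simp add: sum_distrib_left mult.assoc)
  also have "\<dots> = - (\<Sum>i<p. pd i (pd i A) x)"
    by (rule sum_gen_gen_symmetric) (auto intro!: pd_swap[OF D A _ _ x])
  finally show ?thesis .
qed

lemma has_pd_coord_square: "has_pd i (\<lambda>x. (x p)\<^sup>2) (if i = p then 2 * x p else 0) x"
proof (cases "i = p")
  case True
  have "((\<lambda>t::real. t\<^sup>2) has_field_derivative 2 * x p) (at (x p))"
    by (auto intro!: derivative_eq_intros)
  with True show ?thesis by (simp add: has_pd_def has_real_derivative_iff_has_vector_derivative)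
qed (simp add: has_pd_def)

lemma has_pd_combination:
  fixes A B C :: "(nat \<Rightarrow> real) \<Rightarrow> clifford"
  assumes "has_pd i A a x" "has_pd i B b x" "has_pd i C c x"
  shows "has_pd i (\<lambda>x. k *\<^sub>R B x + (x p)\<^sup>2 *\<^sub>R C x + l *\<^sub>R A x)
    (k *\<^sub>R b + ((x p)\<^sup>2 *\<^sub>R c + (if i = p then 2 * x p else 0) *\<^sub>R C x) + l *\<^sub>R a) x"
  by (intro has_pd_add has_pd_linear[OF bounded_linear_scaleR_right]
      has_pd_bilinear[OF bounded_bilinear_scaleR has_pd_coord_square] assms)

text \<open>The system satisfied by \<open>T\<^sup>m F\<^sub>1\<close> and \<open>T\<^sup>m (F\<^sub>2 / r)\<close>.\<close>

definition vekua :: "real \<Rightarrow> nat \<Rightarrow> ((nat \<Rightarrow> real) \<Rightarrow> clifford) \<Rightarrow> ((nat \<Rightarrow> real) \<Rightarrow> clifford) \<Rightarrow> bool" where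
  "vekua lam m A B \<longleftrightarrow> even_smooth A \<and> even_smooth B \<and>
     (\<forall>x\<in>D. Dp A x = real (2 * m + 1) *\<^sub>R B x + (x p)\<^sup>2 *\<^sub>R radial_quot B x + lam *\<^sub>R A x \<and>
        Dp B x = radial_quot A x - lam *\<^sub>R B x)"

text \<open>Both equations are differentiated in \<open>r\<close> and a factor \<open>r\<close> is
  cancelled. The product rule on \<open>r\<^sup>2\<close> contributes \<open>2 r\<close> times
  \<open>radial_quot B\<close>, which raises \<open>2 m + 1\<close> to
  \<open>2 m + 3\<close>.\<close>

lemma vekua_radial_quot:
  assumes "vekua lam m A B"
  shows "vekua lam (Suc m) (radial_quot A) (radial_quot B)"
proof -
  have A: "even_smooth A" and B: "even_smooth B"
    and e1: "\<And>x. x \<in> D \<Longrightarrow> Dp A x = real (2 * m + 1) *\<^sub>R B x + (x p)\<^sup>2 *\<^sub>R radial_quot B x + lam *\<^sub>R A x"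
    and e2: "\<And>x. x \<in> D \<Longrightarrow> Dp B x = radial_quot A x - lam *\<^sub>R B x"
    using assms by (auto simp: vekua_def)
  note A' = even_smooth_radial_quot[OF A] and B' = even_smooth_radial_quot[OF B]
  note A'' = even_smooth_radial_quot[OF A'] and B'' = even_smooth_radial_quot[OF B']
  let ?R = "\<lambda>x. real (2 * Suc m + 1) *\<^sub>R radial_quot B x + (x p)\<^sup>2 *\<^sub>R radial_quot (radial_quot B) x + lam *\<^sub>R radial_quot A x"
  have "Dp (radial_quot A) x = ?R x" if x: "x \<in> D" for x
  proof (rule scaleR_coord_cancel[OF _ _ _ x])
    show "smooth (Suc p) D (Dp (radial_quot A))" by (intro smooth_Dp even_smoothD(1)[OF A'])
    have "smooth (Suc p) D (\<lambda>x. (x p)\<^sup>2)"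
      unfolding power2_eq_square by (intro smooth_mult smooth_coord D)
    then show "smooth (Suc p) D ?R"
      by (intro smooth_add smooth_scaleR_const smooth_scaleR D even_smoothD(1) A' B' B'')
    fix x assume x: "x \<in> D"
    have "x p *\<^sub>R Dp (radial_quot A) x = pd p (Dp A) x" by (rule pd_p_Dp[OF A x, symmetric])
    also have "\<dots> = pd p (\<lambda>x. real (2 * m + 1) *\<^sub>R B x + (x p)\<^sup>2 *\<^sub>R radial_quot B x + lam *\<^sub>R A x) x"
      by (rule pd_cong[OF D x]) (use e1 in auto)
    also have "\<dots> = real (2 * m + 1) *\<^sub>R pd p B x + ((x p)\<^sup>2 *\<^sub>R pd p (radial_quot B) x
        + (if p = p then 2 * x p else 0) *\<^sub>R radial_quot B x) + lam *\<^sub>R pd p A x"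
      by (intro has_pd_unique has_pd_combination even_has_pd A B B' x) auto
    also have "\<dots> = x p *\<^sub>R ?R x"
    proof -
      define k where "k = real (2 * m + 1)"
      have k: "real (2 * Suc m + 1) = k + 2" by (simp add: k_def)
      show ?thesis
        unfolding k k_def[symmetric]
        by (simp add: algebra_simps power2_eq_square
            flip: scaleR_radial_quot[OF A x] scaleR_radial_quot[OF B x] scaleR_radial_quot[OF B' x])
    qed
    finally show "x p *\<^sub>R Dp (radial_quot A) x = x p *\<^sub>R ?R x" .
  qed
  moreover have "Dp (radial_quot B) x = radial_quot (radial_quot A) x + (- lam) *\<^sub>R radial_quot B x" if x: "x \<in> D" for x
  proof (rule scaleR_coord_cancel[OF _ _ _ x])
    show "smooth (Suc p) D (Dp (radial_quot B))" by (intro smooth_Dp even_smoothD(1)[OF B'])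
    show "smooth (Suc p) D (\<lambda>x. radial_quot (radial_quot A) x + (- lam) *\<^sub>R radial_quot B x)"
      by (intro smooth_add smooth_scaleR_const D even_smoothD(1) A'' B')
    fix x assume x: "x \<in> D"
    have "x p *\<^sub>R Dp (radial_quot B) x = pd p (Dp B) x" by (rule pd_p_Dp[OF B x, symmetric])
    also have "\<dots> = pd p (\<lambda>x. radial_quot A x + (- lam) *\<^sub>R B x) x"
      by (rule pd_cong[OF D x]) (use e2 in auto)
    also have "\<dots> = pd p (radial_quot A) x + (- lam) *\<^sub>R pd p B x"
      by (intro has_pd_unique has_pd_add has_pd_linear[OF bounded_linear_scaleR_right]
          even_has_pd A' B x) auto
    also have "\<dots> = x p *\<^sub>R (radial_quot (radial_quot A) x + (- lam) *\<^sub>R radial_quot B x)"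
      by (simp add: algebra_simps flip: scaleR_radial_quot[OF A' x] scaleR_radial_quot[OF B x])
    finally show "x p *\<^sub>R Dp (radial_quot B) x = x p *\<^sub>R (radial_quot (radial_quot A) x + (- lam) *\<^sub>R radial_quot B x)" .
  qed
  ultimately show ?thesis using A' B' by (simp add: vekua_def)
qed

text \<open>Each application of the Helmholtz operator produces a scalar factor; absorbing it into
  the pair keeps every iterate a solution.\<close>

lemma vekua_scaleR:
  assumes "vekua lam m A B"
  shows "vekua lam m (\<lambda>x. c *\<^sub>R A x) (\<lambda>x. c *\<^sub>R B x)"
proof -
  have A: "even_smooth A" and B: "even_smooth B" using assms by (auto simp: vekua_def)
  have Dpc: "Dp (\<lambda>x. c *\<^sub>R C x) x = c *\<^sub>R Dp C x" if C: "even_smooth C" and x: "x \<in> D" for C x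
  proof -
    have "pd i (\<lambda>x. c *\<^sub>R C x) x = c *\<^sub>R pd i C x" if "i < p" for i
      using that by (intro has_pd_unique has_pd_linear[OF bounded_linear_scaleR_right] even_has_pd C x) simp
    then show ?thesis by (simp add: Dp_def scaleR_sum_right)
  qed
  show ?thesis
    unfolding vekua_def
  proof (intro conjI ballI even_smooth_scaleR A B)
    fix x assume x: "x \<in> D"
    show "Dp (\<lambda>x. c *\<^sub>R A x) x = real (2 * m + 1) *\<^sub>R c *\<^sub>R B x
        + (x p)\<^sup>2 *\<^sub>R radial_quot (\<lambda>x. c *\<^sub>R B x) x + lam *\<^sub>R c *\<^sub>R A x"
      using assms x unfolding Dpc[OF A x] radial_quot_scaleR[OF B x] vekua_def
      by (simp only: scaleR_add_right scaleR_left_commute)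
    show "Dp (\<lambda>x. c *\<^sub>R B x) x = radial_quot (\<lambda>x. c *\<^sub>R A x) x - lam *\<^sub>R c *\<^sub>R B x"
      using assms x unfolding Dpc[OF B x] radial_quot_scaleR[OF A x] vekua_def
      by (simp only: scaleR_diff_right scaleR_left_commute)
  qed
qed

text \<open>\<open>Dp\<close> squares to minus the Laplacian in \<open>x\<^sub>p\<close> and
  commutes with multiplication by \<open>r\<^sup>2\<close>. When the system is substituted twice,
  the terms linear in \<open>lam\<close> cancel. The \<open>2 m + 3\<close> for \<open>B\<close>
  comes from the first equation for the pair of radial quotients.\<close>

lemma vekua_laplacian:
  assumes "vekua lam m A B" and x: "x \<in> D"
  shows "(\<Sum>i<p. pd i (pd i A) x)
      = - (real (2 * m + 1) *\<^sub>R radial_quot A x + (x p)\<^sup>2 *\<^sub>R radial_quot (radial_quot A) x + lam\<^sup>2 *\<^sub>R A x)" (is ?A)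
    and "(\<Sum>i<p. pd i (pd i B) x)
      = - (real (2 * m + 3) *\<^sub>R radial_quot B x + (x p)\<^sup>2 *\<^sub>R radial_quot (radial_quot B) x + lam\<^sup>2 *\<^sub>R B x)" (is ?B)
proof -
  have A: "even_smooth A" and B: "even_smooth B"
    and e1: "\<And>x. x \<in> D \<Longrightarrow> Dp A x = real (2 * m + 1) *\<^sub>R B x + (x p)\<^sup>2 *\<^sub>R radial_quot B x + lam *\<^sub>R A x"
    and e2: "\<And>x. x \<in> D \<Longrightarrow> Dp B x = radial_quot A x - lam *\<^sub>R B x"
    using assms by (auto simp: vekua_def)
  note A' = even_smooth_radial_quot[OF A] and B' = even_smooth_radial_quot[OF B]
  have e1': "Dp (radial_quot A) x = real (2 * m + 3) *\<^sub>R radial_quot B x + (x p)\<^sup>2 *\<^sub>R radial_quot (radial_quot B) x + lam *\<^sub>R radial_quot A x"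
    and e2': "Dp (radial_quot B) x = radial_quot (radial_quot A) x - lam *\<^sub>R radial_quot B x"
    using vekua_radial_quot[OF assms(1)] x by (auto simp: vekua_def algebra_simps)
  have "Dp (Dp A) x = (\<Sum>i<p. gen i * (real (2 * m + 1) *\<^sub>R pd i B x
      + (x p)\<^sup>2 *\<^sub>R pd i (radial_quot B) x + lam *\<^sub>R pd i A x))"
    unfolding Dp_def[of "Dp A"]
  proof (intro sum.cong refl arg_cong2[where f = "(*)"])
    fix i assume i: "i \<in> {..<p}"
    have "pd i (Dp A) x = pd i (\<lambda>x. real (2 * m + 1) *\<^sub>R B x + (x p)\<^sup>2 *\<^sub>R radial_quot B x + lam *\<^sub>R A x) x"
      by (rule pd_cong[OF D x]) (use e1 i in auto)
    also have "\<dots> = real (2 * m + 1) *\<^sub>R pd i B x + ((x p)\<^sup>2 *\<^sub>R pd i (radial_quot B) x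
        + (if i = p then 2 * x p else 0) *\<^sub>R radial_quot B x) + lam *\<^sub>R pd i A x"
      using i by (intro has_pd_unique has_pd_combination even_has_pd A B B' x) auto
    finally show "pd i (Dp A) x = real (2 * m + 1) *\<^sub>R pd i B x + (x p)\<^sup>2 *\<^sub>R pd i (radial_quot B) x + lam *\<^sub>R pd i A x"
      using i by simp
  qed
  also have "\<dots> = real (2 * m + 1) *\<^sub>R Dp B x + (x p)\<^sup>2 *\<^sub>R Dp (radial_quot B) x + lam *\<^sub>R Dp A x"
    by (simp add: Dp_def distrib_left sum.distrib scaleR_sum_right)
  finally have "Dp (Dp A) x = real (2 * m + 1) *\<^sub>R radial_quot A x + (x p)\<^sup>2 *\<^sub>R radial_quot (radial_quot A) x + lam\<^sup>2 *\<^sub>R A x"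
    unfolding e1[OF x] e2[OF x] e2' by (simp add: algebra_simps power2_eq_square)
  then show ?A
    using Dp_Dp[OF even_smoothD(1)[OF A] x] by (metis minus_minus)
  have "Dp (Dp B) x = (\<Sum>i<p. gen i * (pd i (radial_quot A) x + (- lam) *\<^sub>R pd i B x))"
    unfolding Dp_def[of "Dp B"]
  proof (intro sum.cong refl arg_cong2[where f = "(*)"])
    fix i assume i: "i \<in> {..<p}"
    have "pd i (Dp B) x = pd i (\<lambda>x. radial_quot A x + (- lam) *\<^sub>R B x) x"
      by (rule pd_cong[OF D x]) (use e2 i in auto)
    also have "\<dots> = pd i (radial_quot A) x + (- lam) *\<^sub>R pd i B x"
      using i by (intro has_pd_unique has_pd_add has_pd_linear[OF bounded_linear_scaleR_right]
          even_has_pd A' B x) auto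
    finally show "pd i (Dp B) x = pd i (radial_quot A) x + (- lam) *\<^sub>R pd i B x" .
  qed
  also have "\<dots> = Dp (radial_quot A) x + (- lam) *\<^sub>R Dp B x"
    by (simp add: Dp_def algebra_simps sum_subtractf sum_negf scaleR_sum_right)
  finally have "Dp (Dp B) x = real (2 * m + 3) *\<^sub>R radial_quot B x + (x p)\<^sup>2 *\<^sub>R radial_quot (radial_quot B) x + lam\<^sup>2 *\<^sub>R B x"
    unfolding e1' e2[OF x] by (simp add: algebra_simps power2_eq_square)
  then show ?B
    using Dp_Dp[OF even_smoothD(1)[OF B] x] by (metis minus_minus)
qed

end

section \<open>Lifting functions from \<open>D\<close> to the partially symmetric completion\<close>

context slice
begin

definition rad :: "(nat \<Rightarrow> real) \<Rightarrow> real" where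
  "rad x = sqrt (\<Sum>j\<in>{p..<p + q}. (x j)\<^sup>2)"

definition rho :: "(nat \<Rightarrow> real) \<Rightarrow> (nat \<Rightarrow> real)" where
  "rho x = (\<lambda>i. if i < p then x i else if i = p then rad x else 0)"

text \<open>The completion without a choice of direction: apart from the vanishing coordinates,
  membership depends on \<open>rho x\<close> only, so openness follows from continuity of
  \<open>rho\<close>.\<close>

definition Omega :: "(nat \<Rightarrow> real) set" where
  "Omega = {x. (\<forall>i\<ge>p + q. x i = 0) \<and> rho x \<in> D}"

definition xq :: "(nat \<Rightarrow> real) \<Rightarrow> clifford" where
  "xq x = (\<Sum>j\<in>{p..<p + q}. x j *\<^sub>R gen j)"

lemma rad_square: "(rad x)\<^sup>2 = (\<Sum>j\<in>{p..<p + q}. (x j)\<^sup>2)"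
  by (simp add: rad_def sum_nonneg)

lemma rho_p: "rho x p = rad x"
  by (simp add: rho_def)

lemma continuous_on_rho: "continuous_on S rho"
proof (rule continuous_on_coordinatewise_then_product)
  fix i
  show "continuous_on S (\<lambda>x. rho x i)"
    unfolding rho_def rad_def
    by (cases "i < p"; cases "i = p") (auto intro!: continuous_intros continuous_on_coord)
qed

lemma nopen_Omega: "nopen (p + q) Omega"
proof (rule openin_Euclidean_space_imp_nopen)
  obtain S where S: "openin (powertop_real UNIV) S" "D = S \<inter> {x. \<forall>i\<ge>Suc p. x i = 0}"
    using openD by (auto simp: Euclidean_space_def openin_subtopology)
  have "open S" using S(1) by (simp add: euclidean_product_topology)
  then have "open (rho -` S)" by (rule open_vimage[OF _ continuous_on_rho])
  moreover have "rho x \<in> D \<longleftrightarrow> rho x \<in> S" for x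
    by (subst S(2)) (auto simp: rho_def)
  then have "Omega = (rho -` S) \<inter> {x. \<forall>i\<ge>p + q. x i = 0}"
    by (auto simp: Omega_def)
  ultimately show "openin (Euclidean_space (p + q)) Omega"
    by (auto simp: Euclidean_space_def openin_subtopology euclidean_product_topology)
qed

lemma rho_in: "x \<in> Omega \<Longrightarrow> rho x \<in> D"
  by (simp add: Omega_def)

lemma has_pd_rho_left:
  assumes A: "even_smooth A" and i: "i < p" and x: "x \<in> Omega"
  shows "has_pd i (\<lambda>x. A (rho x)) (pd i A (rho x)) x"
proof -
  have "rho (x(i := t)) = (rho x)(i := t)" for t
    using i by (auto simp: rho_def rad_def fun_eq_iff intro!: sum.cong)
  moreover have "rho x i = x i" using i by (simp add: rho_def)
  ultimately show ?thesis
    using even_has_pd[OF A _ rho_in[OF x], of i] i by (simp add: has_pd_def)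
qed

text \<open>Off the axis this is the chain rule with \<open>x i / r\<close> as derivative of the
  radius. On the axis the radius is not differentiable, but along the line it is the absolute value
  of \<open>t\<close>, and evenness of \<open>A\<close> allows \<open>t\<close> itself in its
  place.\<close>

lemma has_pd_rho_right:
  assumes A: "even_smooth A" and i: "p \<le> i" "i < p + q" and x: "x \<in> Omega"
  shows "has_pd i (\<lambda>x. A (rho x)) (x i *\<^sub>R radial_quot A (rho x)) x"
proof -
  define c where "c = (\<Sum>j\<in>{p..<p + q} - {i}. (x j)\<^sup>2)"
  have c: "c \<ge> 0" unfolding c_def by (intro sum_nonneg) simp
  have radt: "rad (x(i := t)) = sqrt (c + t\<^sup>2)" for t
    using i by (simp add: rad_def c_def sum.remove[of _ i])
  have rhot: "rho (x(i := t)) = (rho x)(p := sqrt (c + t\<^sup>2))" for t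
    using i by (auto simp: rho_def radt[symmetric] fun_eq_iff)
  have rx: "rad x = sqrt (c + (x i)\<^sup>2)" using radt[of "x i"] by simp
  have hA: "((\<lambda>t. A ((rho x)(p := t))) has_vector_derivative pd p A (rho x)) (at (rad x))"
    using even_has_pd[OF A _ rho_in[OF x], of p] by (simp add: has_pd_def rho_p)
  show ?thesis
  proof (cases "rad x = 0")
    case True
    then have c0: "c = 0" and xi: "x i = 0"
      using rx c by (auto simp: add_nonneg_eq_0_iff)
    have T0: "pd p A (rho x) = 0" using pd_axis[OF A rho_in[OF x]] True by (simp add: rho_p)
    have "\<forall>\<^sub>F t in nhds (rho x p). (rho x)(p := t) \<in> D"
      by (rule nopen_eventually_line[OF D rho_in[OF x]]) simp
    \<comment> \<open>Evenness is available on \<open>D\<close> only, hence the restriction to small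
      \<open>t\<close>, for which the point remains in \<open>D\<close>.\<close>
    then have "\<forall>\<^sub>F t in nhds 0. t \<in> UNIV \<longrightarrow> A ((rho x)(p := t)) = A ((rho x)(p := \<bar>t\<bar>))"
      unfolding rho_p True
    proof eventually_elim
      case (elim t)
      have "reflect p ((rho x)(p := t)) = (rho x)(p := - t)" by (simp add: reflect_def)
      then show ?case using even_smoothD(2)[OF A elim] by (cases "t \<ge> 0") (auto simp: abs_if)
    qed
    then have "((\<lambda>t. A ((rho x)(p := t))) has_vector_derivative 0) (at 0) \<longleftrightarrow>
        ((\<lambda>t. A ((rho x)(p := \<bar>t\<bar>))) has_vector_derivative 0) (at 0)"
      by (intro has_vector_derivative_cong_ev) auto
    then have "((\<lambda>t. A ((rho x)(p := \<bar>t\<bar>))) has_vector_derivative 0) (at 0)"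
      using hA T0 True by simp
    then show ?thesis by (simp add: has_pd_def rhot c0 xi)
  next
    case False
    then have pos: "c + (x i)\<^sup>2 > 0" using c rx by (smt (verit) real_sqrt_zero zero_le_power2)
    have "((\<lambda>t. sqrt (c + t\<^sup>2)) has_field_derivative x i / rad x) (at (x i))"
      using pos by (auto intro!: derivative_eq_intros simp: rx field_simps)
    then have d: "((\<lambda>t. sqrt (c + t\<^sup>2)) has_vector_derivative x i / rad x) (at (x i))"
      by (simp add: has_real_derivative_iff_has_vector_derivative)
    have "(((\<lambda>t. A ((rho x)(p := t))) \<circ> (\<lambda>t. sqrt (c + t\<^sup>2))) has_vector_derivative
        (x i / rad x) *\<^sub>R pd p A (rho x)) (at (x i))"
      by (rule vector_diff_chain_at[OF d]) (use hA rx in simp)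
    moreover have "(x i / rad x) *\<^sub>R pd p A (rho x) = x i *\<^sub>R radial_quot A (rho x)"
      using False scaleR_radial_quot[OF A rho_in[OF x], symmetric] by (simp add: rho_p)
    ultimately show ?thesis by (simp add: has_pd_def rhot o_def)
  qed
qed

text \<open>A derivative of such a composite is a composite of the same kind, multiplied by a
  coordinate in the directions of \<open>x\<^sub>q\<close>. The induction over all even
  \<open>A\<close> therefore asks for no smoothness of \<open>rad\<close>.\<close>

lemma smooth_rho:
  assumes "even_smooth A"
  shows "smooth (p + q) Omega (\<lambda>x. A (rho x))"
proof -
  have "Ck (p + q) k Omega (\<lambda>x. A (rho x))" for k
    using assms
  proof (induction k arbitrary: A)
    case 0
    have "continuous_on D A" by (rule smooth_continuous_on[OF even_smoothD(1)[OF 0]])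
    then have "continuous_on Omega (\<lambda>x. A (rho x))"
      by (rule continuous_on_compose2[OF _ continuous_on_rho]) (auto intro: rho_in)
    then show ?case by simp
  next
    case (Suc k)
    have "continuous_on D A" by (rule smooth_continuous_on[OF even_smoothD(1)[OF Suc.prems]])
    then have c: "continuous_on Omega (\<lambda>x. A (rho x))"
      by (rule continuous_on_compose2[OF _ continuous_on_rho]) (auto intro: rho_in)
    show ?case
    proof (rule Ck_SucI[OF nopen_Omega c,
          where f' = "\<lambda>i x. if i < p then pd i A (rho x) else x i *\<^sub>R radial_quot A (rho x)"])
      show "has_pd i (\<lambda>x. A (rho x)) (if i < p then pd i A (rho x) else x i *\<^sub>R radial_quot A (rho x)) x"
        if "i < p + q" "x \<in> Omega" for i x
        using has_pd_rho_left[OF Suc.prems _ that(2)] has_pd_rho_right[OF Suc.prems _ that]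
        by (cases "i < p") auto
      show "Ck (p + q) k Omega (\<lambda>x. if i < p then pd i A (rho x) else x i *\<^sub>R radial_quot A (rho x))"
        if "i < p + q" for i
        using Suc.IH[OF even_smooth_pd[OF Suc.prems, of i]]
          Ck_bilinear[OF nopen_Omega bounded_bilinear_scaleR Ck_coord[OF nopen_Omega]
            Suc.IH[OF even_smooth_radial_quot[OF Suc.prems]], of i]
        by (cases "i < p") auto
    qed
  qed
  then show ?thesis by (simp add: smooth_def)
qed

text \<open>The term \<open>xq x * B\<close> with even \<open>B\<close> replaces \<omega> times an
  odd function, because \<omega> is not determined on the axis.\<close>

definition slice_fun :: "((nat \<Rightarrow> real) \<Rightarrow> clifford) \<Rightarrow> ((nat \<Rightarrow> real) \<Rightarrow> clifford) \<Rightarrow> (nat \<Rightarrow> real) \<Rightarrow> clifford" where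
  "slice_fun A B x = A (rho x) + xq x * B (rho x)"

lemma smooth_slice_fun: "even_smooth A \<Longrightarrow> even_smooth B \<Longrightarrow> smooth (p + q) Omega (slice_fun A B)"
  unfolding slice_fun_def[abs_def] xq_def
  by (intro smooth_add smooth_mult smooth_sum smooth_scaleR smooth_coord smooth_const smooth_rho nopen_Omega)

lemma xq_square: "xq x * xq x = - (rad x)\<^sup>2 *\<^sub>R 1"
proof -
  have "xq x * xq x = (\<Sum>i\<in>{p..<p + q}. \<Sum>j\<in>{p..<p + q}. gen i * gen j * ((x i * x j) *\<^sub>R 1))"
    by (simp add: xq_def sum_product mult.commute)
  also have "\<dots> = - (\<Sum>i\<in>{p..<p + q}. (x i * x i) *\<^sub>R 1)"
    by (rule sum_gen_gen_symmetric) (auto simp: mult.commute)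
  also have "\<dots> = - (\<Sum>i\<in>{p..<p + q}. (x i)\<^sup>2) *\<^sub>R 1"
    by (simp add: power2_eq_square scaleR_sum_left)
  finally show ?thesis by (simp only: rad_square)
qed

lemma gen_xq:
  assumes "i < p"
  shows "gen i * xq x = - (xq x * gen i)"
proof -
  have "gen i * gen j = - (gen j * gen i)" if "j \<in> {p..<p + q}" for j
    using assms that by (intro gen_swap) auto
  then show ?thesis
    by (simp add: xq_def sum_distrib_left sum_distrib_right sum_negf[symmetric])
qed

lemma has_pd_xq: "has_pd i xq (if p \<le> i \<and> i < p + q then gen i else 0) x"
proof -
  have "has_pd i xq (\<Sum>j\<in>{p..<p + q}. (if i = j then 1 else 0) *\<^sub>R gen j) x"
    unfolding xq_def[abs_def]
    by (intro has_pd_sum has_pd_linear[OF bounded_linear_scaleR_left] has_pd_coord)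
  moreover have "(\<Sum>j\<in>{p..<p + q}. (if i = j then 1 else 0) *\<^sub>R gen j)
      = (\<Sum>j\<in>{p..<p + q}. if i = j then gen j else 0)"
    by (intro sum.cong) auto
  ultimately show ?thesis by (simp add: sum.delta')
qed

lemma has_pd_slice_fun_left:
  assumes "even_smooth A" "even_smooth B" "i < p" "x \<in> Omega"
  shows "has_pd i (slice_fun A B) (slice_fun (pd i A) (pd i B) x) x"
proof -
  have "has_pd i (slice_fun A B) (pd i A (rho x) + (xq x * pd i B (rho x)
      + (if p \<le> i \<and> i < p + q then gen i else 0) * B (rho x))) x"
    unfolding slice_fun_def[abs_def]
    by (intro has_pd_add has_pd_bilinear[OF bounded_bilinear_mult] has_pd_xq has_pd_rho_left assms)
  then show ?thesis using assms(3) by (simp add: slice_fun_def)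
qed

lemma has_pd_slice_fun_right:
  assumes "even_smooth A" "even_smooth B" "p \<le> i" "i < p + q" "x \<in> Omega"
  shows "has_pd i (slice_fun A B) (x i *\<^sub>R slice_fun (radial_quot A) (radial_quot B) x + gen i * B (rho x)) x"
proof -
  have "has_pd i (slice_fun A B) (x i *\<^sub>R radial_quot A (rho x) + (xq x * (x i *\<^sub>R radial_quot B (rho x))
      + (if p \<le> i \<and> i < p + q then gen i else 0) * B (rho x))) x"
    unfolding slice_fun_def[abs_def]
    by (intro has_pd_add has_pd_bilinear[OF bounded_bilinear_mult] has_pd_xq has_pd_rho_right assms)
  then show ?thesis using assms(3,4) by (simp add: slice_fun_def algebra_simps)
qed

lemma pd_pd_slice_fun_left:
  assumes "even_smooth A" "even_smooth B" "i < p" "x \<in> Omega"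
  shows "pd i (pd i (slice_fun A B)) x = slice_fun (pd i (pd i A)) (pd i (pd i B)) x"
proof -
  have "pd i (pd i (slice_fun A B)) x = pd i (slice_fun (pd i A) (pd i B)) x"
    by (rule pd_cong[OF nopen_Omega assms(4)])
       (use assms has_pd_unique[OF has_pd_slice_fun_left[OF assms(1-3)]] in auto)
  also have "\<dots> = slice_fun (pd i (pd i A)) (pd i (pd i B)) x"
    by (intro has_pd_unique has_pd_slice_fun_left even_smooth_pd assms)
  finally show ?thesis .
qed

lemma pd_pd_slice_fun_right:
  assumes "even_smooth A" "even_smooth B" "p \<le> i" "i < p + q" "x \<in> Omega"
  shows "pd i (pd i (slice_fun A B)) x = slice_fun (radial_quot A) (radial_quot B) x + (x i)\<^sup>2 *\<^sub>R slice_fun (radial_quot (radial_quot A)) (radial_quot (radial_quot B)) x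
    + (2 * x i) *\<^sub>R (gen i * radial_quot B (rho x))"
proof -
  note radial_quot = even_smooth_radial_quot[OF assms(1)] even_smooth_radial_quot[OF assms(2)]
  have "pd i (pd i (slice_fun A B)) x = pd i (\<lambda>x. x i *\<^sub>R slice_fun (radial_quot A) (radial_quot B) x + gen i * B (rho x)) x"
    by (rule pd_cong[OF nopen_Omega assms(5,4)]) (rule has_pd_unique[OF has_pd_slice_fun_right[OF assms(1-4)]])
  also have "\<dots> = (x i *\<^sub>R (x i *\<^sub>R slice_fun (radial_quot (radial_quot A)) (radial_quot (radial_quot B)) x + gen i * radial_quot B (rho x))
      + (if i = i then 1 else 0) *\<^sub>R slice_fun (radial_quot A) (radial_quot B) x) + gen i * (x i *\<^sub>R radial_quot B (rho x))"
    by (intro has_pd_unique has_pd_add has_pd_linear[OF bounded_linear_mult_right]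
        has_pd_bilinear[OF bounded_bilinear_scaleR] has_pd_coord has_pd_slice_fun_right has_pd_rho_right assms radial_quot)
  also have "\<dots> = slice_fun (radial_quot A) (radial_quot B) x + (x i)\<^sup>2 *\<^sub>R slice_fun (radial_quot (radial_quot A)) (radial_quot (radial_quot B)) x
    + (2 * x i) *\<^sub>R (gen i * radial_quot B (rho x))"
    by (simp add: scaleR_add_right power2_eq_square scaleR_2 flip: scaleR_scaleR)
  finally show ?thesis .
qed

lemma sum_split_pq: "(\<Sum>i<p + q. f i) = (\<Sum>i<p. f i) + (\<Sum>i\<in>{p..<p + q}. f i :: clifford)"
  unfolding lessThan_atLeast0 by (rule sum.atLeastLessThan_concat[symmetric]) auto

text \<open>The variables of \<open>x\<^sub>q\<close> give \<open>real q\<close> times the next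
  slice function, an \<open>r\<^sup>2\<close> term that cancels against the one from
  \<open>vekua_laplacian\<close>, and \<open>2 *\<^sub>R (xq x * radial_quot B)\<close>. That last
  term lowers the \<open>2 m + 3\<close> at \<open>B\<close> to the \<open>2 m + 1\<close> at
  \<open>A\<close>, so both parts receive the same factor.\<close>

lemma helmholtz_slice_fun:
  assumes v: "vekua lam m A B" and x: "x \<in> Omega"
  shows "helmholtz (p + q) lam (slice_fun A B) x = (real q - 1 - 2 * real m) *\<^sub>R slice_fun (radial_quot A) (radial_quot B) x"
proof -
  have A: "even_smooth A" and B: "even_smooth B" using v by (auto simp: vekua_def)
  let ?y = "rho x"
  have "(\<Sum>i<p. pd i (pd i (slice_fun A B)) x) = (\<Sum>i<p. slice_fun (pd i (pd i A)) (pd i (pd i B)) x)"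
    by (intro sum.cong refl pd_pd_slice_fun_left A B x) simp
  also have "\<dots> = (\<Sum>i<p. pd i (pd i A) ?y) + xq x * (\<Sum>i<p. pd i (pd i B) ?y)"
    by (simp add: slice_fun_def sum.distrib sum_distrib_left)
  also have "\<dots> = - (real (2 * m + 1) *\<^sub>R radial_quot A ?y + (rad x)\<^sup>2 *\<^sub>R radial_quot (radial_quot A) ?y + lam\<^sup>2 *\<^sub>R A ?y)
      + xq x * (- (real (2 * m + 3) *\<^sub>R radial_quot B ?y + (rad x)\<^sup>2 *\<^sub>R radial_quot (radial_quot B) ?y + lam\<^sup>2 *\<^sub>R B ?y))"
    unfolding vekua_laplacian[OF v rho_in[OF x]] rho_p ..
  finally have 1: "(\<Sum>i<p. pd i (pd i (slice_fun A B)) x) = \<dots>" .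
  have "(\<Sum>i\<in>{p..<p + q}. pd i (pd i (slice_fun A B)) x) = (\<Sum>i\<in>{p..<p + q}. slice_fun (radial_quot A) (radial_quot B) x
      + (x i)\<^sup>2 *\<^sub>R slice_fun (radial_quot (radial_quot A)) (radial_quot (radial_quot B)) x + (2 * x i) *\<^sub>R (gen i * radial_quot B ?y))"
    by (intro sum.cong refl pd_pd_slice_fun_right A B x) auto
  also have "\<dots> = real q *\<^sub>R slice_fun (radial_quot A) (radial_quot B) x + (rad x)\<^sup>2 *\<^sub>R slice_fun (radial_quot (radial_quot A)) (radial_quot (radial_quot B)) x
      + 2 *\<^sub>R (xq x * radial_quot B ?y)"
    by (simp add: sum.distrib rad_square xq_def sum_distrib_right scaleR_sum_left scaleR_sum_right
        sum_constant_scaleR del: sum_constant)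
  finally have 2: "(\<Sum>i\<in>{p..<p + q}. pd i (pd i (slice_fun A B)) x) = \<dots>" .
  have 3: "3 *\<^sub>R u = u + 2 *\<^sub>R u" for u :: clifford
    using scaleR_add_left[of 1 2 u] by simp
  show ?thesis
    unfolding helmholtz_def laplacian_def partial_deriv_eq_pd sum_split_pq 1 2
    by (simp add: slice_fun_def algebra_simps 3)
qed

text \<open>Since \<open>xq x\<close> anticommutes with the generators of \<open>Dp\<close>, the
  first \<open>p\<close> variables give \<open>Dp A - xq x * Dp B\<close>. The rest adds
  \<open>xq x * radial_quot A\<close>, the \<open>r\<^sup>2\<close> term with a minus sign, and
  \<open>- q\<close> copies of \<open>B\<close>. Against the system only
  \<open>(2 m + 1 - q)\<close> copies of \<open>B\<close> remain besides the \<open>lam\<close>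
  terms, and these vanish.\<close>

lemma dirac_slice_fun:
  assumes v: "vekua lam m A B" and x: "x \<in> Omega" and q: "q = 2 * m + 1"
  shows "dirac (p + q) (slice_fun A B) x = lam *\<^sub>R slice_fun A B x"
proof -
  have A: "even_smooth A" and B: "even_smooth B" using v by (auto simp: vekua_def)
  let ?y = "rho x"
  have "(\<Sum>i<p. gen i * pd i (slice_fun A B) x) = (\<Sum>i<p. gen i * pd i A ?y - xq x * (gen i * pd i B ?y))"
  proof (intro sum.cong refl)
    fix i assume i: "i \<in> {..<p}"
    then have "pd i (slice_fun A B) x = slice_fun (pd i A) (pd i B) x" by (intro has_pd_unique has_pd_slice_fun_left A B x) simp
    moreover have "gen i * (xq x * pd i B ?y) = - (xq x * (gen i * pd i B ?y))"
      using gen_xq[of i x] i by (simp flip: mult.assoc)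
    ultimately show "gen i * pd i (slice_fun A B) x = gen i * pd i A ?y - xq x * (gen i * pd i B ?y)"
      by (simp add: slice_fun_def distrib_left)
  qed
  also have "\<dots> = Dp A ?y - xq x * Dp B ?y"
    by (simp add: Dp_def sum_subtractf sum_distrib_left)
  finally have 1: "(\<Sum>i<p. gen i * pd i (slice_fun A B) x) = Dp A ?y - xq x * Dp B ?y" .
  have "(\<Sum>i\<in>{p..<p + q}. gen i * pd i (slice_fun A B) x)
      = (\<Sum>i\<in>{p..<p + q}. x i *\<^sub>R gen i * slice_fun (radial_quot A) (radial_quot B) x - B ?y)"
  proof (intro sum.cong refl)
    fix i assume i: "i \<in> {p..<p + q}"
    then have "pd i (slice_fun A B) x = x i *\<^sub>R slice_fun (radial_quot A) (radial_quot B) x + gen i * B (rho x)"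
      by (intro has_pd_unique has_pd_slice_fun_right A B x) auto
    then show "gen i * pd i (slice_fun A B) x = x i *\<^sub>R gen i * slice_fun (radial_quot A) (radial_quot B) x - B ?y"
      by (simp add: distrib_left gen_square flip: mult.assoc)
  qed
  also have "\<dots> = xq x * slice_fun (radial_quot A) (radial_quot B) x - real q *\<^sub>R B ?y"
    by (simp add: xq_def sum_subtractf sum_distrib_right sum_constant_scaleR del: sum_constant)
  also have "\<dots> = xq x * radial_quot A ?y - (rad x)\<^sup>2 *\<^sub>R radial_quot B ?y - real q *\<^sub>R B ?y"
    by (simp add: slice_fun_def distrib_left xq_square flip: mult.assoc)
  finally have 2: "(\<Sum>i\<in>{p..<p + q}. gen i * pd i (slice_fun A B) x) = \<dots>" .
  have e: "Dp A ?y = real q *\<^sub>R B ?y + (rad x)\<^sup>2 *\<^sub>R radial_quot B ?y + lam *\<^sub>R A ?y"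
    "Dp B ?y = radial_quot A ?y - lam *\<^sub>R B ?y"
    using v rho_in[OF x] unfolding vekua_def rho_p[symmetric] arg_cong[OF q, of real] by blast+
  show ?thesis
    unfolding dirac_def partial_deriv_eq_pd sum_split_pq 1 2 e
    by (simp add: slice_fun_def algebra_simps)
qed

lemma slice_fun_scaleR: "slice_fun (\<lambda>x. c *\<^sub>R A x) (\<lambda>x. c *\<^sub>R B x) x = c *\<^sub>R slice_fun A B x"
  by (simp add: slice_fun_def scaleR_add_right)

lemma helmholtz_cong:
  assumes "\<And>x. x \<in> Omega \<Longrightarrow> f x = g x" "x \<in> Omega"
  shows "helmholtz (p + q) lam f x = helmholtz (p + q) lam g x"
proof -
  have "pd i f y = pd i g y" if "i < p + q" "y \<in> Omega" for i y
    using that by (intro pd_cong[OF nopen_Omega] assms)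
  then have "pd i (pd i f) x = pd i (pd i g) x" if "i < p + q" for i
    using that assms by (intro pd_cong[OF nopen_Omega]) auto
  then show ?thesis using assms by (simp add: helmholtz_def laplacian_def partial_deriv_eq_pd)
qed

text \<open>The existential pair hides the scalar factors, so no product of the numbers
  \<open>q - 1 - 2 k\<close> has to be carried along. Agreement on the open set \<open>Omega\<close>
  is enough, as it determines all derivatives there.\<close>

lemma helmholtz_power_slice_fun:
  assumes "vekua lam 0 A0 B0" "\<And>x. x \<in> Omega \<Longrightarrow> f x = slice_fun A0 B0 x"
  shows "\<exists>A B. vekua lam m A B \<and> (\<forall>x\<in>Omega. (helmholtz (p + q) lam ^^ m) f x = slice_fun A B x)"
proof (induction m)
  case 0
  then show ?case using assms by auto
next
  case (Suc m)
  then obtain A B where AB: "vekua lam m A B"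
    "\<And>x. x \<in> Omega \<Longrightarrow> (helmholtz (p + q) lam ^^ m) f x = slice_fun A B x" by blast
  let ?c = "real q - 1 - 2 * real m"
  have "(helmholtz (p + q) lam ^^ Suc m) f x = slice_fun (\<lambda>x. ?c *\<^sub>R radial_quot A x) (\<lambda>x. ?c *\<^sub>R radial_quot B x) x"
    if x: "x \<in> Omega" for x
    using helmholtz_cong[OF AB(2) x] helmholtz_slice_fun[OF AB(1) x] by (simp add: slice_fun_scaleR)
  then show ?case using vekua_scaleR[OF vekua_radial_quot[OF AB(1)]] by blast
qed

section \<open>Polar coordinates on the completion\<close>

lemma one_vector_eq_xq:
  assumes "\<And>i. i < p \<Longrightarrow> w i = 0"
  shows "one_vector (p + q) w = xq w"
  using assms by (simp add: one_vector_def sum_split_pq xq_def)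

lemma slice_sphere_iff:
  "w \<in> slice_sphere p q \<longleftrightarrow> (\<forall>i\<ge>p + q. w i = 0) \<and> (\<forall>i<p. w i = 0) \<and> rad w = 1"
proof -
  have "(one_vector (p + q) w)\<^sup>2 = - 1 \<longleftrightarrow> rad w = 1" if "\<forall>i<p. w i = 0"
  proof -
    have "(one_vector (p + q) w)\<^sup>2 = - ((rad w)\<^sup>2 *\<^sub>R 1)"
      using that by (simp add: one_vector_eq_xq power2_eq_square xq_square del: scaleR_one)
    then have "(one_vector (p + q) w)\<^sup>2 = - 1 \<longleftrightarrow> (rad w)\<^sup>2 *\<^sub>R (1 :: clifford) = 1 *\<^sub>R 1" by simp
    also have "\<dots> \<longleftrightarrow> (rad w)\<^sup>2 = 1" by (subst scaleR_cancel_right) simp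
    \<comment> \<open>As a square root \<open>rad w\<close> is nonnegative, which excludes
      \<open>-1\<close>.\<close>
    also have "\<dots> \<longleftrightarrow> rad w = 1"
      by (simp add: power2_eq_1_iff rad_def) (smt (verit) real_sqrt_ge_zero sum_nonneg zero_le_power2)
    finally show ?thesis .
  qed
  then show ?thesis by (auto simp: slice_sphere_def topspace_Euclidean_space)
qed

lemma rho_slice_point:
  assumes "xp \<in> topspace (Euclidean_space p)" "w \<in> slice_sphere p q" "0 \<le> r"
  shows "rho (slice_point xp r w) = xp(p := r)"
proof -
  have "rad (slice_point xp r w) = sqrt (\<Sum>j\<in>{p..<p + q}. r\<^sup>2 * (w j)\<^sup>2)"
    unfolding rad_def using assms(1)
    by (intro arg_cong[where f = sqrt] sum.cong refl) (auto simp: slice_point_def topspace_Euclidean_space power_mult_distrib)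
  also have "\<dots> = r * rad w"
    using assms(3) by (simp add: rad_def real_sqrt_mult flip: sum_distrib_left)
  also have "\<dots> = r" using assms(2) by (simp add: slice_sphere_iff)
  finally show ?thesis
    using assms by (auto simp: rho_def fun_eq_iff slice_point_def slice_sphere_iff topspace_Euclidean_space)
qed

text \<open>The direction is \<open>x\<^sub>q / r\<close>. On the axis any unit vector will do, and
  \<open>1 \<le> q\<close> ensures that the coordinate vector of index \<open>p\<close> is
  available.\<close>

lemma Omega_obtain:
  assumes "x \<in> Omega" "1 \<le> q"
  obtains xp w where "xp \<in> topspace (Euclidean_space p)" "w \<in> slice_sphere p q"
    "x = slice_point xp (rad x) w" "rho x = xp(p := rad x)" "xq x = rad x *\<^sub>R one_vector (p + q) w"
proof -
  define xp where "xp = (\<lambda>i. if i < p then x i else 0)"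
  have r0: "rad x \<ge> 0" by (simp add: rad_def sum_nonneg)
  have xp: "xp \<in> topspace (Euclidean_space p)" by (simp add: xp_def topspace_Euclidean_space)
  obtain w where w: "w \<in> slice_sphere p q" "\<And>i. p \<le> i \<Longrightarrow> i < p + q \<Longrightarrow> x i = rad x * w i"
  proof (cases "rad x = 0")
    case True
    have "(\<Sum>j\<in>{p..<p + q}. (x j)\<^sup>2) = 0" using True rad_square[of x] by simp
    then have z: "x i = 0" if "p \<le> i" "i < p + q" for i
      using that by (simp add: sum_nonneg_eq_0_iff)
    have "rad (\<lambda>i. if i = p then 1 else 0) = 1"
      using assms(2) by (simp add: rad_def if_distrib[of "\<lambda>t. t\<^sup>2"] sum.delta cong: if_cong)
    then have "(\<lambda>i. if i = p then 1 else 0) \<in> slice_sphere p q"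
      using assms(2) by (auto simp: slice_sphere_iff)
    then show ?thesis using that True z by simp
  next
    case False
    define w where "w = (\<lambda>i. if p \<le> i \<and> i < p + q then x i / rad x else 0)"
    have "(rad w)\<^sup>2 = (\<Sum>j\<in>{p..<p + q}. (x j)\<^sup>2 / (rad x)\<^sup>2)"
      unfolding rad_square[of w] by (intro sum.cong refl) (auto simp: w_def power_divide)
    also have "\<dots> = 1" using False by (simp flip: sum_divide_distrib rad_square[of x])
    finally have "rad w = 1"
      by (simp add: power2_eq_1_iff) (smt (verit) rad_def real_sqrt_ge_zero sum_nonneg zero_le_power2)
    then have "w \<in> slice_sphere p q" by (simp add: slice_sphere_iff w_def)
    then show ?thesis using False by (intro that[of w]) (auto simp: w_def)
  qed
  have x: "x = slice_point xp (rad x) w"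
  proof
    fix i
    consider "i < p" | "p \<le> i" "i < p + q" | "p + q \<le> i" by linarith
    then show "x i = slice_point xp (rad x) w i"
      by cases (use w assms(1) in \<open>auto simp: slice_point_def xp_def Omega_def slice_sphere_iff\<close>)
  qed
  have "xq x = rad x *\<^sub>R one_vector (p + q) w"
    using w by (simp add: one_vector_eq_xq slice_sphere_iff xq_def scaleR_sum_right)
  then show ?thesis
    using rho_slice_point[OF xp w(1) r0] x xp w(1) by (intro that[of xp w]) auto
qed

lemma completion_eq_Omega:
  assumes "1 \<le> q"
  shows "partially_symmetric_completion p q D = Omega"
proof (intro equalityI subsetI)
  fix x assume "x \<in> partially_symmetric_completion p q D"
  then obtain xp r w where *: "x = slice_point xp r w" "xp \<in> topspace (Euclidean_space p)"
    "w \<in> slice_sphere p q" "0 \<le> r" "xp(p := r) \<in> D"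
    by (auto simp: partially_symmetric_completion_def)
  then have "rho x \<in> D" using rho_slice_point by simp
  moreover have "\<forall>i\<ge>p + q. x i = 0"
    using * by (auto simp: slice_point_def slice_sphere_iff topspace_Euclidean_space)
  ultimately show "x \<in> Omega" by (simp add: Omega_def)
next
  fix x assume x: "x \<in> Omega"
  then obtain xp w where "xp \<in> topspace (Euclidean_space p)" "w \<in> slice_sphere p q"
    "x = slice_point xp (rad x) w" "rho x = xp(p := rad x)"
    using assms by (rule Omega_obtain)
  moreover have "rad x \<ge> 0" by (simp add: rad_def sum_nonneg)
  ultimately show "x \<in> partially_symmetric_completion p q D"
    using rho_in[OF x] unfolding partially_symmetric_completion_def by force
qed

end

theorem theorem3p8:
  fixes p q :: nat and D :: "(nat \<Rightarrow> real) set" and lam :: real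
    and F1 F2 f :: "(nat \<Rightarrow> real) \<Rightarrow> clifford"
  assumes "1 \<le> q" and "odd q"
    and "domain_in (p + 1) D"
    and "reflect p ` D = D"
    and "generalized_partial_slice p q D F1 F2 f"
    and "C_k_on (p + 1) 1 D F1" and "C_k_on (p + 1) 1 D F2"
    and "\<And>x. x \<in> D \<Longrightarrow> dirac p F1 x - partial_deriv p F2 x = lam *\<^sub>R F1 x"
    and "\<And>x. x \<in> D \<Longrightarrow> - dirac p F2 x + partial_deriv p F1 x = lam *\<^sub>R F2 x"
  shows "C_k_on (p + q) q (partially_symmetric_completion p q D) f \<and>
    (let g = (helmholtz (p + q) lam ^^ ((q - 1) div 2)) f
     in \<forall>x\<in>partially_symmetric_completion p q D. dirac (p + q) g x - lam *\<^sub>R g x = 0)"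
proof -
  interpret slice p q D
    using assms(3,4) by unfold_locales (auto simp: domain_in_def)
  have "F1 x \<in> clifford_algebra (p + q)" "F2 x \<in> clifford_algebra (p + q)" if "x \<in> D" for x
    using assms(5) that by (simp_all add: generalized_partial_slice_def image_subset_iff)
  note vals = this[THEN clifford_algebra_coeff_eq_0]
  have refl: "F1 (reflect p x) = F1 x" "F2 (reflect p x) = - F2 x" if "x \<in> D" for x
    using assms(5) that by (auto simp: generalized_partial_slice_def)
  have f: "f (slice_point xp r w) = F1 (xp(p := r)) + one_vector (p + q) w * F2 (xp(p := r))"
    if "xp \<in> topspace (Euclidean_space p)" "w \<in> slice_sphere p q" "0 \<le> r" "xp(p := r) \<in> D" for xp r w
    using assms(5) that by (auto simp: generalized_partial_slice_def)
  have e1: "Dp F1 x - pd p F2 x = lam *\<^sub>R F1 x" and e2: "- Dp F2 x + pd p F1 x = lam *\<^sub>R F2 x"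
    if "x \<in> D" for x
    using assms(8,9)[OF that] by (simp_all add: dirac_def partial_deriv_eq_pd Dp_def)
  have C1: "Ck (Suc p) 1 D F1" "Ck (Suc p) 1 D F2"
    using assms(6,7) by (simp_all only: C_k_on_eq_Ck Suc_eq_plus1)
  \<comment> \<open>The generator adjoined here is \<open>gen (p + q)\<close>, the first one outside
    the algebra of values.\<close>
  have sm: "smooth (Suc p) D F1" "smooth (Suc p) D F2"
    by (rule vekua_smooth[OF D C1 le_add1 vals e1[unfolded Dp_def] e2[unfolded Dp_def]]; assumption)+
  \<comment> \<open>\<open>F2\<close> is odd in \<open>r\<close> and vanishes on the axis, so the
    quotient is smooth and even.\<close>
  define B where "B = rquot p F2"
  have F2_axis: "F2 x = 0" if "x \<in> D" "x p = 0" for x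
  proof -
    have "reflect p x = x" using that(2) by (auto simp: reflect_def)
    then have "2 *\<^sub>R F2 x = 0" using refl(2)[OF that(1)] by (simp add: scaleR_2 eq_neg_iff_add_eq_0)
    then show ?thesis by simp
  qed
  have xB: "F2 x = x p *\<^sub>R B x" if "x \<in> D" for x
    using F2_axis[OF that] by (simp add: B_def rquot_def)
  have even_F1: "even_smooth F1"
    using sm(1) refl(1) vals(1) by (auto simp: even_smooth_def)
  have even_B: "even_smooth B"
    unfolding even_smooth_def
  proof (intro conjI ballI allI impI)
    note r = smooth_rquot[where S = "Pow {..<p + q}", OF D _ sm(2) F2_axis _ vals(2)]
    show "smooth (Suc p) D B" unfolding B_def by (rule r(1)) auto
    show "coeff (B x) A = 0" if "x \<in> D" "A \<notin> Pow {..<p + q}" for x A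
      unfolding B_def by (rule r(2)) (use that in auto)
    show "B (reflect p x) = B x" if "x \<in> D" for x
    proof (cases "x p = 0")
      case True
      then have "reflect p x = x" by (auto simp: reflect_def)
      then show ?thesis by simp
    next
      case False
      then show ?thesis using refl(2)[OF that] by (simp add: B_def rquot_def) (simp add: reflect_def)
    qed
  qed
  have vek: "vekua lam 0 F1 B"
    unfolding vekua_def
  proof (intro conjI ballI even_F1 even_B)
    fix x assume x: "x \<in> D"
    \<comment> \<open>The product rule on \<open>F2 = r B\<close> explains the start of the chain:
      the radial derivative is \<open>B\<close> plus \<open>r\<^sup>2\<close> times
      \<open>radial_quot B\<close>, so the coefficient of \<open>B\<close> is
      \<open>1 = 2 * 0 + 1\<close>.\<close>
    have "has_pd p (\<lambda>y. y p *\<^sub>R B y) (B x + x p *\<^sub>R pd p B x) x"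
      by (intro has_pd_coord_scaleR even_has_pd even_B x) simp
    then have "has_pd p F2 (B x + x p *\<^sub>R pd p B x) x"
      by (rule has_pd_cong[OF D x, rotated 2]) (simp_all add: xB)
    then have "pd p F2 x = B x + x p *\<^sub>R x p *\<^sub>R radial_quot B x"
      unfolding scaleR_radial_quot[OF even_B x] by (rule has_pd_unique)
    then show "Dp F1 x = real (2 * 0 + 1) *\<^sub>R B x + (x p)\<^sup>2 *\<^sub>R radial_quot B x + lam *\<^sub>R F1 x"
      using e1[OF x] by (simp add: power2_eq_square algebra_simps)
    show "Dp B x = radial_quot F1 x - lam *\<^sub>R B x"
    proof -
      \<comment> \<open>This is the second equation divided by \<open>r\<close>; the case
        \<open>r = 0\<close> is covered by \<open>scaleR_coord_cancel\<close>.\<close>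
      have "Dp B x = radial_quot F1 x + (- lam) *\<^sub>R B x"
      proof (rule scaleR_coord_cancel[OF _ _ _ x])
        show "smooth (Suc p) D (Dp B)" by (intro smooth_Dp even_smoothD(1) even_B)
        show "smooth (Suc p) D (\<lambda>x. radial_quot F1 x + (- lam) *\<^sub>R B x)"
          by (intro smooth_add smooth_scaleR_const D even_smoothD(1) even_smooth_radial_quot even_F1 even_B)
        fix x assume x: "x \<in> D"
        have "pd i F2 x = x p *\<^sub>R pd i B x" if i: "i < p" for i
        proof (rule has_pd_unique)
          have "has_pd i (\<lambda>y. y p *\<^sub>R B y) (x p *\<^sub>R pd i B x + (if i = p then 1 else 0) *\<^sub>R B x) x"
            using i by (intro has_pd_bilinear[OF bounded_bilinear_scaleR] has_pd_coord even_has_pd even_B x) simp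
          then have "has_pd i (\<lambda>y. y p *\<^sub>R B y) (x p *\<^sub>R pd i B x) x" using i by simp
          then show "has_pd i F2 (x p *\<^sub>R pd i B x) x"
            by (rule has_pd_cong[OF D x, rotated 2]) (use i in \<open>simp_all add: xB\<close>)
        qed
        then have "Dp F2 x = x p *\<^sub>R Dp B x" by (simp add: Dp_def scaleR_sum_right)
        then show "x p *\<^sub>R Dp B x = x p *\<^sub>R (radial_quot F1 x + (- lam) *\<^sub>R B x)"
          using e2[OF x] xB[OF x] scaleR_radial_quot[OF even_F1 x] by (simp add: algebra_simps)
      qed
      then show ?thesis by simp
    qed
  qed
  have fF: "f x = slice_fun F1 B x" if x: "x \<in> Omega" for x
  proof -
    obtain xp w where xw: "xp \<in> topspace (Euclidean_space p)" "w \<in> slice_sphere p q"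
      "x = slice_point xp (rad x) w" "rho x = xp(p := rad x)" "xq x = rad x *\<^sub>R one_vector (p + q) w"
      using x assms(1) by (rule Omega_obtain)
    have "rad x \<ge> 0" by (simp add: rad_def sum_nonneg)
    then have "f x = F1 (rho x) + one_vector (p + q) w * F2 (rho x)"
      using f[OF xw(1,2), of "rad x"] rho_in[OF x] xw(3,4) by simp
    then show ?thesis
      using xB[OF rho_in[OF x]] by (simp add: slice_fun_def xw(5) rho_p)
  qed
  obtain m where q: "q = 2 * m + 1" using assms(2) by (elim oddE)
  obtain A' B' where AB: "vekua lam m A' B'"
    "\<And>x. x \<in> Omega \<Longrightarrow> (helmholtz (p + q) lam ^^ m) f x = slice_fun A' B' x"
    using helmholtz_power_slice_fun[OF vek fF] by blast
  \<comment> \<open>The composed operator has order \<open>2 * ((q - 1) div 2) + 1 = q\<close>.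
    Since \<open>vector_derivative\<close> is total, this clause is what guarantees that the
    derivatives in the equation are genuine.\<close>
  have "C_k_on (p + q) q Omega f"
    unfolding C_k_on_eq_Ck
    by (rule smooth_Ck[OF smooth_cong[OF nopen_Omega fF[symmetric] smooth_slice_fun[OF even_F1 even_B]]])
  moreover have "dirac (p + q) ((helmholtz (p + q) lam ^^ m) f) x = lam *\<^sub>R (helmholtz (p + q) lam ^^ m) f x"
    if x: "x \<in> Omega" for x
  proof -
    have "dirac (p + q) ((helmholtz (p + q) lam ^^ m) f) x = dirac (p + q) (slice_fun A' B') x"
      unfolding dirac_def partial_deriv_eq_pd
      by (intro sum.cong refl arg_cong2[where f = "(*)"] pd_cong[OF nopen_Omega x] AB(2)) auto
    then show ?thesis using dirac_slice_fun[OF AB(1) x q] AB(2)[OF x] by simp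
  qed
  moreover have "(q - 1) div 2 = m" using q by simp
  ultimately show ?thesis
    unfolding completion_eq_Omega[OF assms(1)] by (simp add: Let_def)
qed

end
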